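(* Let $0<\epsilon\leq\frac1{10}$ and let $(G,L)$ be a $\left(\frac43+4\epsilon\right)\Delta$-extra-color edge-list-coloring instance, where $\Delta$ is the maximum degree of $G$ and $\frac{\ln^2(\Delta)}{\Delta}\leq\frac{\epsilon^3}{15}$. Let $(X,\pi_{m-1})$ be its associated weighted simplicial complex. Then for any $2\leq k\leq m$ and any face $\tau\in X$ of co-dimension $k$, $\lambda_2(P_\tau)\leq\frac{\epsilon+\frac1\epsilon}{k-1}$.
   Context: $G=(V,E)$ is a finite simple graph with $m=|E|$ edges, degrees $\Delta_G(v)$ and maximum degree $\Delta$; for an edge $e=\{u,v\}$, $\Delta_G(e)=\Delta_G(u)+\Delta_G(v)-2$ is the number of other edges sharing an endpoint with $e$. An edge-list-coloring instance $(G,L)$ assigns to each edge $e$ a set $L(e)\subseteq[q]$; a proper $L$-edge-list-coloring is $\sigma:E\to[q]$ with $\sigma(e)\in L(e)$ and $\sigma(e)\neq\sigma(f)$ whenever distinct $e,f$ share an endpoint. It is $\beta$-extra-color if $|L(e)|\geq\beta+\Delta_G(e)$ for all $e$. Write $ec$ for $(e,c)$. $X=X(G,L)$ is the pure $(m-1)$-dimensional simplicial complex whose facets are $\{e\sigma(e):e\in E\}$ for proper $\sigma$ (faces are subsets of facets), $\pi_{m-1}$ the uniform distribution on facets, $\mathrm{codim}(\tau)=m-|\tau|$, $X_\tau(0)=\{x\notin\tau:\tau\cup\{x\}\in X\}$. For $\tau$ of co-dimension $k\geq2$, the local walk $P_\tau$ on $X_\tau(0)$ has $P_\tau(x,y)=\frac1{k-1}\Pr_{\sigma\sim\pi_{m-1}}[y\in\sigma\mid\sigma\supseteq\tau\cup\{x\}]$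 for $x\neq y$ and zero diagonal; $\lambda_2(P_\tau)$ is its second largest eigenvalue. *)

theory Defs
  imports
    "HOL-Probability.Probability"
    "Jordan_Normal_Form.Char_Poly"
begin

section \<open>Graphs\<close>

definition simple_graph :: "'v set \<Rightarrow> 'v set set \<Rightarrow> bool" where
  "simple_graph V E \<longleftrightarrow> finite V \<and> (\<forall>e\<in>E. e \<subseteq> V \<and> card e = 2)"

definition degree_of :: "'v set set \<Rightarrow> 'v \<Rightarrow> nat" where
  "degree_of E v = card {e \<in> E. v \<in> e}"

text \<open>The extra 0 only serves to give the graph without vertices maximum degree 0.\<close>

definition max_degree :: "'v set \<Rightarrow> 'v set set \<Rightarrow> nat" where
  "max_degree V E = Max (insert 0 (degree_of E ` V))"

text \<open>For an edge of a simple graph both endpoints have degree at least 1, so the subtraction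
  of natural numbers does not truncate.\<close>

definition edge_degree :: "'v set set \<Rightarrow> 'v set \<Rightarrow> nat" where
  "edge_degree E e = (\<Sum>v\<in>e. degree_of E v) - 2"

section \<open>Edge-list-colorings\<close>

definition edge_list_instance ::
  "'v set \<Rightarrow> 'v set set \<Rightarrow> nat \<Rightarrow> ('v set \<Rightarrow> nat set) \<Rightarrow> bool" where
  "edge_list_instance V E q L \<longleftrightarrow> simple_graph V E \<and> (\<forall>e\<in>E. L e \<subseteq> {1..q})"

definition extra_color :: "real \<Rightarrow> 'v set set \<Rightarrow> ('v set \<Rightarrow> nat set) \<Rightarrow> bool" where
  "extra_color \<beta> E L \<longleftrightarrow> (\<forall>e\<in>E. real (card (L e)) \<ge> \<beta> + real (edge_degree E e))"

definition proper_coloring ::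
  "'v set set \<Rightarrow> ('v set \<Rightarrow> nat set) \<Rightarrow> ('v set \<Rightarrow> nat) \<Rightarrow> bool" where
  "proper_coloring E L \<sigma> \<longleftrightarrow>
     (\<forall>e\<in>E. \<sigma> e \<in> L e) \<and>
     (\<forall>e\<in>E. \<forall>f\<in>E. e \<noteq> f \<longrightarrow> e \<inter> f \<noteq> {} \<longrightarrow> \<sigma> e \<noteq> \<sigma> f)"

section \<open>The complex of partial colorings\<close>

text \<open>Simplices are sets of pairs \<open>(e, c)\<close>. Values of a coloring outside \<open>E\<close> do not matter,
  so facets correspond one-to-one to proper colorings \<open>E \<Rightarrow> [q]\<close>.\<close>

definition facets ::
  "'v set set \<Rightarrow> ('v set \<Rightarrow> nat set) \<Rightarrow> ('v set \<times> nat) set set" where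
  "facets E L = {(\<lambda>e. (e, \<sigma> e)) ` E | \<sigma>. proper_coloring E L \<sigma>}"

definition coloring_complex ::
  "'v set set \<Rightarrow> ('v set \<Rightarrow> nat set) \<Rightarrow> ('v set \<times> nat) set set" where
  "coloring_complex E L = {\<tau>. \<exists>F\<in>facets E L. \<tau> \<subseteq> F}"

definition facet_distribution ::
  "'v set set \<Rightarrow> ('v set \<Rightarrow> nat set) \<Rightarrow> ('v set \<times> nat) set pmf" where
  "facet_distribution E L = pmf_of_set (facets E L)"

definition codim :: "'v set set \<Rightarrow> ('v set \<times> nat) set \<Rightarrow> nat" where
  "codim E \<tau> = card E - card \<tau>"

definition link_vertices ::
  "'v set set \<Rightarrow> ('v set \<Rightarrow> nat set) \<Rightarrow> ('v set \<times> nat) set \<Rightarrow> ('v set \<times> nat) set" where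
  "link_vertices E L \<tau> = {x. x \<notin> \<tau> \<and> insert x \<tau> \<in> coloring_complex E L}"

text \<open>Only meaningful for \<open>\<tau>\<close> of co-dimension at least 2 and \<open>x\<close>, \<open>y\<close> in
  \<open>link_vertices E L \<tau>\<close>; then the conditioning event has positive probability.\<close>

definition local_walk ::
  "'v set set \<Rightarrow> ('v set \<Rightarrow> nat set) \<Rightarrow> ('v set \<times> nat) set \<Rightarrow>
   'v set \<times> nat \<Rightarrow> 'v set \<times> nat \<Rightarrow> real" where
  "local_walk E L \<tau> x y =
     (if x = y then 0
      else 1 / (real (codim E \<tau>) - 1) *
        measure_pmf.prob (cond_pmf (facet_distribution E L) {F. insert x \<tau> \<subseteq> F}) {F. y \<in> F})"

section \<open>Second largest eigenvalue\<close>

text \<open>A real kernel on a finite set is turned into a matrix by listing the set in an arbitrary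
  order; another order conjugates the matrix by a permutation and so leaves its characteristic
  polynomial unchanged.\<close>

definition kernel_mat :: "'a set \<Rightarrow> ('a \<Rightarrow> 'a \<Rightarrow> real) \<Rightarrow> real mat" where
  "kernel_mat S P =
     (let xs = (SOME xs. distinct xs \<and> set xs = S)
      in mat (length xs) (length xs) (\<lambda>(i, j). P (xs ! i) (xs ! j)))"

text \<open>Real eigenvalues, listed in decreasing order with their algebraic multiplicities. The local
  walks are reversible, so all their eigenvalues are real and the list has one entry per vertex of
  the link; index 1 (counting from 0) is the second largest eigenvalue.\<close>

definition eigenvalues_desc :: "real mat \<Rightarrow> real list" where
  "eigenvalues_desc A = rev (sorted_list_of_multiset (proots (char_poly A)))"

definition lambda2 :: "'a set \<Rightarrow> ('a \<Rightarrow> 'a \<Rightarrow> real) \<Rightarrow> real" where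
  "lambda2 S P = eigenvalues_desc (kernel_mat S P) ! 1"

end

theory Submission
  imports Defs
begin

text \<open>
  Pinning edges leaves a list coloring instance of the same kind, so it suffices to bound, for every
  such instance on \<open>k\<close> edges, the variance of \<open>S = (\<Sum>e. \<phi> (e, s e))\<close> under a uniform coloring \<open>s\<close>:
  the covariance operator \<open>K\<close> on functions of pairs (edge, color), with the inner product given by the
  marginals, is \<open>1 + (k - 1) P\<close> on functions of mean zero. We show \<open>K \<le> 1 + T\<close> for an explicit \<open>T\<close> by
  induction on \<open>k\<close> (matrix trickle-down). Averaging the law of total variance over the pinned edge gives
  \<open>k K - K\<^sup>2 \<le> (k - 1) + T'\<close>, where \<open>T'\<close> is the sum over the edges of the mean operator of the pinned
  instance, so what is needed is \<open>T' \<le> (k - 2) T - T\<^sup>2\<close>.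

  We take \<open>T = (\<Sum>v. G v D v - R v)\<close>. Here \<open>D v\<close> restricts to the edges at \<open>v\<close>, and the entry of \<open>R v\<close> at
  two edges at \<open>v\<close> and a common color is the mean product of their Glauber update probabilities. These
  entries are martingales under pinning, and up to an error \<open>O(1 / \<beta>)\<close> the form \<open>R v\<close> lies between \<open>0\<close> and
  \<open>d / \<beta>\<close>, where \<open>d\<close> is the degree of \<open>v\<close> and \<open>1 / \<beta> = t = 3 / (4 \<Delta>)\<close>. Hence, as long as \<open>G v\<close> is at least
  \<open>d / (2 \<beta>)\<close>, the norm of \<open>G v D v - R v\<close> is about \<open>G v\<close>. As every edge has two endpoints, \<open>T\<^sup>2\<close> is at most
  twice the sum of the squares at the vertices, and the requirement becomes a recursion for \<open>G\<close> in the
  degree. It has no solution for two adjacent edges that meet no other edge; such a component is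
  independent of the rest and is split off, like isolated edges.

  The hypothesis on \<open>\<Delta>\<close> only serves to make \<open>\<Delta>\<close> large unless it is 1. The resulting bound \<open>T \<le> 10\<close>
  suffices because \<open>10 \<le> \<epsilon> + 1 / \<epsilon>\<close>.
\<close>

section \<open>Quadratic forms on finite sets\<close>

text \<open>Origin of \<open>T\<close>: adjacent edges never share a color, so at a common color
  their joint probability falls short of the product of the marginals by that whole product, and
  \<open>- R v\<close> is this leading covariance. A pair of edges survives all but two of the
  \<open>k\<close> pinnings, so \<open>R v\<close>, being built from martingales, satisfies the
  required recursion with equality. The cost \<open>T\<^sup>2\<close> must then be paid by the
  diagonal weights alone, which drop when an edge at \<open>v\<close> is pinned. Keeping
  \<open>G v\<close> at least half of \<open>d / \<beta>\<close> fixes the initial value of their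
  recursion; its solution blows up as \<open>d / \<beta>\<close> approaches 1, and the surplus
  \<open>4 / 3 * \<Delta>\<close> keeps \<open>d / \<beta>\<close> at most \<open>3 / 4\<close>. A
  second obstacle is that an inequality between \<open>k K - K\<^sup>2\<close> and
  \<open>k J - J\<^sup>2\<close>, where \<open>J = 1 + T\<close>, does not tell the two branches of
  the quadratic apart. A cruder scalar bound \<open>K \<le> k / 2\<close>, itself obtained by
  trickle-down, selects the lower branch.\<close>

lemma quadratic_nonpos_imp_linear_zero:
  fixes a b :: real
  assumes "\<And>s. 2 * s * b + s\<^sup>2 * a \<le> 0"
  shows "b = 0"
proof (rule ccontr)
  assume b: "b \<noteq> 0"
  define D where "D = \<bar>a\<bar> + 1"
  define s where "s = b / D"
  have D: "D > 0" by (simp add: D_def)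
  then have "2 * s * b + s\<^sup>2 * a = b\<^sup>2 / D\<^sup>2 * (2 * D + a)"
    by (simp add: s_def power2_eq_square field_simps)
  moreover have "b\<^sup>2 / D\<^sup>2 > 0"
    using b D by simp
  moreover have "2 * D + a > 0" by (simp add: D_def)
  ultimately have "2 * s * b + s\<^sup>2 * a > 0" by (metis mult_pos_pos)
  then show False using assms[of s] by simp
qed

text \<open>Vectors are functions on a whole type with the product topology, so this is Tychonoff's
  theorem and holds for infinite types as well.\<close>

lemma compact_weighted_box:
  fixes c :: "'x \<Rightarrow> real"
  shows "compact (PiE UNIV (\<lambda>x. {- c x..c x}))"
proof -
  have "compactin (product_topology (\<lambda>x. euclidean) UNIV) (PiE UNIV (\<lambda>x. {- c x..c x}))"
    by (subst compactin_PiE) auto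
  then show ?thesis
    by (simp add: euclidean_product_topology)
qed

definition quad :: "'x set \<Rightarrow> ('x \<Rightarrow> 'x \<Rightarrow> real) \<Rightarrow> ('x \<Rightarrow> real) \<Rightarrow> real" where
  "quad X b \<phi> = (\<Sum>x\<in>X. \<Sum>y\<in>X. b x y * \<phi> x * \<phi> y)"

lemma quad_add_scaled:
  assumes "\<And>x y. x \<in> X \<Longrightarrow> y \<in> X \<Longrightarrow> b x y = b y x"
  shows "quad X b (\<lambda>x. \<phi> x + s * \<psi> x) =
    quad X b \<phi> + 2 * s * (\<Sum>x\<in>X. \<psi> x * (\<Sum>y\<in>X. b x y * \<phi> y)) + s\<^sup>2 * quad X b \<psi>"
proof -
  have "(\<Sum>x\<in>X. \<Sum>y\<in>X. b x y * \<phi> x * \<psi> y) = (\<Sum>y\<in>X. \<Sum>x\<in>X. b x y * \<phi> x * \<psi> y)"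
    by (rule sum.swap)
  also have "\<dots> = (\<Sum>x\<in>X. \<psi> x * (\<Sum>y\<in>X. b x y * \<phi> y))"
    unfolding sum_distrib_left using assms by (intro sum.cong refl) (auto simp: mult_ac)
  finally have 1: "(\<Sum>x\<in>X. \<Sum>y\<in>X. b x y * \<phi> x * \<psi> y) = (\<Sum>x\<in>X. \<psi> x * (\<Sum>y\<in>X. b x y * \<phi> y))" .
  have "quad X b (\<lambda>x. \<phi> x + s * \<psi> x) =
     (\<Sum>x\<in>X. \<Sum>y\<in>X. b x y * \<phi> x * \<phi> y + s * (b x y * \<phi> x * \<psi> y)
       + s * (\<psi> x * (b x y * \<phi> y)) + s\<^sup>2 * (b x y * \<psi> x * \<psi> y))"
    unfolding quad_def by (intro sum.cong refl) (simp add: algebra_simps power2_eq_square)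
  also have "\<dots> = quad X b \<phi> + s * (\<Sum>x\<in>X. \<Sum>y\<in>X. b x y * \<phi> x * \<psi> y)
      + s * (\<Sum>x\<in>X. \<psi> x * (\<Sum>y\<in>X. b x y * \<phi> y)) + s\<^sup>2 * quad X b \<psi>"
    unfolding quad_def by (simp add: sum.distrib sum_distrib_left)
  finally show ?thesis using 1 by simp
qed

lemma quad_scale: "quad X b (\<lambda>x. s * \<phi> x) = s\<^sup>2 * quad X b \<phi>"
  unfolding quad_def sum_distrib_left
  by (intro sum.cong refl) (simp add: power2_eq_square mult_ac)

lemma weighted_norm_add_scaled:
  fixes \<phi> :: "'x \<Rightarrow> real"
  shows "(\<Sum>x\<in>X. w x * (\<phi> x + s * \<psi> x)\<^sup>2) =
    (\<Sum>x\<in>X. w x * (\<phi> x)\<^sup>2) + 2 * s * (\<Sum>x\<in>X. \<psi> x * (w x * \<phi> x)) + s\<^sup>2 * (\<Sum>x\<in>X. w x * (\<psi> x)\<^sup>2)"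
  unfolding sum_distrib_left sum.distrib[symmetric]
  by (intro sum.cong refl) (simp add: power2_eq_square algebra_simps)

text \<open>A maximiser of the Rayleigh quotient exists by compactness of the unit sphere, and the first
  variation at the maximiser is the eigenvalue equation.\<close>

lemma exists_top_eigenvector:
  fixes b :: "'x \<Rightarrow> 'x \<Rightarrow> real"
  assumes fin: "finite X" and ne: "X \<noteq> {}"
    and sym: "\<And>x y. b x y = b y x" and wpos: "\<forall>x\<in>X. w x > 0"
  shows "\<exists>\<mu> \<phi>. (\<Sum>x\<in>X. w x * (\<phi> x)\<^sup>2) > 0 \<and>
    (\<forall>x\<in>X. (\<Sum>y\<in>X. b x y * \<phi> y) = \<mu> * (w x * \<phi> x)) \<and>
    (\<forall>\<psi>. quad X b \<psi> \<le> \<mu> * (\<Sum>x\<in>X. w x * (\<psi> x)\<^sup>2))"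
proof -
  have w: "w x > 0" if "x \<in> X" for x using wpos that by blast
  have qas: "quad X b (\<lambda>x. \<phi> x + s * \<psi> x) =
    quad X b \<phi> + 2 * s * (\<Sum>x\<in>X. \<psi> x * (\<Sum>y\<in>X. b x y * \<phi> y)) + s\<^sup>2 * quad X b \<psi>" for \<phi> \<psi> s
    using sym by (rule quad_add_scaled)
  define nrm where "nrm = (\<lambda>\<phi>. \<Sum>x\<in>X. w x * (\<phi> x)\<^sup>2)"
  \<comment> \<open>A vector with \<open>nrm \<phi> = 1\<close> obeys these coordinate bounds on
    \<open>X\<close>. The value 0 elsewhere pins the coordinates that the form does not see, so that
    the sphere becomes a closed part of a compact box.\<close>
  define c where "c = (\<lambda>x. if x \<in> X then sqrt (1 / w x) else 0)"
  define S where "S = PiE UNIV (\<lambda>x. {- c x..c x}) \<inter> {\<phi>. nrm \<phi> = 1}"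
  have cont_nrm: "continuous_on UNIV nrm"
    unfolding nrm_def by (intro continuous_intros continuous_on_product_coordinates)
  have "closed {\<phi>. nrm \<phi> = 1}"
    using cont_nrm by (intro closed_Collect_eq) (auto intro: continuous_intros)
  then have compS: "compact S"
    unfolding S_def by (intro compact_Int_closed compact_weighted_box)
  have in_S: "(\<lambda>x. if x \<in> X then \<phi> x else 0) \<in> S" if n: "nrm \<phi> = 1" for \<phi>
  proof -
    have "\<bar>\<phi> x\<bar> \<le> sqrt (1 / w x)" if x: "x \<in> X" for x
    proof -
      have "w x * (\<phi> x)\<^sup>2 \<le> nrm \<phi>" unfolding nrm_def
        using fin x w by (intro member_le_sum) (auto simp: less_imp_le)
      then have "(\<phi> x)\<^sup>2 \<le> 1 / w x" using w[OF x] n by (simp add: field_simps)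
      then show ?thesis by (metis real_sqrt_abs real_sqrt_le_mono)
    qed
    moreover have "nrm (\<lambda>x. if x \<in> X then \<phi> x else 0) = nrm \<phi>" by (simp add: nrm_def)
    ultimately show ?thesis using n unfolding S_def c_def
      by (auto simp: abs_le_iff minus_le_iff)
  qed
  obtain x0 where x0: "x0 \<in> X" using ne by auto
  have "nrm (\<lambda>x. if x = x0 then sqrt (1 / w x0) else 0) = (\<Sum>x\<in>X. if x = x0 then 1 else 0)"
    unfolding nrm_def using w[OF x0] by (intro sum.cong) auto
  also have "\<dots> = 1" using fin x0 by simp
  finally have "S \<noteq> {}" using in_S by blast
  moreover have "continuous_on S (quad X b)"
    unfolding quad_def
    by (intro continuous_intros continuous_on_subset[OF continuous_on_product_coordinates]) auto
  ultimately obtain \<phi> where \<phi>: "\<phi> \<in> S" and max: "\<And>\<psi>. \<psi> \<in> S \<Longrightarrow> quad X b \<psi> \<le> quad X b \<phi>"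
    using continuous_attains_sup[OF compS] by blast
  define \<mu> where "\<mu> = quad X b \<phi>"
  have n1: "nrm \<phi> = 1" using \<phi> by (simp add: S_def)
  have bound: "quad X b \<psi> \<le> \<mu> * nrm \<psi>" for \<psi>
  proof (cases "nrm \<psi> = 0")
    case True
    then have "\<psi> x = 0" if "x \<in> X" for x
    proof -
      have "w x * (\<psi> x)\<^sup>2 = 0"
        using True that fin w unfolding nrm_def
        by (subst (asm) sum_nonneg_eq_0_iff) (auto simp: less_imp_le)
      then show ?thesis using w[OF that] by simp
    qed
    then show ?thesis using True by (simp add: quad_def)
  next
    case False
    have "nrm \<psi> \<ge> 0" unfolding nrm_def using w by (intro sum_nonneg) (auto simp: less_imp_le)
    with False have pos: "nrm \<psi> > 0" by simp
    define r where "r = 1 / sqrt (nrm \<psi>)"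
    have r2: "r\<^sup>2 = 1 / nrm \<psi>" using pos by (simp add: r_def power_divide)
    have "nrm (\<lambda>x. r * \<psi> x) = r\<^sup>2 * nrm \<psi>"
      unfolding nrm_def by (simp add: power_mult_distrib sum_distrib_left mult_ac)
    then have "nrm (\<lambda>x. r * \<psi> x) = 1" using r2 pos by simp
    from max[OF in_S[OF this]] have "quad X b (\<lambda>x. r * \<psi> x) \<le> \<mu>"
      unfolding \<mu>_def by (simp add: quad_def cong: sum.cong)
    then have "quad X b \<psi> / nrm \<psi> \<le> \<mu>" by (simp add: quad_scale r2)
    then show ?thesis using pos by (simp add: field_simps)
  qed
  have eq: "(\<Sum>y\<in>X. b x y * \<phi> y) = \<mu> * (w x * \<phi> x)" if x: "x \<in> X" for x
  proof -
    define \<psi> where "\<psi> = (\<lambda>y. if y = x then 1 else 0 :: real)"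
    have pick: "(\<Sum>y\<in>X. \<psi> y * f y) = f x" for f
      using fin x by (simp add: \<psi>_def if_distrib[of "\<lambda>u. u * _"] cong: if_cong)
    have "2 * s * ((\<Sum>y\<in>X. b x y * \<phi> y) - \<mu> * (w x * \<phi> x))
      + s\<^sup>2 * (quad X b \<psi> - \<mu> * nrm \<psi>) \<le> 0" for s
      using bound[of "\<lambda>x. \<phi> x + s * \<psi> x"]
      unfolding nrm_def weighted_norm_add_scaled qas pick
      using n1[unfolded nrm_def] by (simp add: \<mu>_def[symmetric] algebra_simps)
    from quadratic_nonpos_imp_linear_zero[OF this] show ?thesis by simp
  qed
  show ?thesis
    using n1 eq bound unfolding nrm_def by (intro exI[of _ \<mu>] exI[of _ \<phi>]) simp
qed

text \<open>For a self-adjoint operator the numerical radius is the norm. This converts the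
  two-sided bound on the form at a vertex into a bound on the square of its operator; polarisation
  and the parallelogram law replace a spectral decomposition.\<close>

lemma operator_norm_le_of_form:
  fixes b :: "'x \<Rightarrow> 'x \<Rightarrow> real"
  assumes sym: "\<And>x y. x \<in> X \<Longrightarrow> y \<in> X \<Longrightarrow> b x y = b y x"
    and w: "\<And>x. x \<in> X \<Longrightarrow> w x > 0" and r: "r \<ge> 0"
    and form: "\<And>\<psi>. \<bar>quad X b \<psi>\<bar> \<le> r * (\<Sum>x\<in>X. w x * (\<psi> x)\<^sup>2)"
  shows "(\<Sum>x\<in>X. (\<Sum>y\<in>X. b x y * \<phi> y)\<^sup>2 / w x) \<le> r\<^sup>2 * (\<Sum>x\<in>X. w x * (\<phi> x)\<^sup>2)"
proof -
  have qas: "quad X b (\<lambda>x. \<phi> x + s * \<psi> x) =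
    quad X b \<phi> + 2 * s * (\<Sum>x\<in>X. \<psi> x * (\<Sum>y\<in>X. b x y * \<phi> y)) + s\<^sup>2 * quad X b \<psi>" for \<phi> \<psi> s
    using sym by (rule quad_add_scaled)
  define T where "T = (\<lambda>x. (\<Sum>y\<in>X. b x y * \<phi> y) / w x)"
  define N where "N = (\<lambda>\<phi>. \<Sum>x\<in>X. w x * (\<phi> x)\<^sup>2)"
  define I where "I = (\<Sum>x\<in>X. \<phi> x * (w x * T x))"
  have N0: "N \<psi> \<ge> 0" for \<psi> unfolding N_def using w by (intro sum_nonneg) (auto simp: less_imp_le)
  have lhs: "(\<Sum>x\<in>X. (\<Sum>y\<in>X. b x y * \<phi> y)\<^sup>2 / w x) = N T"
    unfolding N_def T_def by (intro sum.cong refl) (simp add: power2_eq_square)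
  have cross: "(\<Sum>x\<in>X. T x * (\<Sum>y\<in>X. b x y * \<phi> y)) = N T"
    unfolding N_def using w by (intro sum.cong refl) (auto simp: T_def power2_eq_square dest: less_imp_neq)
  \<comment> \<open>polarisation along \<open>\<phi> \<plusminus> s T\<phi>\<close>\<close>
  have key: "4 * s * N T \<le> r * (2 * N \<phi> + 2 * s\<^sup>2 * N T)" for s
  proof -
    have "quad X b (\<lambda>x. \<phi> x + s * T x) - quad X b (\<lambda>x. \<phi> x + (- s) * T x) = 4 * s * N T"
      unfolding qas cross by simp
    moreover have "quad X b (\<lambda>x. \<phi> x + s * T x) \<le> r * N (\<lambda>x. \<phi> x + s * T x)"
      "- quad X b (\<lambda>x. \<phi> x + (- s) * T x) \<le> r * N (\<lambda>x. \<phi> x + (- s) * T x)"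
      using form unfolding N_def abs_le_iff by blast+
    ultimately have "4 * s * N T \<le> r * (N (\<lambda>x. \<phi> x + s * T x) + N (\<lambda>x. \<phi> x + (- s) * T x))"
      unfolding distrib_left by linarith
    also have "N (\<lambda>x. \<phi> x + s * T x) + N (\<lambda>x. \<phi> x + (- s) * T x) = 2 * N \<phi> + 2 * s\<^sup>2 * N T"
      unfolding N_def weighted_norm_add_scaled by simp
    finally show ?thesis .
  qed
  show ?thesis
  proof (cases "r = 0")
    case True
    then show ?thesis using key[of 1] N0[of T] lhs by (simp add: N_def)
  next
    case False
    with r have "r > 0" by simp
    have "4 * (1 / r) * N T \<le> r * (2 * N \<phi> + 2 * (1 / r)\<^sup>2 * N T)" by (rule key)
    then have "4 * N T \<le> 2 * r\<^sup>2 * N \<phi> + 2 * N T"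
      using \<open>r > 0\<close> by (simp add: field_simps power2_eq_square)
    then show ?thesis using lhs by (simp add: N_def)
  qed
qed

section \<open>Variances on sets of functions\<close>

definition ssum :: "'e set \<Rightarrow> ('e \<times> 'c \<Rightarrow> real) \<Rightarrow> ('e \<Rightarrow> 'c) \<Rightarrow> real" where
  "ssum U \<phi> s = (\<Sum>e\<in>U. \<phi> (e, s e))"

definition sqs :: "'e set \<Rightarrow> ('e \<times> 'c \<Rightarrow> real) \<Rightarrow> ('e \<Rightarrow> 'c) \<Rightarrow> real" where
  "sqs U \<phi> s = (\<Sum>e\<in>U. (\<phi> (e, s e))\<^sup>2)"

definition mean :: "'a set \<Rightarrow> ('a \<Rightarrow> real) \<Rightarrow> real" where
  "mean A f = (\<Sum>s\<in>A. f s) / real (card A)"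

text \<open>Unnormalised, like \<open>wt\<close>: the variance times \<open>card A\<close>.
  Contributions of fibers of different sizes then add up without weights.\<close>

definition vsum :: "'a set \<Rightarrow> ('a \<Rightarrow> real) \<Rightarrow> real" where
  "vsum A f = (\<Sum>s\<in>A. (f s - mean A f)\<^sup>2)"

definition fib :: "('e \<Rightarrow> 'c) set \<Rightarrow> 'e \<times> 'c \<Rightarrow> ('e \<Rightarrow> 'c) set" where
  "fib A x = {s \<in> A. s (fst x) = snd x}"

text \<open>Pairs that occur in no member of \<open>A\<close> are left out, which makes the weights
  \<open>wt\<close> positive and the weighted inner product definite.\<close>

definition pts :: "'e set \<Rightarrow> ('e \<Rightarrow> 'c) set \<Rightarrow> ('e \<times> 'c) set" where
  "pts U A = (\<Union>s\<in>A. (\<lambda>e. (e, s e)) ` U)"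

definition wt :: "('e \<Rightarrow> 'c) set \<Rightarrow> 'e \<times> 'c \<Rightarrow> real" where
  "wt A x = real (card (fib A x))"

lemma finite_pts [simp]: "finite A \<Longrightarrow> finite U \<Longrightarrow> finite (pts U A)"
  by (simp add: pts_def)

lemma finite_fib [simp]: "finite A \<Longrightarrow> finite (fib A x)"
  by (simp add: fib_def)

lemma fib_nonempty: "x \<in> pts U A \<Longrightarrow> fib A x \<noteq> {}"
  by (auto simp: pts_def fib_def)

lemma wt_pos: "finite A \<Longrightarrow> x \<in> pts U A \<Longrightarrow> wt A x > 0"
  using fib_nonempty[of x U A] by (simp add: wt_def card_gt_0_iff)

text \<open>A double count of the incidences between pairs and functions. \<open>B\<close> may be
  smaller than \<open>A\<close>, so that a fiber can be summed over the pairs of the whole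
  set.\<close>

lemma sum_pts:
  fixes h :: "('e \<Rightarrow> 'c) \<Rightarrow> 'e \<times> 'c \<Rightarrow> real"
  assumes "finite A" "finite U" "B \<subseteq> A"
  shows "(\<Sum>x\<in>pts U A. \<Sum>s\<in>fib B x. h s x) = (\<Sum>s\<in>B. \<Sum>e\<in>U. h s (e, s e))"
proof -
  have finB: "finite B" using assms finite_subset by blast
  have "(\<Sum>x\<in>pts U A. \<Sum>s\<in>fib B x. h s x) = (\<Sum>x\<in>pts U A. \<Sum>s\<in>B. if s (fst x) = snd x then h s x else 0)"
    using finB by (simp add: fib_def sum.inter_filter)
  also have "\<dots> = (\<Sum>s\<in>B. \<Sum>x\<in>pts U A. if s (fst x) = snd x then h s x else 0)"
    by (rule sum.swap)
  also have "\<dots> = (\<Sum>s\<in>B. \<Sum>e\<in>U. h s (e, s e))"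
  proof (intro sum.cong refl)
    fix s assume "s \<in> B"
    then have *: "{x \<in> pts U A. s (fst x) = snd x} = (\<lambda>e. (e, s e)) ` U"
      using assms by (auto simp: pts_def)
    have "(\<Sum>x\<in>pts U A. if s (fst x) = snd x then h s x else 0) = (\<Sum>x\<in>(\<lambda>e. (e, s e)) ` U. h s x)"
      using assms by (simp add: sum.inter_filter[symmetric] *)
    also have "\<dots> = (\<Sum>e\<in>U. h s (e, s e))"
      by (subst sum.reindex) (auto simp: inj_on_def)
    finally show "(\<Sum>x\<in>pts U A. if s (fst x) = snd x then h s x else 0) = (\<Sum>e\<in>U. h s (e, s e))" .
  qed
  finally show ?thesis .
qed

lemma sum_pts_wt:
  assumes "finite A" "finite U"
  shows "(\<Sum>x\<in>pts U A. wt A x * f x) = (\<Sum>s\<in>A. \<Sum>e\<in>U. f (e, s e))"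
  using sum_pts[OF assms, of A "\<lambda>_. f"] by (simp add: wt_def)

lemma sum_sqs_eq:
  assumes "finite A" "finite U"
  shows "sum (sqs U \<phi>) A = (\<Sum>x\<in>pts U A. wt A x * (\<phi> x)\<^sup>2)"
  using assms by (simp add: sum_pts_wt sqs_def)

lemma sqs_nonneg: "sqs U \<phi> s \<ge> 0"
  by (simp add: sqs_def sum_nonneg)

lemma sum_eq_card_mean:
  assumes "finite A" "A \<noteq> {}"
  shows "(\<Sum>s\<in>A. f s) = real (card A) * mean A f"
  using assms by (simp add: mean_def)

lemma sum_square_deviation:
  assumes "finite A" "A \<noteq> {}"
  shows "(\<Sum>s\<in>A. (f s - r)\<^sup>2) = vsum A f + real (card A) * (mean A f - r)\<^sup>2"
proof -
  let ?m = "mean A f"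
  have "(\<Sum>s\<in>A. (f s - r)\<^sup>2) = (\<Sum>s\<in>A. (f s - ?m)\<^sup>2 + 2 * (?m - r) * f s + (?m - r) * (- ?m - r))"
    by (intro sum.cong refl) (simp add: power2_eq_square algebra_simps)
  also have "\<dots> = vsum A f + 2 * (?m - r) * (real (card A) * ?m) + real (card A) * ((?m - r) * (- ?m - r))"
    unfolding sum.distrib vsum_def sum_distrib_left[symmetric] sum_eq_card_mean[OF assms, of f] by simp
  finally show ?thesis by (simp add: power2_eq_square algebra_simps)
qed

lemma vsum_le_sum_square:
  assumes "finite A" "A \<noteq> {}"
  shows "vsum A f \<le> (\<Sum>s\<in>A. (f s)\<^sup>2)"
  using sum_square_deviation[OF assms, of f 0] by simp

lemma vsum_eq:
  assumes "finite A" "A \<noteq> {}"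
  shows "vsum A f = (\<Sum>s\<in>A. (f s)\<^sup>2) - mean A f * (\<Sum>s\<in>A. f s)"
  using sum_square_deviation[OF assms, of f 0] assms
  by (simp add: sum_eq_card_mean[OF assms] power2_eq_square algebra_simps)

lemma mean_cong: "(\<And>s. s \<in> A \<Longrightarrow> f s = g s) \<Longrightarrow> mean A f = mean A g"
  by (simp add: mean_def)

lemma vsum_cong: "(\<And>s. s \<in> A \<Longrightarrow> f s = g s) \<Longrightarrow> vsum A f = vsum A g"
  using mean_cong[of A f g] by (simp add: vsum_def)

lemma vsum_shift:
  assumes "finite A" "A \<noteq> {}"
  shows "vsum A (\<lambda>s. f s + r) = vsum A f"
proof -
  have "mean A (\<lambda>s. f s + r) = mean A f + r"
    using assms by (simp add: mean_def sum.distrib add_divide_distrib)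
  then show ?thesis by (simp add: vsum_def)
qed

text \<open>For a single \<open>e\<close> the fibers over the pairs \<open>(e, c)\<close> partition
  \<open>A\<close> and the usual law of total variance applies; adding these laws over
  \<open>e\<close> produces the factor \<open>card U\<close>.\<close>

lemma total_variance:
  assumes A: "finite A" and U: "finite U"
  shows "real (card U) * vsum A f =
    (\<Sum>x\<in>pts U A. vsum (fib A x) f) + (\<Sum>x\<in>pts U A. wt A x * (mean (fib A x) f - mean A f)\<^sup>2)"
proof -
  have "(\<Sum>x\<in>pts U A. vsum (fib A x) f) + (\<Sum>x\<in>pts U A. wt A x * (mean (fib A x) f - mean A f)\<^sup>2)
      = (\<Sum>x\<in>pts U A. \<Sum>s\<in>fib A x. (f s - mean A f)\<^sup>2)"
    unfolding sum.distrib[symmetric] wt_def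
    using A by (intro sum.cong refl sum_square_deviation[symmetric]) (auto dest: fib_nonempty)
  also have "\<dots> = (\<Sum>s\<in>A. \<Sum>e\<in>U. (f s - mean A f)\<^sup>2)"
    using sum_pts[OF A U, of A "\<lambda>s x. (f s - mean A f)\<^sup>2"] by simp
  also have "\<dots> = real (card U) * vsum A f"
    by (simp add: vsum_def sum_distrib_left)
  finally show ?thesis by simp
qed

lemma ssum_remove:
  assumes "finite U" "x \<in> pts U A" "s \<in> fib A x"
  shows "ssum U \<phi> s = ssum (U - {fst x}) \<phi> s + \<phi> x"
  using assms by (auto simp: ssum_def fib_def pts_def sum.remove)

lemma vsum_fib_remove:
  assumes "finite A" "finite U" "x \<in> pts U A"
  shows "vsum (fib A x) (ssum U \<phi>) = vsum (fib A x) (ssum (U - {fst x}) \<phi>)"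
proof -
  have "vsum (fib A x) (ssum U \<phi>) = vsum (fib A x) (\<lambda>s. ssum (U - {fst x}) \<phi> s + \<phi> x)"
    using assms by (intro vsum_cong ssum_remove)
  then show ?thesis using assms fib_nonempty[OF assms(3)] by (simp add: vsum_shift)
qed

lemma quad_row: "quad X b \<phi> = (\<Sum>x\<in>X. \<phi> x * (\<Sum>y\<in>X. b x y * \<phi> y))"
  unfolding quad_def sum_distrib_left by (intro sum.cong refl) (simp add: mult_ac)

text \<open>The covariance of the indicators of \<open>x\<close> and \<open>y\<close>, times
  \<open>card A\<close>. Relative to the weights \<open>wt A\<close> it represents the operator
  \<open>K\<close>.\<close>

definition cov_kernel :: "('e \<Rightarrow> 'c) set \<Rightarrow> 'e \<times> 'c \<Rightarrow> 'e \<times> 'c \<Rightarrow> real" where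
  "cov_kernel A x y = real (card (fib (fib A x) y)) - wt A x * wt A y / real (card A)"

lemma cov_kernel_sym: "cov_kernel A x y = cov_kernel A y x"
proof -
  have "fib (fib A x) y = fib (fib A y) x" by (auto simp: fib_def)
  then show ?thesis by (simp add: cov_kernel_def)
qed

text \<open>Hence \<open>K \<phi>\<close> at \<open>x\<close> is the shift of the mean of
  \<open>ssum U \<phi>\<close> caused by pinning \<open>x\<close>, and the second term in
  \<open>total_variance\<close> is the squared norm of \<open>K \<phi>\<close>.\<close>

lemma cov_kernel_row:
  assumes A: "finite A" and U: "finite U" and x: "x \<in> pts U A"
  shows "(\<Sum>y\<in>pts U A. cov_kernel A x y * \<phi> y) =
    wt A x * (mean (fib A x) (ssum U \<phi>) - mean A (ssum U \<phi>))"
proof -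
  have "(\<Sum>y\<in>pts U A. cov_kernel A x y * \<phi> y) =
     (\<Sum>y\<in>pts U A. \<Sum>s\<in>fib (fib A x) y. \<phi> y) - wt A x / real (card A) * (\<Sum>y\<in>pts U A. wt A y * \<phi> y)"
    by (simp add: cov_kernel_def left_diff_distrib sum_subtractf sum_distrib_left mult.assoc)
  also have "(\<Sum>y\<in>pts U A. \<Sum>s\<in>fib (fib A x) y. \<phi> y) = (\<Sum>s\<in>fib A x. ssum U \<phi> s)"
    using sum_pts[OF A U, of "fib A x" "\<lambda>_. \<phi>"] by (simp add: fib_def ssum_def)
  also have "\<dots> = wt A x * mean (fib A x) (ssum U \<phi>)"
    using A fib_nonempty[OF x] by (simp add: sum_eq_card_mean wt_def)
  also have "(\<Sum>y\<in>pts U A. wt A y * \<phi> y) = (\<Sum>s\<in>A. ssum U \<phi> s)"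
    by (simp add: sum_pts_wt[OF A U] ssum_def)
  finally show ?thesis by (simp add: mean_def algebra_simps)
qed

lemma quad_cov_kernel:
  assumes A: "finite A" "A \<noteq> {}" and U: "finite U"
  shows "quad (pts U A) (cov_kernel A) \<phi> = vsum A (ssum U \<phi>)"
proof -
  let ?S = "ssum U \<phi>"
  have "quad (pts U A) (cov_kernel A) \<phi> = (\<Sum>x\<in>pts U A. \<phi> x * (wt A x * (mean (fib A x) ?S - mean A ?S)))"
    unfolding quad_row by (intro sum.cong refl) (simp only: cov_kernel_row[OF A(1) U])
  also have "\<dots> = (\<Sum>x\<in>pts U A. (\<Sum>s\<in>fib A x. \<phi> x * ?S s) - mean A ?S * (wt A x * \<phi> x))"
  proof (intro sum.cong refl)
    fix x assume x: "x \<in> pts U A"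
    have "(\<Sum>s\<in>fib A x. \<phi> x * ?S s) = \<phi> x * (wt A x * mean (fib A x) ?S)"
      using A(1) fib_nonempty[OF x]
      by (simp add: sum_distrib_left[symmetric] sum_eq_card_mean[of "fib A x"] wt_def)
    then show "\<phi> x * (wt A x * (mean (fib A x) ?S - mean A ?S)) =
        (\<Sum>s\<in>fib A x. \<phi> x * ?S s) - mean A ?S * (wt A x * \<phi> x)"
      by (simp add: algebra_simps)
  qed
  also have "\<dots> = (\<Sum>x\<in>pts U A. \<Sum>s\<in>fib A x. \<phi> x * ?S s) - mean A ?S * (\<Sum>x\<in>pts U A. wt A x * \<phi> x)"
    by (simp add: sum_subtractf sum_distrib_left)
  also have "(\<Sum>x\<in>pts U A. \<Sum>s\<in>fib A x. \<phi> x * ?S s) = (\<Sum>s\<in>A. (?S s)\<^sup>2)"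
    using sum_pts[OF A(1) U, of A "\<lambda>s x. \<phi> x * ?S s"]
    by (simp add: ssum_def power2_eq_square sum_distrib_right)
  also have "(\<Sum>x\<in>pts U A. wt A x * \<phi> x) = (\<Sum>s\<in>A. ?S s)"
    by (simp add: sum_pts_wt[OF A(1) U] ssum_def)
  finally show ?thesis by (simp add: vsum_eq[OF A])
qed

section \<open>Matrix trickle-down\<close>

text \<open>Lagrange's identity behind Cauchy-Schwarz. The exact form matters because the equality
  case is needed when \<open>\<theta> = k\<close>.\<close>

lemma ssum_square_identity:
  assumes "finite U"
  shows "2 * (real (card U) * sqs U \<phi> s - (ssum U \<phi> s)\<^sup>2) =
    (\<Sum>e\<in>U. \<Sum>f\<in>U. (\<phi> (e, s e) - \<phi> (f, s f))\<^sup>2)"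
proof -
  have "(\<Sum>e\<in>U. \<Sum>f\<in>U. (\<phi> (e, s e) - \<phi> (f, s f))\<^sup>2) =
     (\<Sum>e\<in>U. \<Sum>f\<in>U. (\<phi> (e, s e))\<^sup>2 + (\<phi> (f, s f))\<^sup>2 - 2 * (\<phi> (e, s e) * \<phi> (f, s f)))"
    by (intro sum.cong refl) (simp add: power2_diff)
  also have "\<dots> = 2 * (real (card U) * sqs U \<phi> s) - 2 * (\<Sum>e\<in>U. \<Sum>f\<in>U. \<phi> (e, s e) * \<phi> (f, s f))"
    by (simp add: sum.distrib sum_subtractf sqs_def sum_distrib_left)
  also have "(\<Sum>e\<in>U. \<Sum>f\<in>U. \<phi> (e, s e) * \<phi> (f, s f)) = (ssum U \<phi> s)\<^sup>2"
    by (simp add: ssum_def power2_eq_square sum_product)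
  finally show ?thesis by (simp add: algebra_simps)
qed

lemma ssum_square_le:
  assumes "finite U"
  shows "(ssum U \<phi> s)\<^sup>2 \<le> real (card U) * sqs U \<phi> s"
proof -
  have "(\<Sum>e\<in>U. \<Sum>f\<in>U. (\<phi> (e, s e) - \<phi> (f, s f))\<^sup>2) \<ge> 0"
    by (intro sum_nonneg) auto
  then show ?thesis using ssum_square_identity[OF assms, of \<phi> s] by simp
qed

lemma sum_fib_sqs_remove:
  assumes A: "finite A" and U: "finite U"
  shows "(\<Sum>x\<in>pts U A. \<Sum>s\<in>fib A x. sqs (U - {fst x}) \<phi> s) =
    (real (card U) - 1) * sum (sqs U \<phi>) A"
proof -
  have "(\<Sum>x\<in>pts U A. \<Sum>s\<in>fib A x. sqs (U - {fst x}) \<phi> s) = (\<Sum>s\<in>A. \<Sum>e\<in>U. sqs (U - {e}) \<phi> s)"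
    using sum_pts[OF A U, of A "\<lambda>s x. sqs (U - {fst x}) \<phi> s"] by simp
  also have "\<dots> = (\<Sum>s\<in>A. \<Sum>e\<in>U. sqs U \<phi> s - (\<phi> (e, s e))\<^sup>2)"
    unfolding sqs_def by (intro sum.cong refl) (simp add: sum_diff1 U)
  also have "\<dots> = (real (card U) - 1) * sum (sqs U \<phi>) A"
    by (simp add: sum_subtractf sqs_def[symmetric] sum_distrib_left left_diff_distrib)
  finally show ?thesis .
qed

text \<open>Oppenheim's trickle-down argument. The induction hypothesis is applied to \<open>\<phi> - r\<close>, with the
  constant \<open>r\<close> depending on the pinned pair; this gain is what makes \<open>\<theta> < k\<close> force \<open>\<theta> \<le> k / 2\<close>.\<close>

lemma trickle_down:
  fixes A :: "('e \<Rightarrow> 'c) set" and U :: "'e set"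
  defines "k \<equiv> real (card U)"
  assumes A: "finite A" "A \<noteq> {}" and U: "finite U" and k3: "card U \<ge> 3"
    and IH: "\<And>x \<phi>. x \<in> pts U A \<Longrightarrow> vsum (fib A x) (ssum (U - {fst x}) \<phi>) \<le>
        (1 + (k - 2) / 100) * sum (sqs (U - {fst x}) \<phi>) (fib A x)"
    and conn: "\<And>\<psi> :: 'e \<times> 'c \<Rightarrow> real. (\<forall>s\<in>A. \<forall>e\<in>U. \<forall>f\<in>U. \<psi> (e, s e) = \<psi> (f, s f)) \<Longrightarrow>
        \<exists>b. \<forall>s\<in>A. \<forall>e\<in>U. \<psi> (e, s e) = b"
  shows "vsum A (ssum U \<phi>) \<le> k / 2 * sum (sqs U \<phi>) A"
proof -
  define X where "X = pts U A"
  define w where "w = wt A"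
  have k: "k \<ge> 3" using k3 by (simp add: k_def)
  obtain a s0 where "a \<in> U" "s0 \<in> A" using k3 A by fastforce
  then have Xne: "X \<noteq> {}" by (auto simp: X_def pts_def)
  have finX: "finite X" using A U by (simp add: X_def)
  have wpos: "\<And>x. x \<in> X \<Longrightarrow> w x > 0" using A by (auto simp: X_def w_def intro: wt_pos)
  obtain \<theta> \<phi>' where npos: "(\<Sum>x\<in>X. w x * (\<phi>' x)\<^sup>2) > 0"
    and row: "\<And>x. x \<in> X \<Longrightarrow> (\<Sum>y\<in>X. cov_kernel A x y * \<phi>' y) = \<theta> * (w x * \<phi>' x)"
    and top: "\<And>\<psi>. quad X (cov_kernel A) \<psi> \<le> \<theta> * (\<Sum>x\<in>X. w x * (\<psi> x)\<^sup>2)"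
    using exists_top_eigenvector[of X "cov_kernel A" w, OF finX Xne cov_kernel_sym] wpos by blast
  define N where "N = sum (sqs U \<phi>') A"
  define S where "S = ssum U \<phi>'"
  have N: "N = (\<Sum>x\<in>X. w x * (\<phi>' x)\<^sup>2)" "N > 0"
    using npos A U by (auto simp: N_def sum_sqs_eq X_def w_def)
  have "\<theta> \<le> k / 2"
  proof (rule ccontr)
    assume "\<not> \<theta> \<le> k / 2"
    then have th: "\<theta> > k / 2" "\<theta> > 0" using k by auto
    have K: "mean (fib A x) S - mean A S = \<theta> * \<phi>' x" if "x \<in> X" for x
      using row[OF that] cov_kernel_row[OF A(1) U, of x \<phi>'] wpos[OF that] that
      by (auto simp: X_def w_def S_def)
    have vS: "vsum A S = \<theta> * N"
      unfolding S_def quad_cov_kernel[OF A U, symmetric] quad_row N(1) sum_distrib_left X_def[symmetric]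
      using row by (intro sum.cong refl) (simp add: sum_distrib_left[symmetric] power2_eq_square mult_ac)
    have sumS: "(\<Sum>s\<in>A. S s) = (\<Sum>x\<in>X. w x * \<phi>' x)"
      by (simp add: X_def w_def S_def sum_pts_wt[OF A(1) U] ssum_def)
    \<comment> \<open>Testing the eigenvalue equation against constants: the weighted sum of
      \<open>K \<phi>'\<close> vanishes, so an eigenvector with a nonzero eigenvalue has mean
      zero.\<close>
    have "\<theta> * (\<Sum>x\<in>X. w x * \<phi>' x) = (\<Sum>x\<in>X. w x * mean (fib A x) S) - mean A S * (\<Sum>x\<in>X. w x)"
      unfolding sum_distrib_left sum_subtractf[symmetric]
    proof (intro sum.cong refl)
      fix x assume "x \<in> X"
      then have "w x * (mean (fib A x) S - mean A S) = w x * (\<theta> * \<phi>' x)" by (simp add: K)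
      then show "\<theta> * (w x * \<phi>' x) = w x * mean (fib A x) S - mean A S * w x"
        by (simp add: algebra_simps)
    qed
    also have "(\<Sum>x\<in>X. w x * mean (fib A x) S) = (\<Sum>x\<in>X. \<Sum>s\<in>fib A x. S s)"
      using A(1) fib_nonempty[of _ U A]
      by (intro sum.cong refl) (simp add: sum_eq_card_mean X_def w_def wt_def)
    also have "\<dots> = k * (\<Sum>s\<in>A. S s)"
      unfolding X_def by (subst sum_pts[OF A(1) U]) (auto simp: k_def sum_distrib_left)
    also have "(\<Sum>x\<in>X. w x) = k * real (card A)"
      using sum_pts_wt[OF A(1) U, of "\<lambda>_. 1"] by (simp add: X_def w_def k_def)
    finally have "\<theta> * (\<Sum>x\<in>X. w x * \<phi>' x) = 0"
      using A by (simp add: sum_eq_card_mean)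
    then have "(\<Sum>s\<in>A. S s) = 0" using th sumS by simp
    then have m0: "mean A S = 0" by (simp add: mean_def)
    have vS': "vsum A S = (\<Sum>s\<in>A. (S s)\<^sup>2)" using vsum_eq[OF A, of S] m0 by simp
    have kN: "k * N - vsum A S = (\<Sum>s\<in>A. k * sqs U \<phi>' s - (S s)\<^sup>2)"
      by (simp add: vS' N_def sum_subtractf sum_distrib_left)
    have nonneg: "k * sqs U \<phi>' s - (S s)\<^sup>2 \<ge> 0" for s
      using ssum_square_le[OF U] by (simp add: k_def S_def)
    then have "k * N - vsum A S \<ge> 0" unfolding kN by (intro sum_nonneg) auto
    then have thk: "\<theta> \<le> k" using vS N(2) by simp
    show False
    \<comment> \<open>Equality in Cauchy-Schwarz makes \<open>\<phi>'\<close> constant along each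
      member of \<open>A\<close>; by \<open>conn\<close> it is then constant altogether, which mean
      zero excludes.\<close>
    proof (cases "\<theta> = k")
      case True
      then have "(\<Sum>s\<in>A. k * sqs U \<phi>' s - (S s)\<^sup>2) = 0" using kN vS by simp
      then have z: "k * sqs U \<phi>' s - (S s)\<^sup>2 = 0" if "s \<in> A" for s
        using that nonneg A(1) by (simp add: sum_nonneg_eq_0_iff)
      have "\<phi>' (e, s e) = \<phi>' (f, s f)" if "s \<in> A" "e \<in> U" "f \<in> U" for s e f
      proof -
        have "(\<Sum>e\<in>U. \<Sum>f\<in>U. (\<phi>' (e, s e) - \<phi>' (f, s f))\<^sup>2) = 0"
          using ssum_square_identity[OF U, of \<phi>' s] z[OF that(1)] by (simp add: k_def S_def)
        then have "(\<Sum>f\<in>U. (\<phi>' (e, s e) - \<phi>' (f, s f))\<^sup>2) = 0"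
          using that(2) U by (subst (asm) sum_nonneg_eq_0_iff) (auto intro!: sum_nonneg)
        then show ?thesis
          using that(3) U by (subst (asm) sum_nonneg_eq_0_iff) auto
      qed
      then obtain b where b: "\<forall>s\<in>A. \<forall>e\<in>U. \<phi>' (e, s e) = b" using conn by blast
      have "(\<Sum>s\<in>A. S s) = real (card A) * (k * b)"
        using b by (simp add: S_def ssum_def k_def)
      then have "b = 0" using \<open>(\<Sum>s\<in>A. S s) = 0\<close> A k by simp
      then have "N = 0" using b by (simp add: N_def sqs_def)
      then show False using N by simp
    next
      case False
      with thk have thk: "\<theta> < k" by simp
      define \<nu> where "\<nu> = (k - 2) / 100"
      have bound: "vsum (fib A x) S \<le> (1 + \<nu>) * (sum (sqs (U - {fst x}) \<phi>') (fib A x)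
          - (\<theta> - 1)\<^sup>2 / (k - 1) * (w x * (\<phi>' x)\<^sup>2))" if x: "x \<in> X" for x
      proof -
        let ?U = "U - {fst x}"
        \<comment> \<open>With \<open>x\<close> pinned, the other \<open>k - 1\<close> summands have
          total conditional mean \<open>(\<theta> - 1) * \<phi>' x\<close>, by the eigenvalue
          equation. Subtracting the share \<open>r\<close> of one summand centers them and makes the
          right side of the induction hypothesis as small as possible.\<close>
        define r where "r = (\<theta> - 1) * \<phi>' x / (k - 1)"
        have xU: "fst x \<in> U" using x by (auto simp: X_def pts_def)
        have fibne: "fib A x \<noteq> {}" "finite (fib A x)" using fib_nonempty[of x U A] x A by (auto simp: X_def)
        have cU: "real (card ?U) = k - 1" using U xU k3 by (simp add: k_def)
        have sh1: "ssum ?U (\<lambda>y. \<phi>' y - r) s = ssum ?U \<phi>' s + (- (k - 1) * r)" for s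
  using cU by (simp add: ssum_def sum_subtractf left_diff_distrib)
        have sh2: "sqs ?U (\<lambda>y. \<phi>' y - r) s = sqs ?U \<phi>' s - 2 * r * ssum ?U \<phi>' s + (k - 1) * r\<^sup>2" for s
          using cU by (simp add: sqs_def ssum_def power2_diff sum.distrib sum_subtractf sum_distrib_left mult_ac)
        have "(\<Sum>s\<in>fib A x. S s) = w x * (\<theta> * \<phi>' x)"
          using K[OF x] m0 fibne by (simp add: sum_eq_card_mean w_def wt_def)
        moreover have "(\<Sum>s\<in>fib A x. S s) = (\<Sum>s\<in>fib A x. ssum ?U \<phi>' s + \<phi>' x)"
          unfolding S_def using U x by (intro sum.cong refl ssum_remove) (auto simp: X_def)
        ultimately have sU: "(\<Sum>s\<in>fib A x. ssum ?U \<phi>' s) = w x * ((\<theta> - 1) * \<phi>' x)"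
          by (simp add: sum.distrib w_def wt_def algebra_simps)
        have "vsum (fib A x) S = vsum (fib A x) (ssum ?U (\<lambda>y. \<phi>' y - r))"
          unfolding sh1 vsum_shift[OF fibne(2,1)] S_def
          using A(1) U x by (intro vsum_fib_remove) (auto simp: X_def)
        also have "\<dots> \<le> (1 + \<nu>) * sum (sqs ?U (\<lambda>y. \<phi>' y - r)) (fib A x)"
          unfolding \<nu>_def using IH x by (simp add: X_def)
        also have "sum (sqs ?U (\<lambda>y. \<phi>' y - r)) (fib A x) =
            sum (sqs ?U \<phi>') (fib A x) - 2 * r * (w x * ((\<theta> - 1) * \<phi>' x)) + w x * ((k - 1) * r\<^sup>2)"
          unfolding sh2 sum.distrib sum_subtractf sum_distrib_left[symmetric] sU by (simp add: w_def wt_def)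
        also have "\<dots> = sum (sqs ?U \<phi>') (fib A x) - (\<theta> - 1)\<^sup>2 / (k - 1) * (w x * (\<phi>' x)\<^sup>2)"
        proof -
          define D where "D = (\<theta> - 1) * \<phi>' x"
          have "(k - 1) * r = D" using k by (simp add: r_def D_def)
          then have "(k - 1) * r\<^sup>2 = r * D" by (simp add: power2_eq_square mult_ac)
          then have "2 * r * (w x * D) - w x * ((k - 1) * r\<^sup>2) = w x * (r * D)" by simp
          moreover have "r * D = (\<theta> - 1)\<^sup>2 / (k - 1) * (\<phi>' x)\<^sup>2"
            by (simp add: r_def D_def power2_eq_square)
          moreover have "(\<theta> - 1)\<^sup>2 / (k - 1) * (w x * (\<phi>' x)\<^sup>2) = w x * ((\<theta> - 1)\<^sup>2 / (k - 1) * (\<phi>' x)\<^sup>2)"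
            by (rule mult.left_commute)
          ultimately have h: "2 * r * (w x * D) - w x * ((k - 1) * r\<^sup>2) =
              (\<theta> - 1)\<^sup>2 / (k - 1) * (w x * (\<phi>' x)\<^sup>2)"
            by (simp only:)
          show ?thesis unfolding D_def[symmetric] h[symmetric] by simp
        qed
        finally show ?thesis .
      qed
      have "k * vsum A S \<le> (1 + \<nu>) * ((k - 1) * N - (\<theta> - 1)\<^sup>2 / (k - 1) * N) + \<theta>\<^sup>2 * N"
      proof -
        have "k * vsum A S = (\<Sum>x\<in>X. vsum (fib A x) S) + (\<Sum>x\<in>X. w x * (\<theta> * \<phi>' x)\<^sup>2)"
          unfolding k_def total_variance[OF A(1) U] X_def[symmetric] w_def[symmetric] by (simp add: K)
        also have "(\<Sum>x\<in>X. w x * (\<theta> * \<phi>' x)\<^sup>2) = \<theta>\<^sup>2 * N"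
          unfolding N(1) sum_distrib_left by (intro sum.cong refl) (simp add: power_mult_distrib)
        also have "(\<Sum>x\<in>X. vsum (fib A x) S) \<le> (\<Sum>x\<in>X. (1 + \<nu>) * (sum (sqs (U - {fst x}) \<phi>') (fib A x)
          - (\<theta> - 1)\<^sup>2 / (k - 1) * (w x * (\<phi>' x)\<^sup>2)))"
          by (intro sum_mono bound)
        also have "\<dots> = (1 + \<nu>) * ((k - 1) * N - (\<theta> - 1)\<^sup>2 / (k - 1) * N)"
          unfolding sum_distrib_left[symmetric] sum_subtractf N(1)[symmetric]
          using sum_fib_sqs_remove[OF A(1) U, of \<phi>'] by (simp add: X_def k_def N_def)
        finally show ?thesis by simp
      qed
      then have "(k * \<theta>) * N \<le> ((1 + \<nu>) * ((k - 1) - (\<theta> - 1)\<^sup>2 / (k - 1)) + \<theta>\<^sup>2) * N"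
        by (simp add: vS algebra_simps)
      then have "k * \<theta> - \<theta>\<^sup>2 \<le> (1 + \<nu>) * ((k - 1) - (\<theta> - 1)\<^sup>2 / (k - 1))"
        using N(2) by simp
      \<comment> \<open>Owing to the shift by \<open>r\<close> the factor
        \<open>k - \<theta>\<close> splits off on both sides; cancelling it is where
        \<open>\<theta> < k\<close> enters.\<close>
      also have "(k - 1) - (\<theta> - 1)\<^sup>2 / (k - 1) = (k - \<theta>) * (k - 2 + \<theta>) / (k - 1)"
        using k by (simp add: field_simps power2_eq_square)
      finally have "(k - \<theta>) * \<theta> \<le> (k - \<theta>) * ((1 + \<nu>) * (k - 2 + \<theta>) / (k - 1))"
        by (simp add: power2_eq_square algebra_simps)
      then have "\<theta> \<le> (1 + \<nu>) * (k - 2 + \<theta>) / (k - 1)"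
        by (rule mult_left_le_imp_le) (use thk in simp)
      then have "\<theta> * (k - 1) \<le> (1 + \<nu>) * (k - 2 + \<theta>)" using k by (simp add: field_simps)
      moreover have "\<theta> * (k - 1) - (1 + \<nu>) * (k - 2 + \<theta>) = (k - 2) * (99 / 100 * \<theta>) - (k - 2) * (1 + \<nu>)"
        by (simp add: \<nu>_def field_simps)
      ultimately have "(k - 2) * (99 / 100 * \<theta>) \<le> (k - 2) * (1 + \<nu>)" by linarith
      \<comment> \<open>This means \<open>\<theta> \<le> (k + 98) / 99\<close>, which is below
        \<open>k / 2\<close> as soon as \<open>k \<ge> 3\<close>.\<close>
      then have "99 / 100 * \<theta> \<le> 1 + \<nu>" using k by simp
      then show False using th(1) k unfolding \<nu>_def by argo
    qed
  qed
  then have "\<theta> * sum (sqs U \<phi>) A \<le> k / 2 * sum (sqs U \<phi>) A"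
    by (intro mult_right_mono sum_nonneg sqs_nonneg)
  moreover have "vsum A (ssum U \<phi>) \<le> \<theta> * sum (sqs U \<phi>) A"
    using top[of \<phi>] quad_cov_kernel[OF A U, of \<phi>] sum_sqs_eq[OF A(1) U, of \<phi>] by (simp add: X_def w_def)
  ultimately show ?thesis by simp
qed

text \<open>With \<open>K\<close> the covariance operator, \<open>T\<close> the operator of \<open>nk\<close> and \<open>J = 1 + T\<close>, the law of total
  variance and the hypothesis on \<open>q\<close> give \<open>kK - K\<^sup>2 \<le> kJ - J\<^sup>2\<close>. As \<open>K \<le> k/2\<close> and \<open>J < k/2\<close>, the
  top eigenvector of \<open>K - J\<close> shows \<open>K \<le> J\<close>.\<close>

lemma matrix_trickle_down:
  fixes A :: "('e \<Rightarrow> 'c) set" and U :: "'e set"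
  defines "k \<equiv> real (card U)"
  assumes A: "finite A" "A \<noteq> {}" and U: "finite U" and k3: "card U \<ge> 3"
    and sym: "\<And>x y. nk x y = nk y x"
    and IH: "\<And>x \<phi>. x \<in> pts U A \<Longrightarrow> vsum (fib A x) (ssum (U - {fst x}) \<phi>) \<le>
        sum (sqs (U - {fst x}) \<phi>) (fib A x) + q x \<phi>"
    and q_le: "\<And>x \<phi>. x \<in> pts U A \<Longrightarrow> q x \<phi> \<le> (k - 2) / 100 * sum (sqs (U - {fst x}) \<phi>) (fib A x)"
    and rec: "\<And>\<phi>. (\<Sum>x\<in>pts U A. q x \<phi>) \<le> (k - 2) * quad (pts U A) nk \<phi>
        - (\<Sum>x\<in>pts U A. (\<Sum>y\<in>pts U A. nk x y * \<phi> y)\<^sup>2 / wt A x)"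
    and nk_le: "\<And>\<phi>. quad (pts U A) nk \<phi> \<le> (k - 1) / 100 * sum (sqs U \<phi>) A"
    and conn: "\<And>\<psi> :: 'e \<times> 'c \<Rightarrow> real. (\<forall>s\<in>A. \<forall>e\<in>U. \<forall>f\<in>U. \<psi> (e, s e) = \<psi> (f, s f)) \<Longrightarrow>
        \<exists>b. \<forall>s\<in>A. \<forall>e\<in>U. \<psi> (e, s e) = b"
  shows "vsum A (ssum U \<phi>) \<le> sum (sqs U \<phi>) A + quad (pts U A) nk \<phi>"
proof -
  define X where "X = pts U A"
  define w where "w = wt A"
  have k: "k \<ge> 3" using k3 by (simp add: k_def)
  obtain a s0 where "a \<in> U" "s0 \<in> A" using k3 A by fastforce
  then have Xne: "X \<noteq> {}" by (auto simp: X_def pts_def)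
  have finX: "finite X" using A U by (simp add: X_def)
  have wpos: "\<And>x. x \<in> X \<Longrightarrow> w x > 0" using A by (auto simp: X_def w_def intro: wt_pos)
  \<comment> \<open>The kernel of \<open>K - J\<close>; the diagonal term \<open>w x\<close> is the
    identity in the weighted inner product.\<close>
  define B where "B = (\<lambda>x y. cov_kernel A x y - (if x = y then w x else 0) - nk x y)"
  have Bsym: "B x y = B y x" for x y
    using sym[of x y] cov_kernel_sym[of A x y] by (simp add: B_def)
  have Brow: "(\<Sum>y\<in>X. B x y * \<psi> y) =
     (\<Sum>y\<in>X. cov_kernel A x y * \<psi> y) - w x * \<psi> x - (\<Sum>y\<in>X. nk x y * \<psi> y)" if "x \<in> X" for x \<psi>
  proof -
    have "(\<Sum>y\<in>X. (if x = y then w x else 0) * \<psi> y) = w x * \<psi> x"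
      using finX that by (simp add: if_distrib[of "\<lambda>u. u * _"] cong: if_cong)
    then show ?thesis by (simp add: B_def left_diff_distrib sum_subtractf)
  qed
  have Bquad: "quad X B \<psi> = vsum A (ssum U \<psi>) - sum (sqs U \<psi>) A - quad X nk \<psi>" for \<psi>
  proof -
    have "quad X B \<psi> = (\<Sum>x\<in>X. \<psi> x * (\<Sum>y\<in>X. cov_kernel A x y * \<psi> y) - w x * (\<psi> x)\<^sup>2
        - \<psi> x * (\<Sum>y\<in>X. nk x y * \<psi> y))"
      unfolding quad_row by (intro sum.cong refl) (simp add: Brow power2_eq_square right_diff_distrib)
    also have "\<dots> = quad X (cov_kernel A) \<psi> - (\<Sum>x\<in>X. w x * (\<psi> x)\<^sup>2) - quad X nk \<psi>"
      by (simp add: sum_subtractf quad_row)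
    finally show ?thesis
      using quad_cov_kernel[OF A U, of \<psi>] sum_sqs_eq[OF A(1) U, of \<psi>] by (simp add: X_def w_def)
  qed
  obtain \<mu> \<phi>' where npos: "(\<Sum>x\<in>X. w x * (\<phi>' x)\<^sup>2) > 0"
    and row: "\<And>x. x \<in> X \<Longrightarrow> (\<Sum>y\<in>X. B x y * \<phi>' y) = \<mu> * (w x * \<phi>' x)"
    and top: "\<And>\<psi>. quad X B \<psi> \<le> \<mu> * (\<Sum>x\<in>X. w x * (\<psi> x)\<^sup>2)"
    using exists_top_eigenvector[of X "B" w, OF finX Xne Bsym] wpos by blast
  define N where "N = sum (sqs U \<phi>') A"
  define S where "S = ssum U \<phi>'"
  define T where "T = (\<lambda>x. (\<Sum>y\<in>X. nk x y * \<phi>' y) / w x)"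
  define Q where "Q = quad X nk \<phi>'"
  have N: "N = (\<Sum>x\<in>X. w x * (\<phi>' x)\<^sup>2)" "N > 0"
    using npos A U by (auto simp: N_def sum_sqs_eq X_def w_def)
  have wT: "w x * T x = (\<Sum>y\<in>X. nk x y * \<phi>' y)" if "x \<in> X" for x
    using wpos[OF that] by (simp add: T_def)
  have Q: "Q = (\<Sum>x\<in>X. w x * (\<phi>' x * T x))"
    unfolding Q_def quad_row by (intro sum.cong refl) (simp add: wT[symmetric])
  have K: "mean (fib A x) S - mean A S = (1 + \<mu>) * \<phi>' x + T x" if x: "x \<in> X" for x
  proof -
    have "w x * (mean (fib A x) S - mean A S) = w x * ((1 + \<mu>) * \<phi>' x + T x)"
      using row[OF x] Brow[OF x, of \<phi>'] cov_kernel_row[OF A(1) U, of x \<phi>'] x wT[OF x]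
      by (simp add: X_def w_def S_def algebra_simps)
    then show ?thesis using wpos[OF x] by simp
  qed
  have "\<mu> \<le> 0"
  proof (rule ccontr)
    assume "\<not> \<mu> \<le> 0"
    then have \<mu>: "\<mu> > 0" by simp
    have vS: "vsum A S = (1 + \<mu>) * N + Q"
    proof -
      have "quad X B \<phi>' = (\<Sum>x\<in>X. \<phi>' x * (\<mu> * (w x * \<phi>' x)))"
        unfolding quad_row by (intro sum.cong refl) (simp add: row)
      also have "\<dots> = \<mu> * N"
        unfolding N(1) sum_distrib_left by (intro sum.cong refl) (simp add: power2_eq_square)
      finally show ?thesis using Bquad[of \<phi>'] by (simp add: S_def Q_def N_def algebra_simps)
    qed
    have K2: "(\<Sum>x\<in>X. w x * (mean (fib A x) S - mean A S)\<^sup>2)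
        = (1 + \<mu>)\<^sup>2 * N + 2 * (1 + \<mu>) * Q + (\<Sum>x\<in>X. w x * (T x)\<^sup>2)"
      unfolding N(1) Q sum_distrib_left sum.distrib[symmetric]
      by (intro sum.cong refl) (simp add: K power2_eq_square algebra_simps)
    have T2: "(\<Sum>x\<in>X. w x * (T x)\<^sup>2) = (\<Sum>x\<in>X. (\<Sum>y\<in>X. nk x y * \<phi>' y)\<^sup>2 / w x)"
    proof (intro sum.cong refl)
      fix x assume x: "x \<in> X"
      show "w x * (T x)\<^sup>2 = (\<Sum>y\<in>X. nk x y * \<phi>' y)\<^sup>2 / w x"
        unfolding wT[OF x, symmetric] using wpos[OF x] by (simp add: power2_eq_square)
    qed
    have "k * vsum A S = (\<Sum>x\<in>X. vsum (fib A x) S) + (\<Sum>x\<in>X. w x * (mean (fib A x) S - mean A S)\<^sup>2)"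
      unfolding k_def total_variance[OF A(1) U] X_def[symmetric] w_def[symmetric] ..
    also have "(\<Sum>x\<in>X. vsum (fib A x) S) \<le> (\<Sum>x\<in>X. sum (sqs (U - {fst x}) \<phi>') (fib A x) + q x \<phi>')"
    proof (intro sum_mono)
      fix x assume "x \<in> X"
      then show "vsum (fib A x) S \<le> sum (sqs (U - {fst x}) \<phi>') (fib A x) + q x \<phi>'"
        using vsum_fib_remove[OF A(1) U, of x \<phi>'] IH[of x \<phi>'] by (simp add: X_def S_def)
    qed
    also have "\<dots> \<le> (k - 1) * N + ((k - 2) * Q - (\<Sum>x\<in>X. w x * (T x)\<^sup>2))"
      using sum_fib_sqs_remove[OF A(1) U, of \<phi>'] rec[of \<phi>'] unfolding T2
      by (simp add: sum.distrib X_def k_def N_def Q_def w_def)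
    finally have "k * ((1 + \<mu>) * N + Q) \<le> (k - 1) * N + (k - 2) * Q + (1 + \<mu>)\<^sup>2 * N + 2 * (1 + \<mu>) * Q"
      unfolding K2 vS by simp
    \<comment> \<open>As \<open>K \<phi>' = J \<phi>' + \<mu> \<phi>'\<close>, the forms of
      \<open>K\<^sup>2\<close> and \<open>J\<^sup>2\<close> at \<open>\<phi>'\<close> differ by
      \<open>\<mu>\<close> times the form of \<open>K + J\<close>. Dividing by
      \<open>\<mu> > 0\<close> leaves the claim that \<open>K + J\<close> is at least
      \<open>k\<close> at \<open>\<phi>'\<close>.\<close>
    then have "\<mu> * (k * N) \<le> \<mu> * ((2 + \<mu>) * N + 2 * Q)"
      by (simp add: power2_eq_square algebra_simps)
    then have "k * N \<le> (2 + \<mu>) * N + 2 * Q" using \<mu> by simp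
    also have "\<dots> = vsum A S + (N + Q)" by (simp add: vS algebra_simps)
    also have "vsum A S \<le> k / 2 * N"
      unfolding S_def N_def k_def
    proof (rule trickle_down[OF A U k3 _ conn])
      fix x \<phi> assume "x \<in> pts U A"
      then show "vsum (fib A x) (ssum (U - {fst x}) \<phi>)
         \<le> (1 + (real (card U) - 2) / 100) * sum (sqs (U - {fst x}) \<phi>) (fib A x)"
        using IH[of x \<phi>] q_le[of x \<phi>] unfolding k_def distrib_right mult_1 by linarith
    qed
    also have "Q \<le> (k - 1) / 100 * N" using nk_le[of \<phi>'] by (simp add: Q_def N_def X_def)
    \<comment> \<open>The upper bound \<open>k / 2 + 1 + (k - 1) / 100\<close> on
      \<open>K + J\<close> is below \<open>k\<close> from \<open>k = 3\<close> on. At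
      \<open>k = 2\<close> there is no room, so pairs of edges need a direct computation.\<close>
    finally have "k * N \<le> (k / 2 + 1 + (k - 1) / 100) * N" by (simp add: algebra_simps)
    then have "k \<le> k / 2 + 1 + (k - 1) / 100" using N(2) by simp
    then show False using k by argo
  qed
  then have "quad X B \<phi> \<le> 0"
    using top[of \<phi>] wpos by (smt (verit) mult_nonneg_nonneg mult_nonpos_nonneg sum_nonneg zero_le_power2)
  then show ?thesis using Bquad[of \<phi>] by (simp add: X_def)
qed

section \<open>Second eigenvalues of reversible chains\<close>

text \<open>Conjugation by the shear that sends the first basis vector to the all-one vector splits the
  eigenvalue 1 off a stochastic matrix.\<close>

lemma char_poly_stochastic:
  fixes a :: "nat \<Rightarrow> nat \<Rightarrow> real"
  assumes row: "\<And>i. i < Suc m \<Longrightarrow> (\<Sum>j<Suc m. a i j) = 1"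
  shows "char_poly (mat (Suc m) (Suc m) (\<lambda>(i, j). a i j)) =
    [:- 1, 1:] * char_poly (mat m m (\<lambda>(i, j). a (Suc i) (Suc j) - a 0 (Suc j)))"
proof -
  define n where "n = Suc m"
  define A where "A = mat n n (\<lambda>(i, j). a i j)"
  define T where "T = mat n n (\<lambda>(i, j). if i = j \<or> j = 0 then 1 else 0 :: real)"
  define T' where "T' = mat n n (\<lambda>(i, j). (if j = i then 1 else 0) - (if j = 0 then (if i = 0 then 0 else 1) else 0) :: real)"
  define B where "B = mat m m (\<lambda>(i, j). a (Suc i) (Suc j) - a 0 (Suc j))"
  define R where "R = mat 1 m (\<lambda>(i, j). a 0 (Suc j))"
  have carr: "A \<in> carrier_mat n n" "T \<in> carrier_mat n n" "T' \<in> carrier_mat n n"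
    by (simp_all add: A_def T_def T'_def)
  have T'M: "(T' * M) $$ (i, j) = M $$ (i, j) - (if i = 0 then 0 else M $$ (0, j))"
    if M: "M \<in> carrier_mat n n" and ij: "i < n" "j < n" for M i j
  proof -
    have "(T' * M) $$ (i, j) = (\<Sum>k\<in>{0..<n}. T' $$ (i, k) * M $$ (k, j))"
      using M ij carr by (auto simp: scalar_prod_def)
    also have "\<dots> = (\<Sum>k\<in>{0..<n}. (if k = i then M $$ (k, j) else 0)
       - (if k = 0 then (if i = 0 then 0 else M $$ (k, j)) else 0))"
      using ij by (intro sum.cong refl) (auto simp: T'_def)
    also have "\<dots> = M $$ (i, j) - (if i = 0 then 0 else M $$ (0, j))"
      using ij by (simp add: sum_subtractf)
    finally show ?thesis .
  qed
  have AT: "(A * T) $$ (i, j) = (if j = 0 then 1 else a i j)" if ij: "i < n" "j < n" for i j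
  proof -
    have "(A * T) $$ (i, j) = (\<Sum>k\<in>{0..<n}. a i k * (if k = j \<or> j = 0 then 1 else 0))"
      using ij by (auto simp: scalar_prod_def A_def T_def)
    also have "\<dots> = (if j = 0 then \<Sum>k<n. a i k else a i j)"
      using ij by (simp add: if_distrib[of "\<lambda>u. _ * u"] atLeast0LessThan cong: if_cong)
    finally show ?thesis using row ij by (simp add: n_def)
  qed
  have T'T: "T' * T = 1\<^sub>m n"
  proof (rule eq_matI)
    fix i j assume "i < dim_row (1\<^sub>m n :: real mat)" "j < dim_col (1\<^sub>m n :: real mat)"
    then have ij: "i < n" "j < n" by auto
    show "(T' * T) $$ (i, j) = 1\<^sub>m n $$ (i, j)"
      unfolding T'M[OF carr(2) ij] using ij by (auto simp: T_def)
  qed (use carr in auto)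
  then have TT': "T * T' = 1\<^sub>m n" using carr mat_mult_left_right_inverse by blast
  have "T' * (A * T) = four_block_mat (mat 1 1 (\<lambda>_. 1)) R (0\<^sub>m m 1) B"
  proof (rule eq_matI)
    fix i j
    assume "i < dim_row (four_block_mat (mat 1 1 (\<lambda>_. 1 :: real)) R (0\<^sub>m m 1) B)"
      "j < dim_col (four_block_mat (mat 1 1 (\<lambda>_. 1 :: real)) R (0\<^sub>m m 1) B)"
    then have ij: "i < n" "j < n" by (auto simp: n_def B_def)
    have c: "A * T \<in> carrier_mat n n" using carr by simp
    have n0: "0 < n" by (simp add: n_def)
    show "(T' * (A * T)) $$ (i, j) = four_block_mat (mat 1 1 (\<lambda>_. 1)) R (0\<^sub>m m 1) B $$ (i, j)"
      unfolding T'M[OF c ij] AT[OF ij] AT[OF n0 ij(2)] using ij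
      by (auto simp: B_def R_def n_def)
  qed (use carr in \<open>auto simp: n_def B_def\<close>)
  moreover have "similar_mat A (T' * (A * T))"
  proof (rule similar_matI[of _ _ T T' n])
    have "T * (T' * (A * T)) * T' = (T * T') * (A * (T * T'))"
      using carr by (simp add: assoc_mult_mat[of _ n n _ n _ n])
    then show "A = T * (T' * (A * T)) * T'" using carr TT' by simp
  qed (use carr TT' T'T in auto)
  ultimately have "char_poly A = char_poly (four_block_mat (mat 1 1 (\<lambda>_. 1)) R (0\<^sub>m m 1) B)"
    using char_poly_similar by metis
  also have "\<dots> = char_poly (mat 1 1 (\<lambda>_. 1)) * char_poly B"
    by (rule char_poly_four_block_zeros_col) (auto simp: R_def B_def)
  also have "char_poly (mat 1 1 (\<lambda>_. 1)) = [:- 1, 1 :: real:]"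
    by (subst char_poly_upper_triangular[of _ 1]) (auto simp: diag_mat_def)
  finally show ?thesis by (simp add: A_def B_def n_def)
qed

text \<open>Of the two largest entries at most one is accounted for by the extra copy of
  \<open>u\<close>; the other lies in \<open>N\<close>. That \<open>N\<close> is nonempty guarantees
  that index 1 exists.\<close>

lemma second_of_desc_list_le:
  fixes M :: "'a :: linorder multiset"
  assumes "M = add_mset u N" "N \<noteq> {#}" "\<And>x. x \<in># N \<Longrightarrow> x \<le> b"
  shows "rev (sorted_list_of_multiset M) ! 1 \<le> b"
proof (rule ccontr)
  let ?l = "rev (sorted_list_of_multiset M)"
  assume gt: "\<not> ?l ! 1 \<le> b"
  have mset: "mset ?l = M" by simp
  have "length ?l = size M" by (metis mset size_mset)
  then have len: "length ?l \<ge> 2" using assms(1,2) by (cases N) auto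
  then obtain x y r where l: "?l = x # y # r"
    by (metis One_nat_def Suc_1 Suc_le_length_iff)
  have "sorted (rev ?l)" by simp
  then have "y \<le> x" unfolding l by (auto simp: sorted_append)
  then have "x > b" "y > b" using gt l by auto
  moreover have "add_mset x (add_mset y (mset r)) = add_mset u N"
    using mset assms(1) unfolding l by simp
  then have "x \<in># N \<or> y \<in># N"
    by (metis add_eq_conv_ex add_mset_eq_single insert_noteq_member union_single_eq_member)
  ultimately show False using assms(3) by (meson leD)
qed

text \<open>Removing the factor with root 1 from the characteristic polynomial removes exactly one
  copy of the eigenvalue 1, even if 1 is multiple. Every real root that remains comes from a left
  eigenvector with coordinate sum 0; divided by \<open>w\<close> it becomes a function of weighted
  mean zero whose Rayleigh quotient is that root, so \<open>form\<close> applies.\<close>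

lemma lambda2_le:
  fixes P :: "'a \<Rightarrow> 'a \<Rightarrow> real"
  assumes S: "finite S" and row: "\<And>x. x \<in> S \<Longrightarrow> (\<Sum>y\<in>S. P x y) = 1"
    and w: "\<And>x. x \<in> S \<Longrightarrow> w x > 0"
    and rev: "\<And>x y. x \<in> S \<Longrightarrow> y \<in> S \<Longrightarrow> w x * P x y = w y * P y x"
    and form: "\<And>\<phi>. (\<Sum>x\<in>S. w x * \<phi> x) = 0 \<Longrightarrow>
      (\<Sum>x\<in>S. \<Sum>y\<in>S. w x * P x y * \<phi> x * \<phi> y) \<le> b * (\<Sum>x\<in>S. w x * (\<phi> x)\<^sup>2)"
    and ev: "\<And>x. x \<in> S \<Longrightarrow> (\<Sum>y\<in>S. P x y * \<psi> y) = r * \<psi> x"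
      "(\<Sum>x\<in>S. w x * \<psi> x) = 0" "\<exists>x\<in>S. \<psi> x \<noteq> 0"
  shows "lambda2 S P \<le> b"
proof -
  define xs where "xs = (SOME xs. distinct xs \<and> set xs = S)"
  have "\<exists>xs. distinct xs \<and> set xs = S" using finite_distinct_list[OF S] by auto
  then have xs: "distinct xs" "set xs = S" unfolding xs_def by (metis (mono_tags, lifting) someI_ex)+
  have "xs \<noteq> []" using ev(3) xs by auto
  then obtain m where m: "length xs = Suc m" by (cases xs) auto
  have bij: "bij_betw (\<lambda>i. xs ! i) {..<Suc m} S"
    using bij_betw_nth[OF xs(1), of "{..<Suc m}" S] m xs(2) by auto
  have sumS: "(\<Sum>x\<in>S. f x) = (\<Sum>i<Suc m. f (xs ! i))" for f :: "'a \<Rightarrow> real"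
    using sum.reindex_bij_betw[OF bij, of f] by simp
  have inS: "xs ! i \<in> S" if "i < Suc m" for i using that m xs by (metis nth_mem)
  define a where "a = (\<lambda>i j. P (xs ! i) (xs ! j))"
  define v where "v = (\<lambda>i. w (xs ! i))"
  have v: "v i > 0" if "i < Suc m" for i using w inS that by (simp add: v_def)
  define B where "B = mat m m (\<lambda>(i, j). a (Suc i) (Suc j) - a 0 (Suc j))"
  have rowa: "(\<Sum>j<Suc m. a i j) = 1" if "i < Suc m" for i
    using row[OF inS[OF that]] by (simp add: sumS a_def)
  have cp: "char_poly (kernel_mat S P) = [:- 1, 1:] * char_poly B"
    unfolding kernel_mat_def xs_def[symmetric] Let_def m B_def
    using char_poly_stochastic[of m a, OF rowa] by (simp add: a_def)
  have Bc: "B \<in> carrier_mat m m" by (simp add: B_def)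
  have BTc: "transpose_mat B \<in> carrier_mat m m" by (simp add: B_def)
  have cpB: "char_poly B \<noteq> 0" using degree_monic_char_poly[OF Bc] by auto
  have roots_le: "\<mu> \<le> b" if "poly (char_poly B) \<mu> = 0" for \<mu>
  proof -
    have "eigenvalue (transpose_mat B) \<mu>"
      using that eigenvalue_root_char_poly[OF BTc] char_poly_transpose_mat[OF Bc] by simp
    then obtain y where y: "y \<in> carrier_vec m" "y \<noteq> 0\<^sub>v m" "transpose_mat B *\<^sub>v y = \<mu> \<cdot>\<^sub>v y"
      unfolding eigenvalue_def eigenvector_def using Bc by auto
    \<comment> \<open>The prepended entry makes the sum zero. Then the subtraction of row 0 in
      \<open>B\<close> cancels, and \<open>z\<close> is a left eigenvector of the full
      matrix.\<close>
    define z where "z = (\<lambda>i. case i of 0 \<Rightarrow> - (\<Sum>i<m. y $ i) | Suc i \<Rightarrow> y $ i)"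
    have z0: "(\<Sum>i<Suc m. z i) = 0"
      unfolding sum.lessThan_Suc_shift by (simp add: z_def)
    have yB: "(\<Sum>i<m. y $ i * (a (Suc i) (Suc j) - a 0 (Suc j))) = \<mu> * y $ j" if j: "j < m" for j
    proof -
      have "(transpose_mat B *\<^sub>v y) $ j = (\<Sum>i<m. y $ i * (a (Suc i) (Suc j) - a 0 (Suc j)))"
        using j y(1) by (simp add: scalar_prod_def B_def atLeast0LessThan mult.commute)
      then show ?thesis using y j by simp
    qed
    have zP': "(\<Sum>i<Suc m. z i * a i (Suc j)) = \<mu> * z (Suc j)" if j: "j < m" for j
      unfolding sum.lessThan_Suc_shift using yB[OF j]
      by (simp add: z_def right_diff_distrib sum_subtractf sum_distrib_right)
    have zP: "(\<Sum>i<Suc m. z i * a i j) = \<mu> * z j" if j: "j < Suc m" for j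
    proof (cases j)
      case (Suc j')
      then show ?thesis using zP' j by simp
    next
      \<comment> \<open>Column 0 is invisible to \<open>B\<close>. It is recovered from the other
        columns because all rows sum to 1 and \<open>z\<close> sums to 0.\<close>
      case 0
      have "(\<Sum>j<Suc m. \<Sum>i<Suc m. z i * a i j) = (\<Sum>i<Suc m. z i * (\<Sum>j<Suc m. a i j))"
        unfolding sum_distrib_left by (rule sum.swap)
      also have "\<dots> = 0" using z0 rowa by simp
      finally have "(\<Sum>i<Suc m. z i * a i 0) = - (\<Sum>j<m. \<Sum>i<Suc m. z i * a i (Suc j))"
        by (subst (asm) sum.lessThan_Suc_shift) linarith
      also have "\<dots> = - (\<Sum>j<m. \<mu> * z (Suc j))" using zP' by simp
      also have "\<dots> = \<mu> * z 0" by (simp add: z_def sum_distrib_left)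
      finally show ?thesis using 0 by simp
    qed
    define g where "g = (\<lambda>i. z i / v i)"
    have vg: "v i * g i = z i" if "i < Suc m" for i using v[OF that] by (simp add: g_def)
    obtain i0 where i0: "i0 < m" "y $ i0 \<noteq> 0"
      using y(1,2) by (metis carrier_vecD eq_vecI index_zero_vec(1) index_zero_vec(2))
    have pos: "(\<Sum>i<Suc m. v i * (g i)\<^sup>2) > 0"
    proof -
      have "0 < v (Suc i0) * (g (Suc i0))\<^sup>2"
        using i0 v[of "Suc i0"] by (simp add: g_def z_def zero_less_mult_iff)
      also have "\<dots> \<le> (\<Sum>i<Suc m. v i * (g i)\<^sup>2)"
        using i0 v by (intro member_le_sum) (auto simp: less_imp_le)
      finally show ?thesis .
    qed
    have "\<exists>\<phi>. \<forall>i<Suc m. \<phi> (xs ! i) = g i"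
      by (rule exI[of _ "\<lambda>x. g (the_inv_into {..<Suc m} (\<lambda>i. xs ! i) x)"])
        (use bij in \<open>auto simp: bij_betw_def the_inv_into_f_f\<close>)
    then obtain \<phi> where \<phi>: "\<And>i. i < Suc m \<Longrightarrow> \<phi> (xs ! i) = g i" by blast
    have "(\<Sum>x\<in>S. w x * \<phi> x) = (\<Sum>i<Suc m. z i)"
      unfolding sumS by (intro sum.cong refl) (simp add: \<phi> vg[unfolded v_def])
    then have "(\<Sum>x\<in>S. w x * \<phi> x) = 0" using z0 by simp
    from form[OF this]
    have le: "(\<Sum>i<Suc m. \<Sum>j<Suc m. v i * a i j * g i * g j) \<le> b * (\<Sum>i<Suc m. v i * (g i)\<^sup>2)"
      unfolding sumS by (simp add: \<phi> v_def a_def)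
    have "(\<Sum>i<Suc m. \<Sum>j<Suc m. v i * a i j * g i * g j) = (\<Sum>j<Suc m. \<Sum>i<Suc m. v i * a i j * g i * g j)"
      by (rule sum.swap)
    also have "\<dots> = (\<Sum>j<Suc m. g j * (\<Sum>i<Suc m. z i * a i j))"
      unfolding sum_distrib_left
      by (intro sum.cong refl) (simp add: vg[symmetric] mult_ac)
    also have "\<dots> = (\<Sum>j<Suc m. \<mu> * (v j * (g j)\<^sup>2))"
    proof (intro sum.cong refl)
      fix j assume "j \<in> {..<Suc m}"
      then have "(\<Sum>i<Suc m. z i * a i j) = \<mu> * (v j * g j)"
        using zP[of j] vg[of j] by (simp del: sum.lessThan_Suc)
      then show "g j * (\<Sum>i<Suc m. z i * a i j) = \<mu> * (v j * (g j)\<^sup>2)"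
        by (simp only: power2_eq_square mult_ac)
    qed
    also have "\<dots> = \<mu> * (\<Sum>i<Suc m. v i * (g i)\<^sup>2)" by (simp only: sum_distrib_left)
    finally have "\<mu> * (\<Sum>i<Suc m. v i * (g i)\<^sup>2) \<le> b * (\<Sum>i<Suc m. v i * (g i)\<^sup>2)"
      using le by (simp only:)
    then show ?thesis using pos by (rule mult_right_le_imp_le)
  qed
  \<comment> \<open>The list of eigenvalues is indexed at 1, so a real eigenvalue besides 1 must be exhibited.\<close>
  have "eigenvalue (transpose_mat B) r"
  proof -
    \<comment> \<open>Reversibility turns the right eigenvector \<open>\<psi>\<close> into the left
      eigenvector with entries weight times \<open>\<psi>\<close>; as these sum to 0, dropping entry
      0 gives an eigenvector of the transpose of \<open>B\<close>.\<close>
    define y where "y = vec m (\<lambda>i. v (Suc i) * \<psi> (xs ! Suc i))"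
    have z0: "(\<Sum>i<Suc m. v i * \<psi> (xs ! i)) = 0" using ev(2) by (simp add: sumS v_def)
    have "transpose_mat B *\<^sub>v y = r \<cdot>\<^sub>v y"
    proof (rule eq_vecI)
      fix j assume "j < dim_vec (r \<cdot>\<^sub>v y)"
      then have j: "j < m" by (simp add: y_def)
      have "(transpose_mat B *\<^sub>v y) $ j =
         (\<Sum>i<m. v (Suc i) * \<psi> (xs ! Suc i) * (a (Suc i) (Suc j) - a 0 (Suc j)))"
        using j by (simp add: scalar_prod_def B_def atLeast0LessThan mult.commute y_def)
      also have "\<dots> = (\<Sum>i<Suc m. v i * \<psi> (xs ! i) * (a i (Suc j) - a 0 (Suc j)))"
        unfolding sum.lessThan_Suc_shift by simp
      also have "\<dots> = (\<Sum>i<Suc m. v i * a i (Suc j) * \<psi> (xs ! i))"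
      proof -
        have "(\<Sum>i<Suc m. v i * \<psi> (xs ! i) * a 0 (Suc j)) = 0"
          unfolding sum_distrib_right[symmetric] using z0 by simp
        then show ?thesis
          by (simp add: right_diff_distrib sum_subtractf mult_ac del: sum.lessThan_Suc)
      qed
      also have "\<dots> = (\<Sum>i<Suc m. v (Suc j) * (a (Suc j) i * \<psi> (xs ! i)))"
        using rev inS j by (intro sum.cong refl) (simp add: v_def a_def)
      also have "\<dots> = v (Suc j) * (r * \<psi> (xs ! Suc j))"
        unfolding sum_distrib_left[symmetric] using ev(1)[OF inS, of "Suc j"] j
        by (simp add: sumS a_def del: sum.lessThan_Suc)
      finally show "(transpose_mat B *\<^sub>v y) $ j = (r \<cdot>\<^sub>v y) $ j" using j by (simp add: y_def)
    qed (simp add: y_def B_def)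
    moreover have "y \<noteq> 0\<^sub>v m"
    proof
      assume y0: "y = 0\<^sub>v m"
      have z: "\<psi> (xs ! Suc i) = 0" if "i < m" for i
      proof -
        have "y $ i = 0" using y0 that by simp
        then show ?thesis using v[of "Suc i"] that by (simp add: y_def)
      qed
      then have "v 0 * \<psi> (xs ! 0) = 0" using z0 unfolding sum.lessThan_Suc_shift by simp
      then have "\<psi> (xs ! 0) = 0" using v[of 0] by simp
      then have "\<psi> (xs ! i) = 0" if "i < Suc m" for i using z that by (cases i) auto
      then show False using ev(3) xs(2) m by (metis in_set_conv_nth)
    qed
    ultimately show ?thesis unfolding eigenvalue_def eigenvector_def
      by (intro exI[of _ y]) (simp add: y_def B_def)
  qed
  then have root: "poly (char_poly B) r = 0"
    using eigenvalue_root_char_poly[OF BTc] char_poly_transpose_mat[OF Bc] by simp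
  have "proots (char_poly (kernel_mat S P)) = add_mset 1 (proots (char_poly B))"
    unfolding cp using cpB by (subst proots_mult) auto
  moreover have "r \<in># proots (char_poly B)" using root cpB by simp
  then have "proots (char_poly B) \<noteq> {#}" by auto
  ultimately show ?thesis unfolding lambda2_def eigenvalues_desc_def
    using roots_le cpB by (intro second_of_desc_list_le) auto
qed

section \<open>Partial list edge colorings\<close>

locale list_coloring =
  fixes E :: "'v set set" and L :: "'v set \<Rightarrow> nat set" and \<Delta> :: nat
  assumes finite_E: "finite E" and card_edge: "\<And>e. e \<in> E \<Longrightarrow> card e = 2"
    and finite_L: "\<And>e. e \<in> E \<Longrightarrow> finite (L e)"
    and degree_le: "\<And>v. degree_of E v \<le> \<Delta>" and Delta_pos: "\<Delta> \<ge> 1"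
    and extra: "\<And>e. e \<in> E \<Longrightarrow> real (card (L e)) \<ge> 4 / 3 * real \<Delta> + real (edge_degree E e)"
begin

definition t :: real where "t = 3 / (4 * real \<Delta>)"

definition inc :: "'v set set \<Rightarrow> 'v \<Rightarrow> 'v set set" where
  "inc U v = {e \<in> U. v \<in> e}"

definition nb :: "'v set set \<Rightarrow> 'v set \<Rightarrow> 'v set set" where
  "nb U e = {f \<in> U. f \<noteq> e \<and> f \<inter> e \<noteq> {}}"

definition avail :: "'v set \<Rightarrow> ('v set \<Rightarrow> nat) \<Rightarrow> nat set" where
  "avail e s = {c \<in> L e. \<forall>f\<in>nb E e. s f \<noteq> c}"

text \<open>Fixing the values outside \<open>E\<close> makes this set finite and puts it in
  bijection with the facets.\<close>

definition colorings :: "('v set \<Rightarrow> nat) set" where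
  "colorings = {s \<in> extensional E. proper_coloring E L s}"

text \<open>Pinning shrinks \<open>U\<close> and leaves \<open>E\<close> and \<open>L\<close>
  untouched. Hence \<open>avail\<close> and \<open>h\<close> always refer to all neighbors, pinned
  or not, and \<open>h\<close> as a function of the coloring never changes; this is what makes its
  averages martingales.\<close>

definition ext :: "'v set set \<Rightarrow> ('v set \<Rightarrow> nat) \<Rightarrow> ('v set \<Rightarrow> nat) set" where
  "ext U \<rho> = {s \<in> colorings. \<forall>e\<in>E - U. s e = \<rho> e}"

text \<open>The conditional probability of \<open>s e = c\<close> given the colors of all other edges.\<close>

definition h :: "'v set \<Rightarrow> nat \<Rightarrow> ('v set \<Rightarrow> nat) \<Rightarrow> real" where
  "h e c s = (if c \<in> avail e s then 1 / real (card (avail e s)) else 0)"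

definition palette :: "nat set" where
  "palette = (\<Union>e\<in>E. L e)"

lemma t_pos: "t > 0"
  using Delta_pos by (simp add: t_def)

lemma finite_palette [simp]: "finite palette"
  using finite_E finite_L by (simp add: palette_def)

lemma finite_edge: "e \<in> E \<Longrightarrow> finite e"
  using card_edge by (metis card.infinite zero_neq_numeral)

lemma edge_nonempty: "e \<in> E \<Longrightarrow> e \<noteq> {}"
  using card_edge by fastforce

lemma edges_share_one:
  assumes "e \<in> E" "f \<in> E" "v \<in> e" "v \<in> f" "u \<in> e" "u \<in> f" "u \<noteq> v"
  shows "e = f"
proof -
  have "e = {u, v}" "f = {u, v}"
    using assms card_edge[of e] card_edge[of f] finite_edge
    by (metis card_2_iff doubleton_eq_iff insert_iff singletonD)+
  then show ?thesis by simp
qed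

lemma edge_eq_doubleton: "e \<in> E \<Longrightarrow> \<exists>u v. u \<noteq> v \<and> e = {u, v}"
  using card_edge[of e] by (auto simp: card_2_iff)

lemma inc_remove: "inc (U - {g}) v = inc U v - {g}"
  by (auto simp: inc_def)

lemma inc_subset: "inc U v \<subseteq> U"
  by (auto simp: inc_def)

lemma degree_of_inc: "degree_of U v = card (inc U v)"
  by (simp add: degree_of_def inc_def)

lemma finite_sub: "U \<subseteq> E \<Longrightarrow> finite U"
  using finite_E finite_subset by blast

lemma finite_inc: "U \<subseteq> E \<Longrightarrow> finite (inc U v)"
  using finite_sub inc_subset finite_subset by metis

lemma nb_eq: "u \<noteq> v \<Longrightarrow> nb U {u, v} = (inc U u - {{u, v}}) \<union> (inc U v - {{u, v}})"
  by (auto simp: nb_def inc_def)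

lemma card_nb:
  assumes U: "U \<subseteq> E" and e: "e \<in> U"
  shows "real (card (nb U e)) = (\<Sum>v\<in>e. real (degree_of U v) - 1)"
proof -
  obtain u v where uv: "u \<noteq> v" "e = {u, v}" using edge_eq_doubleton U e by blast
  have "(inc U u - {e}) \<inter> (inc U v - {e}) = {}"
    using uv edges_share_one[of e _ v u] U e by (auto simp: inc_def)
  then have "card (nb U e) = card (inc U u - {e}) + card (inc U v - {e})"
    using nb_eq[OF uv(1), of U] uv(2) finite_inc[OF U] by (simp add: card_Un_disjoint)
  moreover have "real (card (inc U x - {e})) = real (degree_of U x) - 1" if "x \<in> e" for x
  proof -
    have "e \<in> inc U x" using e that by (simp add: inc_def)
    then have "card (inc U x) > 0" using finite_inc[OF U] by (auto simp: card_gt_0_iff)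
    then show ?thesis using \<open>e \<in> inc U x\<close> by (simp add: degree_of_inc of_nat_diff)
  qed
  ultimately show ?thesis using uv by simp
qed

lemma degree_pos:
  assumes "U \<subseteq> E" "e \<in> U" "v \<in> e"
  shows "degree_of U v \<ge> 1"
proof -
  have "e \<in> inc U v" using assms by (simp add: inc_def)
  then show ?thesis using finite_inc[OF assms(1)] by (auto simp: degree_of_inc Suc_le_eq card_gt_0_iff)
qed

lemma edge_degree_eq:
  assumes "e \<in> E"
  shows "edge_degree E e = card (nb E e)"
proof -
  obtain u v where uv: "u \<noteq> v" "e = {u, v}" using edge_eq_doubleton assms by blast
  have "real (card (nb E e)) = (real (degree_of E u) - 1) + (real (degree_of E v) - 1)"
    using card_nb[of E e] assms uv by simp
  moreover have "degree_of E u \<ge> 1" "degree_of E v \<ge> 1" using degree_pos[of E e] assms uv by auto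
  ultimately show ?thesis using uv by (simp add: edge_degree_def)
qed

lemma degree_le_sub: "U \<subseteq> E \<Longrightarrow> degree_of U v \<le> \<Delta>"
  using card_mono[OF finite_inc[of E v], of "inc U v"] degree_le[of v]
  by (fastforce simp: degree_of_inc inc_def)

lemma avail_subset: "avail e s \<subseteq> L e"
  by (auto simp: avail_def)

lemma finite_avail: "e \<in> E \<Longrightarrow> finite (avail e s)"
  using finite_L avail_subset finite_subset by metis

lemma finite_nb: "finite (nb E e)"
  using finite_E by (simp add: nb_def)

text \<open>Each edge in \<open>S\<close> forbids at most one color, and the list exceeds the number
  of neighbors by \<open>1 / t\<close>. The surplus therefore survives every pinning, and each
  neighbor left out of \<open>S\<close> adds one more color.\<close>

lemma card_avail_ge_gen:
  assumes e: "e \<in> E" and S: "S \<subseteq> nb E e"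
  shows "real (card {c \<in> L e. \<forall>f\<in>S. s f \<noteq> c}) \<ge> 1 / t + real (card (nb E e)) - real (card S)"
proof -
  have fS: "finite S" using S finite_nb finite_subset by blast
  have "L e - s ` S \<subseteq> {c \<in> L e. \<forall>f\<in>S. s f \<noteq> c}" by auto
  then have "card (L e - s ` S) \<le> card {c \<in> L e. \<forall>f\<in>S. s f \<noteq> c}"
    using finite_L[OF e] by (intro card_mono) auto
  moreover have "card (L e) - card (s ` S) \<le> card (L e - s ` S)"
    using fS by (intro diff_card_le_card_Diff) auto
  moreover have "card (s ` S) \<le> card S" using fS by (rule card_image_le)
  moreover have "real (card (L e)) \<ge> 1 / t + real (card (nb E e))"
    using extra[OF e] edge_degree_eq[OF e] by (simp add: t_def)
  ultimately show ?thesis by linarith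
qed

lemma card_avail_ge: "e \<in> E \<Longrightarrow> real (card (avail e s)) \<ge> 1 / t"
  using card_avail_ge_gen[of e "nb E e" s] by (simp add: avail_def)

lemma card_avail_pos:
  assumes "e \<in> E"
  shows "card (avail e s) > 0"
proof -
  have "0 < 1 / t" using t_pos by simp
  from less_le_trans[OF this card_avail_ge[OF assms]] show ?thesis by simp
qed

lemma card_avail_ge2:
  assumes "e \<in> E"
  shows "card (avail e s) \<ge> 2"
proof -
  have "1 / t > 1" using Delta_pos by (simp add: t_def)
  then show ?thesis using card_avail_ge[OF assms, of s] by linarith
qed

lemma avail_cong: "(\<And>f. f \<in> nb E e \<Longrightarrow> s f = s' f) \<Longrightarrow> avail e s = avail e s'"
  by (auto simp: avail_def)

lemma avail_upd: "avail e (s(e := c)) = avail e s"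
  by (rule avail_cong) (auto simp: nb_def)

lemma h_cong: "(\<And>f. f \<in> nb E e \<Longrightarrow> s f = s' f) \<Longrightarrow> h e c s = h e c s'"
  unfolding h_def using avail_cong[of e s s'] by simp

lemma h_nonneg: "h e c s \<ge> 0"
  by (simp add: h_def)

lemma h_le: "e \<in> E \<Longrightarrow> h e c s \<le> t"
  using card_avail_ge[of e s] t_pos card_avail_pos[of e s]
  by (auto simp: h_def field_simps)

lemma colorings_iff:
  "s \<in> colorings \<longleftrightarrow> s \<in> extensional E \<and> (\<forall>e\<in>E. s e \<in> avail e s)"
  unfolding colorings_def proper_coloring_def avail_def nb_def
  by (auto; metis inf_commute)

lemma finite_colorings [simp]: "finite colorings"
proof (rule finite_subset)
  show "colorings \<subseteq> PiE E L"
    by (auto simp: colorings_iff PiE_def avail_def)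
  show "finite (PiE E L)" using finite_E finite_L by (rule finite_PiE)
qed

lemma finite_ext [simp]: "finite (ext U \<rho>)"
  by (simp add: ext_def)

lemma upd_in_colorings:
  assumes "s \<in> colorings" "e \<in> E" "c \<in> avail e s"
  shows "s(e := c) \<in> colorings"
proof -
  have "(s(e := c)) f \<in> avail f (s(e := c))" if f: "f \<in> E" for f
  proof (cases "f = e")
    case True
    then show ?thesis using assms avail_upd by simp
  next
    case False
    have 1: "s f \<in> L f" "\<And>g. g \<in> nb E f \<Longrightarrow> s g \<noteq> s f"
      using assms(1) f by (auto simp: colorings_iff avail_def)
    have 2: "c \<noteq> s f" if "e \<in> nb E f"
      using assms(3) that False f by (auto simp: avail_def nb_def)
    show ?thesis using 1 2 False by (auto simp: avail_def)
  qed
  then show ?thesis using assms by (auto simp: colorings_iff extensional_def)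
qed

lemma upd_in_ext:
  assumes "s \<in> ext U \<rho>" "U \<subseteq> E" "e \<in> U" "c \<in> avail e s"
  shows "s(e := c) \<in> ext U \<rho>"
  using assms upd_in_colorings[of s e c] by (auto simp: ext_def)

lemma ext_in_avail: "s \<in> ext U \<rho> \<Longrightarrow> e \<in> E \<Longrightarrow> s e \<in> avail e s"
  by (auto simp: ext_def colorings_iff)

lemma ext_in_palette: "s \<in> ext U \<rho> \<Longrightarrow> e \<in> E \<Longrightarrow> s e \<in> palette"
  using ext_in_avail avail_subset by (fastforce simp: palette_def)

lemma pts_subset: "U \<subseteq> E \<Longrightarrow> pts U (ext V' \<rho>) \<subseteq> U \<times> palette"
  using ext_in_palette by (fastforce simp: pts_def)

text \<open>Self-reducibility: conditioning on a pair yields a space of the same kind, with one edge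
  fewer and another boundary coloring, so the induction hypothesis covers it.\<close>

lemma fib_ext:
  assumes "x \<in> pts U (ext U \<rho>)" "U \<subseteq> E"
  obtains s where "s \<in> colorings" "fib (ext U \<rho>) x = ext (U - {fst x}) s"
proof -
  obtain s where s: "s \<in> ext U \<rho>" "s (fst x) = snd x" and xU: "fst x \<in> U"
    using assms by (auto simp: pts_def)
  have "fib (ext U \<rho>) x = ext (U - {fst x}) s"
    using s xU assms(2) by (auto simp: fib_def ext_def; metis DiffI)
  then show ?thesis using that s by (auto simp: ext_def)
qed

text \<open>Resampling one edge is reversible: both sides count the pairs \<open>(s, s(e := c'))\<close>, each weighted
  by the inverse number of available colors.\<close>

lemma sum_h_eq_wt:
  assumes U: "U \<subseteq> E" and e: "e \<in> U"
  shows "(\<Sum>s\<in>ext U \<rho>. h e c s) = wt (ext U \<rho>) (e, c)"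
proof -
  let ?A = "ext U \<rho>"
  have eE: "e \<in> E" using U e by auto
  define w where "w = (\<lambda>s. 1 / real (card (avail e s)))"
  define R where "R = {(s, s') \<in> ?A \<times> ?A. \<exists>c'. s' = s(e := c')}"
  have finR: "finite R" unfolding R_def by (rule finite_subset[of _ "?A \<times> ?A"]) auto
  have Rsym: "(s', s) \<in> R" if "(s, s') \<in> R" for s s'
    using that unfolding R_def by (auto intro!: exI[of _ "s e"])
  have Rw: "w s' = w s" if "(s, s') \<in> R" for s s'
    using that avail_upd by (auto simp: R_def w_def)
  have Rimg: "{s'. (s, s') \<in> R} = (\<lambda>c'. s(e := c')) ` avail e s" if s: "s \<in> ?A" for s
  proof -
    have "c' \<in> avail e s" if "s(e := c') \<in> ?A" for c'
      using ext_in_avail[OF that eE] avail_upd by simp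
    then show ?thesis using s upd_in_ext[OF s U e] by (auto simp: R_def)
  qed
  have sumR: "(\<Sum>(s, s')\<in>R. F s s') = (\<Sum>s\<in>?A. \<Sum>c'\<in>avail e s. F s (s(e := c')))"
    for F :: "_ \<Rightarrow> _ \<Rightarrow> real"
  proof -
    have "R = Sigma ?A (\<lambda>s. {s'. (s, s') \<in> R})" by (auto simp: R_def)
    then have "(\<Sum>(s, s')\<in>R. F s s') = (\<Sum>(s, s')\<in>Sigma ?A (\<lambda>s. {s'. (s, s') \<in> R}). F s s')" by simp
    also have "\<dots> = (\<Sum>s\<in>?A. \<Sum>s'\<in>{s'. (s, s') \<in> R}. F s s')"
      using Rimg finite_avail[OF eE] by (subst sum.Sigma) auto
    also have "\<dots> = (\<Sum>s\<in>?A. \<Sum>c'\<in>avail e s. F s (s(e := c')))"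
    proof (intro sum.cong refl)
      fix s assume s: "s \<in> ?A"
      have "inj_on (\<lambda>c'. s(e := c')) (avail e s)" by (auto intro!: inj_onI dest: fun_upd_eqD)
      then show "(\<Sum>s'\<in>{s'. (s, s') \<in> R}. F s s') = (\<Sum>c'\<in>avail e s. F s (s(e := c')))"
        unfolding Rimg[OF s] by (subst sum.reindex) auto
    qed
    finally show ?thesis .
  qed
  have "(\<Sum>s\<in>?A. h e c s) = (\<Sum>s\<in>?A. \<Sum>c'\<in>avail e s. if (s(e := c')) e = c then w s else 0)"
    using finite_avail[OF eE] by (intro sum.cong refl) (simp add: h_def w_def)
  also have "\<dots> = (\<Sum>(s, s')\<in>R. if s' e = c then w s else 0)"
    by (rule sumR[symmetric])
  also have "\<dots> = (\<Sum>(s, s')\<in>R. if s e = c then w s' else 0)"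
    by (rule sum.reindex_bij_witness[of _ prod.swap prod.swap]) (auto intro: Rsym)
  also have "\<dots> = (\<Sum>(s, s')\<in>R. if s e = c then w s else 0)"
    by (intro sum.cong refl) (auto simp: Rw)
  also have "\<dots> = (\<Sum>s\<in>?A. \<Sum>c'\<in>avail e s. if s e = c then w s else 0)"
    by (rule sumR)
  also have "\<dots> = (\<Sum>s\<in>?A. if s e = c then 1 else 0)"
  proof (intro sum.cong refl)
    fix s
    show "(\<Sum>c'\<in>avail e s. if s e = c then w s else 0) = (if s e = c then 1 else 0)"
      using card_avail_pos[OF eE, of s] by (simp add: w_def)
  qed
  also have "\<dots> = wt ?A (e, c)"
    by (simp add: wt_def fib_def sum.inter_filter[symmetric])
  finally show ?thesis .
qed

text \<open>On average \<open>h e c\<close> may be exchanged for the indicator of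
  \<open>s e = c\<close>. Thus bounds proved for each coloring in terms of \<open>h\<close> turn
  into bounds in terms of \<open>sqs\<close>.\<close>

lemma sum_h_weighted:
  assumes U: "U \<subseteq> E" and I: "I \<subseteq> U"
  shows "(\<Sum>s\<in>ext U \<rho>. \<Sum>e\<in>I. \<Sum>c\<in>palette. g (e, c) * h e c s) =
    (\<Sum>s\<in>ext U \<rho>. \<Sum>e\<in>I. g (e, s e))"
proof -
  have "(\<Sum>s\<in>ext U \<rho>. \<Sum>c\<in>palette. g (e, c) * h e c s) = (\<Sum>s\<in>ext U \<rho>. g (e, s e))"
    if e: "e \<in> I" for e
  proof -
    have eU: "e \<in> U" "e \<in> E" using e I U by auto
    have "(\<Sum>s\<in>ext U \<rho>. \<Sum>c\<in>palette. g (e, c) * h e c s) =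
        (\<Sum>c\<in>palette. g (e, c) * (\<Sum>s\<in>ext U \<rho>. h e c s))"
      by (subst sum.swap) (simp add: sum_distrib_left)
    also have "\<dots> = (\<Sum>c\<in>palette. \<Sum>s\<in>ext U \<rho>. if s e = c then g (e, c) else 0)"
      by (simp add: sum_h_eq_wt[OF U eU(1)] wt_def fib_def sum.inter_filter[symmetric] mult.commute)
    also have "\<dots> = (\<Sum>s\<in>ext U \<rho>. \<Sum>c\<in>palette. if s e = c then g (e, c) else 0)"
      by (rule sum.swap)
    also have "\<dots> = (\<Sum>s\<in>ext U \<rho>. g (e, s e))"
      using ext_in_palette eU(2) by (intro sum.cong refl) (simp add: sum.delta')
    finally show ?thesis .
  qed
  then show ?thesis
    by (subst (1 2) sum.swap) (simp cong: sum.cong)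
qed

text \<open>Recoloring one edge does not change the common value \<open>X s\<close>, since this
  value can be read off at another edge. As \<open>X s\<close> depends only on the color of
  \<open>g\<close>, it suffices to give \<open>g\<close> a prescribed color by such moves; neighbors
  of \<open>g\<close> that carry that color are recolored beforehand.\<close>

lemma constant_of_single_site:
  assumes U: "U \<subseteq> E" and card: "card U \<ge> 2"
    and eq: "\<forall>s\<in>ext U \<rho>. \<forall>e\<in>U. \<forall>f\<in>U. (\<psi> :: _ \<Rightarrow> real) (e, s e) = \<psi> (f, s f)"
  shows "\<exists>b. \<forall>s\<in>ext U \<rho>. \<forall>e\<in>U. \<psi> (e, s e) = b"
proof -
  obtain g where g: "g \<in> U" using card by fastforce
  define X where "X = (\<lambda>s. \<psi> (g, s g))"
  have Xeq: "\<psi> (e, s e) = X s" if "s \<in> ext U \<rho>" "e \<in> U" for s e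
    unfolding X_def using eq that g by blast
  have site: "X (s(e := c)) = X s"
    if s: "s \<in> ext U \<rho>" and e: "e \<in> U" and c: "c \<in> avail e s" for s e c
  proof -
    have "\<not> U \<subseteq> {e}" using card card_mono[of "{e}" U] by fastforce
    then obtain f where f: "f \<in> U" "f \<noteq> e" by auto
    have "X (s(e := c)) = \<psi> (f, (s(e := c)) f)"
      using Xeq[OF upd_in_ext[OF s U e c] f(1)] by simp
    then show ?thesis using Xeq[OF s f(1)] f(2) by simp
  qed
  have reach: "\<exists>s'\<in>ext U \<rho>. s' g = s1 g \<and> X s' = X s"
    if s1: "s1 \<in> ext U \<rho>" and s: "s \<in> ext U \<rho>" for s1 s
    using s
  proof (induction "card {f \<in> nb E g. s f = s1 g}" arbitrary: s rule: less_induct)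
    case less
    have gE: "g \<in> E" using g U by auto
    show ?case
    proof (cases "{f \<in> nb E g. s f = s1 g} = {}")
      case True
      then have "s1 g \<in> avail g s"
        using ext_in_avail[OF s1 gE] by (auto simp: avail_def)
      then show ?thesis
        using site[OF less.prems g] upd_in_ext[OF less.prems U g] by (intro bexI[of _ "s(g := s1 g)"]) auto
    next
      case False
      then obtain f where f: "f \<in> nb E g" "s f = s1 g" by auto
      have fE: "f \<in> E" using f by (simp add: nb_def)
      have fU: "f \<in> U"
      proof (rule ccontr)
        assume "f \<notin> U"
        then have "s1 f = s f" using fE s1 less.prems by (auto simp: ext_def)
        moreover have "s1 f \<noteq> s1 g" using ext_in_avail[OF s1 gE] f(1) by (auto simp: avail_def)
        ultimately show False using f(2) by simp
      qed
      \<comment> \<open>A second available color exists because \<open>1 / t > 1\<close>. As it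
        differs from the target color \<open>s1 g\<close>, the move removes one conflict and creates
        none.\<close>
      have "\<not> avail f s \<subseteq> {s f}"
        using card_avail_ge2[OF fE, of s] card_mono[of "{s f}" "avail f s"] by fastforce
      then obtain c' where c': "c' \<in> avail f s" "c' \<noteq> s f" by auto
      let ?s = "s(f := c')"
      have "{f' \<in> nb E g. ?s f' = s1 g} \<subset> {f \<in> nb E g. s f = s1 g}"
        using f c' by (auto split: if_splits)
      then have "card {f' \<in> nb E g. ?s f' = s1 g} < card {f \<in> nb E g. s f = s1 g}"
        using finite_nb by (intro psubset_card_mono) auto
      from less.hyps[OF this upd_in_ext[OF less.prems U fU c'(1)]]
      show ?thesis using site[OF less.prems fU c'(1)] by simp
    qed
  qed
  have "X s = X s1" if s: "s \<in> ext U \<rho>" and s1: "s1 \<in> ext U \<rho>" for s s1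
  proof -
    obtain s' where "s' \<in> ext U \<rho>" "s' g = s1 g" "X s' = X s" using reach[OF s1 s] by blast
    then show ?thesis by (simp add: X_def)
  qed
  then show ?thesis using Xeq by metis
qed

end

section \<open>Vertex weights and their recursion under pinning\<close>

context list_coloring
begin

text \<open>The weight of a vertex of degree \<open>d\<close> solves a discrete form of the differential inequality
  \<open>u' \<ge> 2 t u\<^sup>2\<close> for \<open>u = wgt d / (t * (d - 1))\<close>; the solution \<open>1 / (2 - 2 t d)\<close> stays bounded because
  \<open>t * d \<le> 3 / 4\<close>. The bounded term \<open>20 * min d 200\<close> absorbs the error at small degrees.\<close>

definition den :: "nat \<Rightarrow> real" where
  "den d = 19 / 10 - t * (21 / 10 * real d + 20 * real (min d 200))"

definition wgt :: "nat \<Rightarrow> real" where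
  "wgt d = t * (real d - 1) / den d"

text \<open>At a vertex of degree 2 this set is empty exactly if its two edges meet no other edge of
  \<open>U\<close>, which is the case that has to be split off.\<close>

definition second :: "'v set set \<Rightarrow> 'v \<Rightarrow> 'v set set" where
  "second U v = {g \<in> U. v \<notin> g \<and> (\<exists>e\<in>inc U v. g \<inter> e \<noteq> {})}"

text \<open>At degree 2 the recursion for \<open>wgt\<close> has no slack. There it comes from the second neighborhood:
  \<open>j * (sqrt j - sqrt (j - 1)) \<ge> 1 / 2\<close> for \<open>j \<ge> 1\<close>.\<close>

definition G :: "'v set set \<Rightarrow> 'v \<Rightarrow> real" where
  "G U v = (if degree_of U v \<le> 1 then 0
     else if degree_of U v = 2 then t / 2 + 12 * t\<^sup>2 * sqrt (real (card (second U v)))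
     else wgt (degree_of U v))"

text \<open>Bounds the norm of the operator at \<open>v\<close>. The additional \<open>t\<close> is
  the amount by which the form of \<open>R v\<close> may be negative.\<close>

definition bnd :: "'v set set \<Rightarrow> 'v \<Rightarrow> real" where
  "bnd U v = (if degree_of U v \<le> 1 then 0 else G U v + t)"

lemma t_Delta: "t * real \<Delta> = 3 / 4"
  using Delta_pos by (simp add: t_def)

lemma t_d:
  assumes "d \<le> \<Delta>"
  shows "t * real d \<le> 3 / 4"
proof -
  have "t * real d \<le> t * real \<Delta>" using t_pos assms by (intro mult_left_mono) auto
  then show ?thesis using t_Delta by linarith
qed

lemma card_second_le:
  assumes U: "U \<subseteq> E" and d: "degree_of U v = 2"
  shows "card (second U v) \<le> 2 * \<Delta>"
proof -
  have "second U v \<subseteq> (\<Union>e\<in>inc U v. \<Union>x\<in>e - {v}. inc U x)"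
    by (auto simp: second_def inc_def)
  then have "card (second U v) \<le> card (\<Union>e\<in>inc U v. \<Union>x\<in>e - {v}. inc U x)"
    using finite_inc[OF U] finite_edge U by (intro card_mono) (auto simp: inc_def)
  also have "\<dots> \<le> (\<Sum>e\<in>inc U v. card (\<Union>x\<in>e - {v}. inc U x))"
    using finite_inc[OF U] by (rule card_UN_le)
  also have "\<dots> \<le> (\<Sum>e\<in>inc U v. \<Delta>)"
  proof (intro sum_mono)
    fix e assume e: "e \<in> inc U v"
    then have eE: "e \<in> E" "v \<in> e" using U by (auto simp: inc_def)
    have "card (e - {v}) = 1" using card_edge[OF eE(1)] eE by simp
    then obtain u where "e - {v} = {u}" by (auto simp: card_1_singleton_iff)
    then show "card (\<Union>x\<in>e - {v}. inc U x) \<le> \<Delta>"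
      using degree_le_sub[OF U, of u] by (simp add: degree_of_inc)
  qed
  also have "\<dots> = 2 * \<Delta>" using d by (simp add: degree_of_inc)
  finally show ?thesis .
qed

end

locale list_coloring_large = list_coloring E L \<Delta>
  for E :: "'v set set" and L :: "'v set \<Rightarrow> nat set" and \<Delta> :: nat +
  assumes large: "\<Delta> \<le> 1 \<or> \<Delta> \<ge> 400000"
begin

lemma t_small:
  assumes "\<Delta> \<ge> 2"
  shows "t \<le> 1 / 500000"
proof -
  have "real \<Delta> \<ge> 400000" using large assms by linarith
  then show ?thesis by (simp add: t_def field_simps)
qed

text \<open>The worst case is
  \<open>19 / 10 - 21 / 10 * (3 / 4) - 20 * 200 / 500000 = 317 / 1000\<close>.\<close>

lemma den_bounds:
  assumes "2 \<le> d" "d \<le> \<Delta>"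
  shows "den d \<ge> 3 / 10" "den d \<le> 19 / 10"
proof -
  have "t \<le> 1 / 500000" using t_small assms by simp
  moreover have "real (min d 200) \<le> 200" by simp
  ultimately have "t * real (min d 200) \<le> 1 / 500000 * 200"
    using t_pos by (intro mult_mono) auto
  moreover have "t * real d \<le> 3 / 4" using t_d assms by simp
  ultimately show "den d \<ge> 3 / 10" by (simp add: den_def algebra_simps)
  show "den d \<le> 19 / 10" using t_pos by (simp add: den_def)
qed

lemma wgt_bounds:
  assumes "2 \<le> d" "d \<le> \<Delta>"
  shows "wgt d \<ge> t * (real d - 1) / (19 / 10)" "wgt d \<le> 4 * (t * (real d - 1))"
proof -
  have 0: "t * (real d - 1) \<ge> 0" using t_pos assms by simp
  show "wgt d \<ge> t * (real d - 1) / (19 / 10)"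
    unfolding wgt_def using den_bounds[OF assms] 0 by (intro divide_left_mono) auto
  have "wgt d \<le> t * (real d - 1) / (3 / 10)"
    unfolding wgt_def using den_bounds[OF assms] 0 by (intro divide_left_mono) auto
  then show "wgt d \<le> 4 * (t * (real d - 1))" using 0 by simp
qed

text \<open>Consecutive values \<open>b\<close>, \<open>a\<close> of \<open>den\<close> differ by
  \<open>t * \<delta>\<close>, so \<open>1 / a - 1 / b\<close> is
  \<open>t * \<delta> / (a * b)\<close>. After division by \<open>t\<^sup>2 / a\<^sup>2\<close> the
  claim compares \<open>2 * (x - 1 + a)\<^sup>2\<close> with
  \<open>\<delta> * (x - 1) * (x - 2)\<close>, up to the factor \<open>a / b\<close> close to 1. For
  large \<open>x\<close> any \<open>\<delta>\<close> slightly above 2 suffices, whence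
  \<open>21 / 10\<close>; at \<open>x = 3\<close> about 16 is needed, which the extra slope 20 up to
  degree 200 provides.\<close>

lemma wgt_recursion:
  assumes "3 \<le> d" "d \<le> \<Delta>"
  shows "(real d - 1) * wgt (d - 1) + 2 * (wgt d + t)\<^sup>2 \<le> (real d - 2) * wgt d"
proof -
  define x where "x = real d"
  have x: "x \<ge> 3" using assms by (simp add: x_def)
  have rd: "real (d - 1) = x - 1" using assms by (simp add: x_def of_nat_diff)
  define a where "a = den d"
  define b where "b = den (d - 1)"
  define \<delta> :: real where "\<delta> = (if d \<le> 200 then 221 / 10 else 21 / 10)"
  have b: "b = a + t * \<delta>"
  proof -
    have "real (min d 200) - real (min (d - 1) 200) = (if d \<le> 200 then 1 else 0)"
      using assms by (auto simp: of_nat_diff)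
    moreover have "b - a = t * (21 / 10 * (real d - real (d - 1)) + 20 * (real (min d 200) - real (min (d - 1) 200)))"
      by (simp add: a_def b_def den_def right_diff_distrib distrib_left)
    moreover have "real d - real (d - 1) = 1" using assms by (simp add: of_nat_diff)
    ultimately have "b - a = t * (21 / 10 * 1 + 20 * (if d \<le> 200 then 1 else 0))"
      by (simp only:)
    then have "b - a = t * \<delta>" by (simp add: \<delta>_def)
    then show ?thesis by simp
  qed
  have bounds: "a \<ge> 3 / 10" "a \<le> 19 / 10" "b \<ge> 3 / 10"
    using den_bounds[of d] den_bounds[of "d - 1"] assms by (auto simp: a_def b_def)
  have t: "t \<le> 1 / 500000" using t_small assms by simp
  have d0: "\<delta> > 0" "\<delta> \<le> 221 / 10" by (auto simp: \<delta>_def)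
  have "t * \<delta> \<le> 1 / 500000 * (221 / 10)" using t t_pos d0 by (intro mult_mono) auto
  then have ab: "a \<ge> 999 / 1000 * b" using b bounds by simp
  have poly: "2 * (x + 1)\<^sup>2 \<le> 999 / 1000 * \<delta> * ((x - 1) * (x - 2))"
  proof (cases "d \<le> 200")
    case True
    have "(x - 3) * (20 * x - 10) \<ge> 0" using x by simp
    then have "2 * (x + 1)\<^sup>2 \<le> 22 * ((x - 1) * (x - 2))"
      by (simp add: power2_eq_square algebra_simps)
    moreover have "(x - 1) * (x - 2) \<ge> 0" using x by simp
    ultimately show ?thesis using True by (simp add: \<delta>_def)
  next
    case False
    then have "x \<ge> 200" by (simp add: x_def)
    have "200 * x \<le> x * x" using \<open>x \<ge> 200\<close> by (intro mult_right_mono) auto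
    moreover have "2 * (x + 1)\<^sup>2 = 2 * (x * x) + 4 * x + 2"
      "(x - 1) * (x - 2) = x * x - 3 * x + 2"
      by (simp_all add: power2_eq_square algebra_simps)
    ultimately have "2 * (x + 1)\<^sup>2 \<le> 209 / 100 * ((x - 1) * (x - 2))"
      using \<open>x \<ge> 200\<close> by linarith
    moreover have "(x - 1) * (x - 2) \<ge> 0" using x by simp
    ultimately show ?thesis using False by (simp add: \<delta>_def)
  qed
  have "2 * (x - 1 + a)\<^sup>2 \<le> 2 * (x + 1)\<^sup>2"
    using bounds x by (intro mult_left_mono power_mono) auto
  also have "\<dots> \<le> \<delta> * ((x - 1) * (x - 2)) * (999 / 1000)" using poly by simp
  also have "\<dots> \<le> \<delta> * ((x - 1) * (x - 2)) * (a / b)"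
  proof (rule mult_left_mono)
    show "999 / 1000 \<le> a / b" using ab bounds by (simp add: field_simps)
    have "(x - 1) * (x - 2) \<ge> 0" using x by simp
    then show "\<delta> * ((x - 1) * (x - 2)) \<ge> 0" using d0(1) by simp
  qed
  finally have main: "2 * (x - 1 + a)\<^sup>2 \<le> \<delta> * ((x - 1) * (x - 2)) * (a / b)" .
  have "2 * (wgt d + t)\<^sup>2 = t\<^sup>2 / a\<^sup>2 * (2 * (x - 1 + a)\<^sup>2)"
    using bounds by (simp add: wgt_def a_def[symmetric] x_def[symmetric] power2_eq_square field_simps)
  also have "\<dots> \<le> t\<^sup>2 / a\<^sup>2 * (\<delta> * ((x - 1) * (x - 2)) * (a / b))"
    by (intro mult_left_mono main) auto
  also have "\<dots> = t * ((x - 1) * (x - 2)) * (t * \<delta> / (a * b))"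
    using bounds by (simp add: power2_eq_square)
  also have "t * \<delta> / (a * b) = 1 / a - 1 / b"
    using bounds b by (simp add: field_simps)
  also have "t * ((x - 1) * (x - 2)) * (1 / a - 1 / b) = (x - 2) * wgt d - (x - 1) * wgt (d - 1)"
  proof -
    have "real (d - 1) - 1 = x - 2" using rd by simp
    then have w: "wgt d = t * (x - 1) / a" "wgt (d - 1) = t * (x - 2) / b"
      unfolding wgt_def a_def b_def x_def by simp_all
    have dist: "t * (p * q) * (1 / a - 1 / b) = q * (t * p / a) - p * (t * q / b)" for p q :: real
      by (simp add: right_diff_distrib mult_ac)
    show ?thesis unfolding w by (rule dist)
  qed
  finally show ?thesis by (simp add: x_def)
qed

text \<open>The constant \<open>26 / 1000\<close> lies just below \<open>10 / 19 - 1 / 2\<close>,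
  the gap between \<open>t / 2\<close> and the lower bound on \<open>wgt 2\<close>. The term is of
  order \<open>t * sqrt t\<close>, since \<open>t * j\<close> is at most
  \<open>3 / 2\<close>.\<close>

lemma sqrt_second_small:
  assumes U: "U \<subseteq> E" and d: "degree_of U v = 2"
  shows "12 * t\<^sup>2 * sqrt (real (card (second U v))) \<le> t * (26 / 1000)"
proof -
  define j where "j = real (card (second U v))"
  have "2 \<le> \<Delta>" using degree_le_sub[OF U, of v] d by simp
  have ts: "t \<le> 1 / 500000" using t_small[OF \<open>2 \<le> \<Delta>\<close>] .
  have "j \<le> 2 * real \<Delta>" using card_second_le[OF U d] by (simp add: j_def)
  then have "t * (t * j) \<le> t * (t * (2 * real \<Delta>))" using t_pos by (intro mult_left_mono) auto
  also have "\<dots> = t * (3 / 2)" using t_Delta by simp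
  also have "\<dots> \<le> (2 / 1000)\<^sup>2" using ts by (simp add: power2_eq_square)
  finally have "(t * sqrt j)\<^sup>2 \<le> (2 / 1000)\<^sup>2"
    by (simp add: power_mult_distrib j_def power2_eq_square mult_ac)
  then have "t * sqrt j \<le> 2 / 1000" by (rule power2_le_imp_le) auto
  then have "t * (12 * (t * sqrt j)) \<le> t * (26 / 1000)" using t_pos by (intro mult_left_mono) auto
  then show ?thesis by (simp add: j_def power2_eq_square mult_ac)
qed

text \<open>The lower bound is half of the upper bound on the form of \<open>R v\<close>, so that
  subtracting \<open>R v\<close> does not enlarge the norm by more than \<open>t\<close>. The upper
  bound lets the recursion at degree 3, where a pinning leads to degree 2, be carried out with
  \<open>wgt\<close> alone.\<close>

lemma G_bounds:
  assumes U: "U \<subseteq> E" and d: "degree_of U v \<ge> 2"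
  shows "t * (real (degree_of U v) - 1) / 2 \<le> G U v" "G U v \<le> wgt (degree_of U v)"
proof -
  have dD: "degree_of U v \<le> \<Delta>" using degree_le_sub[OF U] .
  have "t * (real (degree_of U v) - 1) / 2 \<le> t * (real (degree_of U v) - 1) / (19 / 10)"
    using t_pos d by simp
  then have *: "t * (real (degree_of U v) - 1) / 2 \<le> wgt (degree_of U v)"
    using wgt_bounds(1)[OF d dD] by linarith
  show "t * (real (degree_of U v) - 1) / 2 \<le> G U v"
    using * d by (simp add: G_def)
  show "G U v \<le> wgt (degree_of U v)"
  proof (cases "degree_of U v = 2")
    case True
    then show ?thesis using sqrt_second_small[OF U True] wgt_bounds(1)[OF d dD] t_pos
      by (simp add: G_def)
  next
    case False
    then show ?thesis using d by (simp add: G_def)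
  qed
qed

lemma bnd_bounds:
  assumes U: "U \<subseteq> E" and d: "degree_of U v \<ge> 1"
  shows "0 \<le> bnd U v" "bnd U v \<le> 5 * t * (real (degree_of U v) - 1)"
proof -
  show "0 \<le> bnd U v"
  proof (cases "degree_of U v \<ge> 2")
    case True
    have "0 \<le> t * (real (degree_of U v) - 1) / 2" using t_pos True by simp
    then show ?thesis using G_bounds(1)[OF U True] t_pos by (simp add: bnd_def)
  qed (simp add: bnd_def)
  show "bnd U v \<le> 5 * t * (real (degree_of U v) - 1)"
  proof (cases "degree_of U v \<ge> 2")
    case True
    have "t * 1 \<le> t * (real (degree_of U v) - 1)"
      using t_pos True by (intro mult_left_mono) auto
    then show ?thesis
      using G_bounds(2)[OF U True] wgt_bounds(2)[OF True degree_le_sub[OF U]] True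
      by (simp add: bnd_def)
  next
    case False
    with d have "degree_of U v = 1" by simp
    then show ?thesis by (simp add: bnd_def)
  qed
qed

text \<open>The first bound is the smallness that the trickle-down argument demands for every number
  of edges. The second yields the final constant: an edge has at most \<open>2 * \<Delta>\<close>
  neighbors, and \<open>5 * t * (2 * \<Delta>) = 15 / 2\<close>.\<close>

lemma sum_bnd_le:
  assumes U: "U \<subseteq> E" and e: "e \<in> U"
  shows "(\<Sum>v\<in>e. bnd U v) \<le> (real (card U) - 1) / 100" "(\<Sum>v\<in>e. bnd U v) \<le> 10"
proof -
  have le: "(\<Sum>v\<in>e. bnd U v) \<le> 5 * t * real (card (nb U e))"
    unfolding card_nb[OF U e] sum_distrib_left
    by (intro sum_mono bnd_bounds[OF U] degree_pos[OF U e])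
  have "nb U e \<subseteq> U - {e}" by (auto simp: nb_def)
  then have "card (nb U e) \<le> card (U - {e})"
    using finite_sub[OF U] by (intro card_mono) auto
  moreover have cU: "real (card (U - {e})) = real (card U) - 1"
    using card_Suc_Diff1[OF finite_sub[OF U] e] by linarith
  ultimately have nbU: "real (card (nb U e)) \<le> real (card U) - 1" by linarith
  have "real (card (nb U e)) \<le> (\<Sum>v\<in>e. real \<Delta> - 1)"
    unfolding card_nb[OF U e] using degree_le_sub[OF U] by (intro sum_mono) auto
  also have "\<dots> \<le> 2 * real \<Delta>" using card_edge e U by auto
  finally have nbD: "real (card (nb U e)) \<le> 2 * real \<Delta>" .
  have "5 * t * real (card (nb U e)) \<le> 5 * t * (2 * real \<Delta>)"
    using nbD t_pos by (intro mult_left_mono) auto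
  also have "\<dots> = 10 * (t * real \<Delta>)" by simp
  finally show "(\<Sum>v\<in>e. bnd U v) \<le> 10" using le t_Delta by linarith
  show "(\<Sum>v\<in>e. bnd U v) \<le> (real (card U) - 1) / 100"
  proof (cases "\<Delta> \<ge> 2")
    case True
    have "5 * t * real (card (nb U e)) \<le> 5 * (1 / 500000) * (real (card U) - 1)"
      using nbU t_pos t_small[OF True] by (intro mult_mono) auto
    also have "\<dots> \<le> (real (card U) - 1) / 100"
      using order_trans[OF of_nat_0_le_iff nbU] by (simp add: field_simps)
    finally show ?thesis using le by linarith
  next
    case False
    then have "degree_of U v \<le> 1" for v using degree_le_sub[OF U, of v] by linarith
    then have "(\<Sum>v\<in>e. bnd U v) = 0" by (simp add: bnd_def)
    then show ?thesis using order_trans[OF of_nat_0_le_iff nbU] by simp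
  qed
qed

lemma G_remove_inc:
  assumes U: "U \<subseteq> E" and g: "g \<in> inc U v"
  shows "degree_of (U - {g}) v = degree_of U v - 1"
  using g finite_inc[OF U] by (simp add: degree_of_inc inc_remove)

lemma degree_remove_other: "g \<notin> inc U v \<Longrightarrow> degree_of (U - {g}) v = degree_of U v"
  by (simp add: degree_of_inc inc_remove)

lemma second_remove: "g \<notin> inc U v \<Longrightarrow> second (U - {g}) v = second U v - {g}"
  by (auto simp: second_def inc_remove)

text \<open>Any of the \<open>j\<close> edges of the second neighborhood may be pinned, so the gain
  is \<open>j\<close> times one decrement. The root is convenient because this product stays bounded
  below while the function itself is small compared with \<open>\<Delta>\<close>.\<close>

lemma sqrt_gap:
  assumes "(j::nat) \<ge> 1"
  shows "real j * (sqrt (real j) - sqrt (real (j - 1))) \<ge> 1 / 2"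
proof -
  define a where "a = sqrt (real j)"
  define b where "b = sqrt (real (j - 1))"
  have ab: "b \<le> a" "b \<ge> 0" "a \<ge> 1" using assms by (auto simp: a_def b_def)
  have sq: "a\<^sup>2 - b\<^sup>2 = 1" "a\<^sup>2 = real j" using assms by (auto simp: a_def b_def of_nat_diff)
  have "1 = (a - b) * (a + b)" using sq by (simp add: power2_eq_square algebra_simps)
  also have "\<dots> \<le> (a - b) * (2 * a)" using ab by (intro mult_left_mono) auto
  also have "\<dots> \<le> (a - b) * (2 * a\<^sup>2)"
    using ab by (intro mult_left_mono) (auto simp: power2_eq_square)
  finally show ?thesis using sq by (simp add: a_def b_def mult_ac)
qed

text \<open>There are \<open>k - 1\<close> pinnings of other edges on the left, but the off-diagonal
  part only allows the factor \<open>k - 2\<close>. One copy of \<open>G U v\<close> plus the square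
  must thus be gained from pinnings that lower the weight. At degree 2 the single other edge at
  \<open>v\<close> pays exactly the copy, and the square is left to the second neighborhood.\<close>

lemma G_recursion:
  assumes U: "U \<subseteq> E" and e: "e \<in> U" "v \<in> e"
    and second: "degree_of U v = 2 \<Longrightarrow> second U v \<noteq> {}"
  shows "(\<Sum>g\<in>U - {e}. G (U - {g}) v) \<le> (real (card U) - 2) * G U v - 2 * (bnd U v)\<^sup>2"
proof -
  let ?d = "degree_of U v"
  have eI: "e \<in> inc U v" using e by (simp add: inc_def)
  have finU: "finite U" using finite_sub[OF U] .
  have d1: "?d \<ge> 1" using degree_pos[OF U e] .
  have cI: "real (card (inc U v - {e})) = real ?d - 1"
    using card_Suc_Diff1[OF finite_inc[OF U] eI] by (simp add: degree_of_inc)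
  have cO: "real (card (U - inc U v)) = real (card U) - real ?d"
    using card_Diff_subset[OF finite_inc[OF U] inc_subset] card_mono[OF finU inc_subset]
    by (simp add: degree_of_inc of_nat_diff)
  have split: "(\<Sum>g\<in>U - {e}. f g) = (\<Sum>g\<in>inc U v - {e}. f g) + (\<Sum>g\<in>U - inc U v. f g)" for f :: "_ \<Rightarrow> real"
  proof -
    have "U - {e} = (inc U v - {e}) \<union> (U - inc U v)" using eI inc_subset by auto
    then show ?thesis using finU finite_inc[OF U] by (simp add: sum.union_disjoint Diff_Int_distrib2)
  qed
  consider "?d = 1" | "?d = 2" | "?d \<ge> 3" using d1 by linarith
  then show ?thesis
  proof cases
    case 1
    have "G (U - {g}) v = 0" for g
    proof -
      have "card (inc U v - {g}) \<le> card (inc U v)"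
        by (rule card_mono) (auto simp: finite_inc[OF U])
      then show ?thesis using 1 by (simp add: G_def inc_remove degree_of_inc)
    qed
    then show ?thesis using 1 by (simp add: G_def bnd_def)
  next
    case 2
    define j where "j = card (second U v)"
    have finS: "finite (second U v)" using finU by (simp add: second_def)
    have j1: "j \<ge> 1" using second[OF 2] finS by (simp add: j_def Suc_le_eq card_gt_0_iff)
    have SU: "second U v \<subseteq> U - inc U v" by (auto simp: second_def inc_def)
    define Gj where "Gj = (\<lambda>j::nat. t / 2 + 12 * t\<^sup>2 * sqrt (real j))"
    have "(\<Sum>g\<in>inc U v - {e}. G (U - {g}) v) = 0"
      using G_remove_inc[OF U] 2 by (intro sum.neutral) (auto simp: G_def)
    moreover have "(\<Sum>g\<in>U - inc U v. G (U - {g}) v) =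
        (\<Sum>g\<in>second U v. G (U - {g}) v) + (\<Sum>g\<in>(U - inc U v) - second U v. G (U - {g}) v)"
      using sum.subset_diff[OF SU] finU by (simp add: add.commute)
    moreover have "(\<Sum>g\<in>second U v. G (U - {g}) v) = real j * Gj (j - 1)"
    proof -
      have "G (U - {g}) v = Gj (j - 1)" if "g \<in> second U v" for g
      proof -
        have g: "g \<notin> inc U v" using that SU by auto
        then show ?thesis using that 2 finS
          by (simp add: G_def Gj_def degree_remove_other second_remove j_def)
      qed
      then show ?thesis by (simp add: j_def)
    qed
    moreover have "(\<Sum>g\<in>(U - inc U v) - second U v. G (U - {g}) v) = (real (card U) - 2 - real j) * Gj j"
    proof -
      have "G (U - {g}) v = Gj j" if "g \<in> (U - inc U v) - second U v" for g
        using that 2 by (simp add: G_def Gj_def degree_remove_other second_remove j_def)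
      moreover have "real (card ((U - inc U v) - second U v)) = real (card U) - 2 - real j"
        using card_Diff_subset[OF finS SU] card_mono[OF _ SU] finU cO 2
        by (simp add: j_def of_nat_diff)
      ultimately show ?thesis by simp
    qed
    moreover have GU: "G U v = Gj j" using 2 by (simp add: G_def Gj_def j_def)
    ultimately have "(\<Sum>g\<in>U - {e}. G (U - {g}) v) = (real (card U) - 2) * G U v - real j * (Gj j - Gj (j - 1))"
      by (simp add: split algebra_simps)
    moreover have "real j * (Gj j - Gj (j - 1)) = 12 * t\<^sup>2 * (real j * (sqrt (real j) - sqrt (real (j - 1))))"
      by (simp add: Gj_def algebra_simps)
    moreover have "12 * t\<^sup>2 * (real j * (sqrt (real j) - sqrt (real (j - 1)))) \<ge> 12 * t\<^sup>2 * (1 / 2)"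
      using sqrt_gap[OF j1] by (intro mult_left_mono) auto
    \<comment> \<open>Here \<open>bnd U v\<close> is about \<open>3 / 2 * t\<close>. The coefficient
      12 in \<open>G\<close> is chosen so that its gain \<open>12 * t\<^sup>2 * (1 / 2)\<close>
      exceeds twice the square.\<close>
    moreover have "2 * (bnd U v)\<^sup>2 \<le> 6 * t\<^sup>2"
    proof -
      have "bnd U v = t / 2 + 12 * t\<^sup>2 * sqrt (real (card (second U v))) + t"
        using 2 by (simp add: bnd_def G_def)
      then have "bnd U v \<le> t * (153 / 100)" "0 \<le> bnd U v"
        using sqrt_second_small[OF U 2] t_pos bnd_bounds(1)[OF U d1] by linarith+
      then have "(bnd U v)\<^sup>2 \<le> (t * (153 / 100))\<^sup>2" by (intro power_mono)
      also have "\<dots> \<le> 3 * t\<^sup>2" by (simp add: power2_eq_square)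
      finally show ?thesis by simp
    qed
    ultimately show ?thesis by linarith
  next
    case 3
    have dD: "?d \<le> \<Delta>" using degree_le_sub[OF U] .
    have GU: "G U v = wgt ?d" "bnd U v = wgt ?d + t" using 3 by (auto simp: G_def bnd_def)
    have "(\<Sum>g\<in>inc U v - {e}. G (U - {g}) v) \<le> (\<Sum>g\<in>inc U v - {e}. wgt (?d - 1))"
    proof (intro sum_mono)
      fix g assume "g \<in> inc U v - {e}"
      then have "degree_of (U - {g}) v = ?d - 1" using G_remove_inc[OF U] by auto
      moreover have "U - {g} \<subseteq> E" "2 \<le> ?d - 1" using U 3 by auto
      ultimately show "G (U - {g}) v \<le> wgt (?d - 1)"
        using G_bounds(2)[of "U - {g}" v] by simp
    qed
    moreover have "(\<Sum>g\<in>U - inc U v. G (U - {g}) v) = (\<Sum>g\<in>U - inc U v. wgt ?d)"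
      using 3 by (intro sum.cong refl) (auto simp: G_def degree_remove_other)
    ultimately have "(\<Sum>g\<in>U - {e}. G (U - {g}) v) \<le> (real ?d - 1) * wgt (?d - 1) + (real (card U) - real ?d) * wgt ?d"
      using cI cO by (simp add: split)
    also have "\<dots> = ((real ?d - 1) * wgt (?d - 1) - (real ?d - 2) * wgt ?d) + (real (card U) - 2) * wgt ?d"
      by (simp add: algebra_simps)
    also have "\<dots> \<le> (real (card U) - 2) * wgt ?d - 2 * (wgt ?d + t)\<^sup>2"
      using wgt_recursion[OF 3 dD] by linarith
    finally show ?thesis by (simp add: GU)
  qed
qed

end

section \<open>The comparison operator\<close>

lemma sum_swap_off_diagonal:
  fixes F :: "'a \<Rightarrow> 'a \<Rightarrow> real"
  assumes "finite U" "finite I"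
  shows "(\<Sum>g\<in>U. \<Sum>e\<in>I - {g}. F g e) = (\<Sum>e\<in>I. \<Sum>g\<in>U - {e}. F g e)"
proof -
  have off: "(\<Sum>e\<in>J - {g}. f e) = (\<Sum>e\<in>J. if e \<noteq> g then f e else 0)"
    if "finite J" for J and g :: 'a and f :: "'a \<Rightarrow> real"
    using that by (intro sum.mono_neutral_cong_left) auto
  have "(\<Sum>g\<in>U. \<Sum>e\<in>I - {g}. F g e) = (\<Sum>g\<in>U. \<Sum>e\<in>I. if e \<noteq> g then F g e else 0)"
    using assms by (simp add: off)
  also have "\<dots> = (\<Sum>e\<in>I. \<Sum>g\<in>U. if g \<noteq> e then F g e else 0)"
    by (subst sum.swap) (simp add: eq_commute)
  also have "\<dots> = (\<Sum>e\<in>I. \<Sum>g\<in>U - {e}. F g e)"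
    using assms by (simp add: off)
  finally show ?thesis .
qed

text \<open>A pair is lost only when one of its two members is removed. As the coefficients do not
  depend on the removed element, this is an identity, and it expresses the martingale
  property.\<close>

lemma sum_remove_pairs:
  fixes a :: "'a \<Rightarrow> 'a \<Rightarrow> real"
  assumes U: "finite U" and I: "I \<subseteq> U"
  shows "(\<Sum>g\<in>U. \<Sum>e\<in>I - {g}. \<Sum>f\<in>I - {g} - {e}. a e f) =
    (real (card U) - 2) * (\<Sum>e\<in>I. \<Sum>f\<in>I - {e}. a e f)"
proof -
  have finI: "finite I" using assms finite_subset by blast
  have "(\<Sum>g\<in>U. \<Sum>e\<in>I - {g}. \<Sum>f\<in>I - {g} - {e}. a e f) =
      (\<Sum>e\<in>I. \<Sum>g\<in>U - {e}. \<Sum>f\<in>(I - {e}) - {g}. a e f)"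
    using sum_swap_off_diagonal[OF U finI, of "\<lambda>g e. \<Sum>f\<in>I - {g} - {e}. a e f"]
    by (simp add: Diff_insert[symmetric] insert_commute)
  also have "\<dots> = (\<Sum>e\<in>I. \<Sum>f\<in>I - {e}. \<Sum>g\<in>U - {e} - {f}. a e f)"
    using U finI by (intro sum.cong refl sum_swap_off_diagonal) auto
  also have "\<dots> = (\<Sum>e\<in>I. \<Sum>f\<in>I - {e}. (real (card U) - 2) * a e f)"
  proof (intro sum.cong refl)
    fix e f assume ef: "e \<in> I" "f \<in> I - {e}"
    then have "e \<in> U" "f \<in> U - {e}" using I by auto
    then have "Suc (Suc (card (U - {e} - {f}))) = card U"
      using U by (metis card_Suc_Diff1 finite_Diff)
    then have "real (card (U - {e} - {f})) = real (card U) - 2" by linarith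
    then show "(\<Sum>g\<in>U - {e} - {f}. a e f) = (real (card U) - 2) * a e f" by simp
  qed
  finally show ?thesis by (simp add: sum_distrib_left)
qed

lemma sum_off_diagonal_product:
  fixes a :: "'a \<Rightarrow> real"
  assumes "finite I"
  shows "(\<Sum>e\<in>I. \<Sum>f\<in>I - {e}. a e * a f) = (\<Sum>e\<in>I. a e)\<^sup>2 - (\<Sum>e\<in>I. (a e)\<^sup>2)"
proof -
  have "(\<Sum>e\<in>I. \<Sum>f\<in>I - {e}. a e * a f) = (\<Sum>e\<in>I. a e * (\<Sum>f\<in>I. a f) - (a e)\<^sup>2)"
    using assms by (intro sum.cong refl)
      (simp add: sum_distrib_left[symmetric] sum_diff1 power2_eq_square right_diff_distrib)
  then show ?thesis by (simp add: sum_subtractf sum_distrib_right[symmetric] power2_eq_square)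
qed

lemma quad_neutral:
  assumes "finite Y" "X \<subseteq> Y"
    and "\<And>x y. x \<in> Y \<Longrightarrow> y \<in> Y \<Longrightarrow> x \<notin> X \<or> y \<notin> X \<Longrightarrow> b x y = 0"
  shows "quad X b \<phi> = quad Y b \<phi>"
  unfolding quad_def
proof (rule sum.mono_neutral_cong_left[OF assms(1,2)])
  show "\<forall>x\<in>Y - X. (\<Sum>y\<in>Y. b x y * \<phi> x * \<phi> y) = 0"
    using assms(3) by (auto intro!: sum.neutral)
  fix x assume x: "x \<in> X"
  then show "(\<Sum>y\<in>X. b x y * \<phi> x * \<phi> y) = (\<Sum>y\<in>Y. b x y * \<phi> x * \<phi> y)"
    using assms by (intro sum.mono_neutral_left) auto
qed

context list_coloring_large
begin

text \<open>The form of \<open>R v\<close> at one coloring, before averaging. Pinning merely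
  restricts the later sum over colorings, so all recursions can be checked for each \<open>s\<close>
  separately.\<close>

definition pairform :: "'v set set \<Rightarrow> ('v set \<times> nat \<Rightarrow> real) \<Rightarrow> ('v set \<Rightarrow> nat) \<Rightarrow> real" where
  "pairform I \<phi> s = (\<Sum>e\<in>I. \<Sum>f\<in>I - {e}. \<Sum>c\<in>palette. (\<phi> (e, c) * h e c s) * (\<phi> (f, c) * h f c s))"

definition vform :: "'v set set \<Rightarrow> 'v \<Rightarrow> ('v set \<times> nat \<Rightarrow> real) \<Rightarrow> ('v set \<Rightarrow> nat) \<Rightarrow> real" where
  "vform U v \<phi> s = G U v * sqs (inc U v) \<phi> s - pairform (inc U v) \<phi> s"

text \<open>The sum runs over the vertices of \<open>E\<close> rather than \<open>U\<close>, so that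
  its index set is the same for all pinned instances.\<close>

definition nform :: "'v set set \<Rightarrow> ('v set \<times> nat \<Rightarrow> real) \<Rightarrow> ('v set \<Rightarrow> nat) \<Rightarrow> real" where
  "nform U \<phi> s = (\<Sum>v\<in>\<Union>E. vform U v \<phi> s)"

definition offdiag :: "('v set \<Rightarrow> nat) set \<Rightarrow> 'v \<Rightarrow> 'v set \<times> nat \<Rightarrow> 'v set \<times> nat \<Rightarrow> real" where
  "offdiag A v x y = (if fst x \<noteq> fst y \<and> snd x = snd y \<and> v \<in> fst x \<and> v \<in> fst y
     then - (\<Sum>s\<in>A. h (fst x) (snd x) s * h (fst y) (snd y) s) else 0)"

definition nkv :: "'v set set \<Rightarrow> ('v set \<Rightarrow> nat) set \<Rightarrow> 'v \<Rightarrow> 'v set \<times> nat \<Rightarrow> 'v set \<times> nat \<Rightarrow> real" where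
  "nkv U A v x y = (if x = y \<and> v \<in> fst x then wt A x * G U v else 0) + offdiag A v x y"

definition nk :: "'v set set \<Rightarrow> ('v set \<Rightarrow> nat) set \<Rightarrow> 'v set \<times> nat \<Rightarrow> 'v set \<times> nat \<Rightarrow> real" where
  "nk U A x y = (\<Sum>v\<in>\<Union>E. nkv U A v x y)"

lemma finite_vertices: "finite (\<Union>E)"
  using finite_E finite_edge by auto

lemma nkv_sym: "nkv U A v x y = nkv U A v y x"
  by (auto simp: nkv_def offdiag_def mult.commute)

lemma nkv_eq_0: "v \<notin> fst x \<or> v \<notin> fst y \<Longrightarrow> nkv U A v x y = 0"
  by (auto simp: nkv_def offdiag_def)

lemma quad_offdiag:
  assumes U: "U \<subseteq> E"
  shows "quad (pts U (ext U \<rho>)) (offdiag (ext U \<rho>) v) \<phi> = - (\<Sum>s\<in>ext U \<rho>. pairform (inc U v) \<phi> s)"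
proof -
  let ?A = "ext U \<rho>" and ?C = palette
  let ?I = "inc U v" and ?T = "\<lambda>e f c s. (\<phi> (e, c) * h e c s) * (\<phi> (f, c) * h f c s)"
  have finU: "finite U" using finite_sub[OF U] .
  have finI: "finite ?I" using finite_inc[OF U] .
  \<comment> \<open>The kernel only sees attained pairs, whereas \<open>pairform\<close> runs over
    the whole palette. For a pair that is never attained the average of \<open>h\<close> is 0, and
    being nonnegative \<open>h\<close> vanishes at every coloring.\<close>
  have h0: "h (fst x) (snd x) s = 0" if x: "x \<in> U \<times> ?C" "x \<notin> pts U ?A" and s: "s \<in> ?A" for x s
  proof -
    have "fib ?A x = {}" using x by (force simp: fib_def pts_def)
    then have "(\<Sum>s\<in>?A. h (fst x) (snd x) s) = 0"
      using sum_h_eq_wt[OF U, where e = "fst x" and c = "snd x" and \<rho> = \<rho>] x by (auto simp: wt_def)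
    then show ?thesis using s h_nonneg by (subst (asm) sum_nonneg_eq_0_iff) auto
  qed
  have "quad (pts U ?A) (offdiag ?A v) \<phi> = quad (U \<times> ?C) (offdiag ?A v) \<phi>"
  proof (rule quad_neutral)
    show "finite (U \<times> ?C)" using finU by simp
    show "pts U ?A \<subseteq> U \<times> ?C" by (rule pts_subset[OF U])
    fix x y assume "x \<in> U \<times> ?C" "y \<in> U \<times> ?C" "x \<notin> pts U ?A \<or> y \<notin> pts U ?A"
    then show "offdiag ?A v x y = 0" using h0 by (auto simp: offdiag_def intro!: sum.neutral)
  qed
  also have "\<dots> = (\<Sum>e\<in>U. \<Sum>c\<in>?C. \<Sum>f\<in>U. \<Sum>c'\<in>?C. offdiag ?A v (e, c) (f, c') * \<phi> (e, c) * \<phi> (f, c'))"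
    unfolding quad_def by (simp add: sum.cartesian_product')
  also have "\<dots> = (\<Sum>e\<in>U. \<Sum>c\<in>?C. \<Sum>f\<in>U. if v \<in> e \<and> v \<in> f \<and> e \<noteq> f then
      - (\<Sum>s\<in>?A. ?T e f c s) else 0)"
  proof (intro sum.cong refl)
    fix e c f assume c: "c \<in> ?C"
    have "(\<Sum>c'\<in>?C. offdiag ?A v (e, c) (f, c') * \<phi> (e, c) * \<phi> (f, c')) =
       (\<Sum>c'\<in>?C. if c = c' then offdiag ?A v (e, c) (f, c) * \<phi> (e, c) * \<phi> (f, c) else 0)"
      by (intro sum.cong refl) (auto simp: offdiag_def)
    also have "\<dots> = offdiag ?A v (e, c) (f, c) * \<phi> (e, c) * \<phi> (f, c)" using c by simp
    also have "\<dots> = (if v \<in> e \<and> v \<in> f \<and> e \<noteq> f then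
      - (\<Sum>s\<in>?A. ?T e f c s) else 0)"
      by (auto simp: offdiag_def sum_distrib_left sum_distrib_right mult_ac)
    finally show "(\<Sum>c'\<in>?C. offdiag ?A v (e, c) (f, c') * \<phi> (e, c) * \<phi> (f, c')) = \<dots>" .
  qed
  also have "\<dots> = (\<Sum>e\<in>U. if v \<in> e then \<Sum>f\<in>U. if v \<in> f \<and> e \<noteq> f then
      - (\<Sum>c\<in>?C. \<Sum>s\<in>?A. ?T e f c s) else 0 else 0)"
  proof (intro sum.cong refl)
    fix e
    show "(\<Sum>c\<in>?C. \<Sum>f\<in>U. if v \<in> e \<and> v \<in> f \<and> e \<noteq> f then
        - (\<Sum>s\<in>?A. ?T e f c s) else 0) =
      (if v \<in> e then \<Sum>f\<in>U. if v \<in> f \<and> e \<noteq> f then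
        - (\<Sum>c\<in>?C. \<Sum>s\<in>?A. ?T e f c s) else 0 else 0)"
      by (subst sum.swap) (auto simp: sum_negf intro!: sum.cong)
  qed
  also have "\<dots> = (\<Sum>e\<in>?I. \<Sum>f\<in>?I - {e}.
      - (\<Sum>c\<in>?C. \<Sum>s\<in>?A. ?T e f c s))"
  proof -
    have "{f \<in> U. v \<in> f \<and> e \<noteq> f} = ?I - {e}" for e by (auto simp: inc_def)
    then show ?thesis using finU by (simp add: sum.inter_filter[symmetric] inc_def)
  qed
  also have "\<dots> = (\<Sum>e\<in>?I. \<Sum>f\<in>?I - {e}.
      - (\<Sum>s\<in>?A. \<Sum>c\<in>?C. ?T e f c s))"
    by (intro sum.cong refl arg_cong[of _ _ uminus] sum.swap)
  also have "\<dots> = - (\<Sum>s\<in>?A. pairform ?I \<phi> s)"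
    unfolding pairform_def sum_negf
    by (subst (2) sum.swap, subst sum.swap) (simp add: sum_negf)
  finally show ?thesis .
qed

lemma quad_nkv:
  assumes U: "U \<subseteq> E"
  shows "quad (pts U (ext U \<rho>)) (nkv U (ext U \<rho>) v) \<phi> = (\<Sum>s\<in>ext U \<rho>. vform U v \<phi> s)"
proof -
  let ?A = "ext U \<rho>"
  have finU: "finite U" using finite_sub[OF U] .
  let ?D = "\<lambda>x y. if x = y \<and> v \<in> fst x then wt ?A x * G U v else 0"
  have "quad (pts U ?A) (nkv U ?A v) \<phi> = quad (pts U ?A) ?D \<phi> + quad (pts U ?A) (offdiag ?A v) \<phi>"
    by (simp add: quad_def nkv_def distrib_right sum.distrib)
  also have "quad (pts U ?A) ?D \<phi> = (\<Sum>x\<in>pts U ?A. wt ?A x * (if v \<in> fst x then G U v * (\<phi> x)\<^sup>2 else 0))"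
    unfolding quad_def
  proof (intro sum.cong refl)
    fix x assume x: "x \<in> pts U ?A"
    have "(\<Sum>y\<in>pts U ?A. ?D x y * \<phi> x * \<phi> y) =
        (\<Sum>y\<in>pts U ?A. if x = y then wt ?A x * (if v \<in> fst x then G U v * (\<phi> x)\<^sup>2 else 0) else 0)"
      by (intro sum.cong refl) (auto simp: power2_eq_square)
    then show "(\<Sum>y\<in>pts U ?A. ?D x y * \<phi> x * \<phi> y) = wt ?A x * (if v \<in> fst x then G U v * (\<phi> x)\<^sup>2 else 0)"
      using x finU by simp
  qed
  also have "\<dots> = (\<Sum>s\<in>?A. \<Sum>e\<in>U. if v \<in> e then G U v * (\<phi> (e, s e))\<^sup>2 else 0)"
    using finU by (subst sum_pts_wt) auto
  also have "\<dots> = (\<Sum>s\<in>?A. G U v * sqs (inc U v) \<phi> s)"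
    using finU by (simp add: sqs_def inc_def sum.inter_filter sum_distrib_left if_distrib cong: if_cong)
  finally show ?thesis by (simp add: quad_offdiag[OF U] vform_def sum_subtractf)
qed

lemma quad_nk:
  assumes U: "U \<subseteq> E"
  shows "quad (pts U (ext U \<rho>)) (nk U (ext U \<rho>)) \<phi> = sum (nform U \<phi>) (ext U \<rho>)"
proof -
  let ?A = "ext U \<rho>"
  have "quad (pts U ?A) (nk U ?A) \<phi> =
     (\<Sum>x\<in>pts U ?A. \<Sum>y\<in>pts U ?A. \<Sum>v\<in>\<Union>E. nkv U ?A v x y * \<phi> x * \<phi> y)"
    by (simp add: quad_def nk_def sum_distrib_right)
  also have "\<dots> = (\<Sum>x\<in>pts U ?A. \<Sum>v\<in>\<Union>E. \<Sum>y\<in>pts U ?A. nkv U ?A v x y * \<phi> x * \<phi> y)"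
    by (intro sum.cong refl sum.swap)
  also have "\<dots> = (\<Sum>v\<in>\<Union>E. quad (pts U ?A) (nkv U ?A v) \<phi>)"
    unfolding quad_def by (rule sum.swap)
  also have "\<dots> = (\<Sum>v\<in>\<Union>E. \<Sum>s\<in>?A. vform U v \<phi> s)"
    by (simp add: quad_nkv[OF U])
  also have "\<dots> = sum (nform U \<phi>) ?A"
    unfolding nform_def by (rule sum.swap)
  finally show ?thesis .
qed

text \<open>For a fixed color the sum over distinct edges is a square minus its diagonal; dropping
  the square leaves a diagonal controlled by \<open>h \<le> t\<close>. The upper bound is a Schur
  test: products are split into squares, one factor \<open>h\<close> is replaced by
  \<open>t\<close>, and every edge has \<open>d - 1\<close> partners.\<close>

lemma pairform_bounds:
  assumes U: "U \<subseteq> E"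
  defines "H \<equiv> \<lambda>v \<phi> s. \<Sum>e\<in>inc U v. \<Sum>c\<in>palette. (\<phi> (e, c))\<^sup>2 * h e c s"
  shows "- pairform (inc U v) \<phi> s \<le> t * H v \<phi> s"
    "pairform (inc U v) \<phi> s \<le> t * (real (degree_of U v) - 1) * H v \<phi> s"
proof -
  let ?I = "inc U v"
  have finI: "finite ?I" using finite_inc[OF U] .
  have IE: "e \<in> E" if "e \<in> ?I" for e using that U by (auto simp: inc_def)
  have "pairform ?I \<phi> s = (\<Sum>c\<in>palette. \<Sum>e\<in>?I. \<Sum>f\<in>?I - {e}. (\<phi> (e, c) * h e c s) * (\<phi> (f, c) * h f c s))"
  proof -
    have "pairform ?I \<phi> s = (\<Sum>e\<in>?I. \<Sum>c\<in>palette. \<Sum>f\<in>?I - {e}. (\<phi> (e, c) * h e c s) * (\<phi> (f, c) * h f c s))"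
      unfolding pairform_def by (intro sum.cong refl sum.swap)
    then show ?thesis by (simp only: sum.swap[of _ palette])
  qed
  then have eq: "pairform ?I \<phi> s =
      (\<Sum>c\<in>palette. (\<Sum>e\<in>?I. \<phi> (e, c) * h e c s)\<^sup>2 - (\<Sum>e\<in>?I. (\<phi> (e, c) * h e c s)\<^sup>2))"
    using sum_off_diagonal_product[OF finI] by simp
  have "- pairform ?I \<phi> s \<le> (\<Sum>c\<in>palette. \<Sum>e\<in>?I. (\<phi> (e, c) * h e c s)\<^sup>2)"
    unfolding eq sum_negf[symmetric] by (intro sum_mono) simp
  also have "\<dots> \<le> (\<Sum>c\<in>palette. \<Sum>e\<in>?I. t * ((\<phi> (e, c))\<^sup>2 * h e c s))"
  proof (intro sum_mono)
    fix c e assume e: "e \<in> ?I"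
    have "(\<phi> (e, c))\<^sup>2 * h e c s * h e c s \<le> (\<phi> (e, c))\<^sup>2 * h e c s * t"
      using h_le[OF IE[OF e]] h_nonneg by (intro mult_left_mono) auto
    then show "(\<phi> (e, c) * h e c s)\<^sup>2 \<le> t * ((\<phi> (e, c))\<^sup>2 * h e c s)"
      by (simp add: power_mult_distrib power2_eq_square mult_ac)
  qed
  also have "\<dots> = t * H v \<phi> s"
    unfolding H_def by (subst sum.swap) (simp add: sum_distrib_left)
  finally show "- pairform ?I \<phi> s \<le> t * H v \<phi> s" .
  let ?b = "\<lambda>e f. \<Sum>c\<in>palette. ((\<phi> (e, c))\<^sup>2 * h e c s) * h f c s"
  have "pairform ?I \<phi> s \<le> (\<Sum>e\<in>?I. \<Sum>f\<in>?I - {e}. (?b e f + ?b f e) / 2)"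
    unfolding pairform_def
  proof (intro sum_mono)
    fix e f
    have "(\<phi> (e, c) * h e c s) * (\<phi> (f, c) * h f c s) \<le>
      (((\<phi> (e, c))\<^sup>2 * h e c s) * h f c s + ((\<phi> (f, c))\<^sup>2 * h f c s) * h e c s) / 2" for c
    proof -
      have "0 \<le> (\<phi> (e, c) - \<phi> (f, c))\<^sup>2 * (h e c s * h f c s)"
        using h_nonneg by (intro mult_nonneg_nonneg) auto
      then show ?thesis by (simp add: power2_eq_square algebra_simps)
    qed
    then show "(\<Sum>c\<in>palette. (\<phi> (e, c) * h e c s) * (\<phi> (f, c) * h f c s)) \<le> (?b e f + ?b f e) / 2"
      unfolding sum.distrib[symmetric] sum_divide_distrib by (intro sum_mono)
  qed
  also have "\<dots> = ((\<Sum>e\<in>?I. \<Sum>f\<in>?I - {e}. ?b e f) + (\<Sum>e\<in>?I. \<Sum>f\<in>?I - {e}. ?b f e)) / 2"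
    unfolding sum.distrib[symmetric] sum_divide_distrib ..
  also have "(\<Sum>e\<in>?I. \<Sum>f\<in>?I - {e}. ?b f e) = (\<Sum>e\<in>?I. \<Sum>f\<in>?I - {e}. ?b e f)"
    using sum_swap_off_diagonal[OF finI finI, of "\<lambda>e f. ?b f e"] .
  also have "((\<Sum>e\<in>?I. \<Sum>f\<in>?I - {e}. ?b e f) + (\<Sum>e\<in>?I. \<Sum>f\<in>?I - {e}. ?b e f)) / 2 =
      (\<Sum>e\<in>?I. \<Sum>f\<in>?I - {e}. ?b e f)" by simp
  also have "\<dots> \<le> (\<Sum>e\<in>?I. \<Sum>f\<in>?I - {e}. \<Sum>c\<in>palette. ((\<phi> (e, c))\<^sup>2 * h e c s) * t)"
    using h_le IE h_nonneg by (intro sum_mono mult_left_mono) auto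
  also have "\<dots> = (\<Sum>e\<in>?I. t * (real (degree_of U v) - 1) * (\<Sum>c\<in>palette. (\<phi> (e, c))\<^sup>2 * h e c s))"
  proof (intro sum.cong refl)
    fix e assume e: "e \<in> ?I"
    have "real (card (?I - {e})) = real (degree_of U v) - 1"
      using card_Suc_Diff1[OF finI e] by (simp add: degree_of_inc)
    then show "(\<Sum>f\<in>?I - {e}. \<Sum>c\<in>palette. ((\<phi> (e, c))\<^sup>2 * h e c s) * t) =
      t * (real (degree_of U v) - 1) * (\<Sum>c\<in>palette. (\<phi> (e, c))\<^sup>2 * h e c s)"
      by (simp add: sum_distrib_left mult_ac)
  qed
  finally show "pairform ?I \<phi> s \<le> t * (real (degree_of U v) - 1) * H v \<phi> s"
    by (simp add: H_def sum_distrib_left)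
qed

lemma vform_degree_le_1:
  assumes U: "U \<subseteq> E" and d: "degree_of U v \<le> 1"
  shows "vform U v \<phi> s = 0"
proof -
  have E0: "inc U v - {e} = {}" if "e \<in> inc U v" for e
    using d that card_le_Suc0_iff_eq[OF finite_inc[OF U]] by (auto simp: degree_of_inc)
  have "pairform (inc U v) \<phi> s = 0"
    unfolding pairform_def by (rule sum.neutral, rule ballI) (simp only: E0 sum.empty)
  then show ?thesis using d by (simp add: vform_def G_def)
qed

lemma vform_bound:
  assumes U: "U \<subseteq> E"
  shows "\<bar>\<Sum>s\<in>ext U \<rho>. vform U v \<phi> s\<bar> \<le> bnd U v * sum (sqs (inc U v) \<phi>) (ext U \<rho>)"
proof (cases "degree_of U v \<le> 1")
  case True
  then show ?thesis by (simp add: vform_degree_le_1[OF U] bnd_def)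
next
  case False
  let ?S = "\<Sum>s\<in>ext U \<rho>. sqs (inc U v) \<phi> s"
  let ?H = "\<lambda>s. \<Sum>e\<in>inc U v. \<Sum>c\<in>palette. (\<phi> (e, c))\<^sup>2 * h e c s"
  let ?p = "\<Sum>s\<in>ext U \<rho>. pairform (inc U v) \<phi> s"
  have HS: "(\<Sum>s\<in>ext U \<rho>. ?H s) = ?S"
    using sum_h_weighted[OF U inc_subset[of U v], where \<rho> = \<rho> and g = "\<lambda>x. (\<phi> x)\<^sup>2"] by (simp add: sqs_def)
  have "- ?p \<le> (\<Sum>s\<in>ext U \<rho>. t * ?H s)"
    unfolding sum_negf[symmetric] by (intro sum_mono pairform_bounds(1)[OF U])
  then have p1: "- ?p \<le> t * ?S" by (simp add: sum_distrib_left[symmetric] HS)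
  have "?p \<le> (\<Sum>s\<in>ext U \<rho>. t * (real (degree_of U v) - 1) * ?H s)"
    by (intro sum_mono pairform_bounds(2)[OF U])
  then have p2: "?p \<le> t * (real (degree_of U v) - 1) * ?S" by (simp add: sum_distrib_left[symmetric] HS)
  have S0: "?S \<ge> 0" by (intro sum_nonneg sqs_nonneg)
  have v: "(\<Sum>s\<in>ext U \<rho>. vform U v \<phi> s) = G U v * ?S - ?p"
    by (simp add: vform_def sum_subtractf sum_distrib_left)
  have b: "bnd U v = G U v + t" using False by (simp add: bnd_def)
  \<comment> \<open>This is where the lower bound on \<open>G\<close> enters: the excess of
    \<open>R v\<close> over the diagonal is again at most \<open>G U v + t\<close>.\<close>
  have "t * (real (degree_of U v) - 1) \<le> G U v + G U v + t"
    using G_bounds(1)[OF U, of v] False t_pos by linarith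
  then have "t * (real (degree_of U v) - 1) * ?S \<le> (G U v + G U v + t) * ?S"
    using S0 by (rule mult_right_mono)
  then have "?p - G U v * ?S \<le> bnd U v * ?S" using p2 by (simp add: b distrib_right)
  moreover have "G U v * ?S - ?p \<le> bnd U v * ?S" using p1 by (simp add: b distrib_right)
  ultimately show ?thesis unfolding v by (simp add: abs_le_iff)
qed

lemma sum_vertices_inc:
  assumes U: "U \<subseteq> E"
  shows "(\<Sum>v\<in>\<Union>E. b v * (\<Sum>e\<in>inc U v. F e)) = (\<Sum>e\<in>U. F e * (\<Sum>v\<in>e. b v :: real))"
proof -
  have finU: "finite U" using finite_sub[OF U] .
  have "(\<Sum>v\<in>\<Union>E. b v * (\<Sum>e\<in>inc U v. F e)) = (\<Sum>v\<in>\<Union>E. \<Sum>e\<in>U. if v \<in> e then b v * F e else 0)"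
    using finU by (simp add: inc_def sum.inter_filter sum_distrib_left if_distrib cong: if_cong)
  also have "\<dots> = (\<Sum>e\<in>U. \<Sum>v\<in>\<Union>E. if v \<in> e then b v * F e else 0)" by (rule sum.swap)
  also have "\<dots> = (\<Sum>e\<in>U. F e * (\<Sum>v\<in>e. b v))"
  proof (intro sum.cong refl)
    fix e assume "e \<in> U"
    then have "{v \<in> \<Union>E. v \<in> e} = e" using U by auto
    then show "(\<Sum>v\<in>\<Union>E. if v \<in> e then b v * F e else 0) = F e * (\<Sum>v\<in>e. b v)"
      using finite_vertices by (simp add: sum.inter_filter[symmetric] sum_distrib_left mult.commute)
  qed
  finally show ?thesis .
qed

lemma sum_nform_le:
  assumes U: "U \<subseteq> E" and r: "\<And>e. e \<in> U \<Longrightarrow> (\<Sum>v\<in>e. bnd U v) \<le> r"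
  shows "sum (nform U \<phi>) (ext U \<rho>) \<le> r * sum (sqs U \<phi>) (ext U \<rho>)"
proof -
  let ?A = "ext U \<rho>"
  have "sum (nform U \<phi>) ?A = (\<Sum>v\<in>\<Union>E. \<Sum>s\<in>?A. vform U v \<phi> s)"
    unfolding nform_def by (rule sum.swap)
  also have "\<dots> \<le> (\<Sum>v\<in>\<Union>E. bnd U v * sum (sqs (inc U v) \<phi>) ?A)"
    using vform_bound[OF U] by (intro sum_mono) (meson abs_le_iff)
  also have "\<dots> = (\<Sum>s\<in>?A. \<Sum>v\<in>\<Union>E. bnd U v * sqs (inc U v) \<phi> s)"
    unfolding sum_distrib_left by (rule sum.swap)
  also have "\<dots> = (\<Sum>s\<in>?A. \<Sum>e\<in>U. (\<phi> (e, s e))\<^sup>2 * (\<Sum>v\<in>e. bnd U v))"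
    unfolding sqs_def by (intro sum.cong refl sum_vertices_inc[OF U])
  also have "\<dots> \<le> (\<Sum>s\<in>?A. \<Sum>e\<in>U. (\<phi> (e, s e))\<^sup>2 * r)"
    using r by (intro sum_mono mult_left_mono) auto
  also have "\<dots> = r * sum (sqs U \<phi>) ?A"
    by (simp add: sqs_def sum_distrib_left mult.commute)
  finally show ?thesis .
qed

text \<open>A row at \<open>x\<close> only involves the two endpoints of \<open>fst x\<close>, so
  Cauchy-Schwarz costs a factor 2. Each vertex operator is supported on the pairs at its vertex;
  applying the norm bound there produces \<open>sqs (inc U v)\<close> instead of the full
  \<open>sqs U\<close>.\<close>

lemma sum_nk_row_square_le:
  assumes U: "U \<subseteq> E" and \<rho>: "\<rho> \<in> colorings"
  defines "A \<equiv> ext U \<rho>"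
  shows "(\<Sum>x\<in>pts U A. (\<Sum>y\<in>pts U A. nk U A x y * \<phi> y)\<^sup>2 / wt A x) \<le>
    (\<Sum>s\<in>A. \<Sum>v\<in>\<Union>E. 2 * (bnd U v)\<^sup>2 * sqs (inc U v) \<phi> s)"
proof -
  let ?X = "pts U A"
  have finU: "finite U" using finite_sub[OF U] .
  have finA: "finite A" by (simp add: A_def)
  have finX: "finite ?X" using finA finU by simp
  define R where "R = (\<lambda>v x. \<Sum>y\<in>?X. nkv U A v x y * \<phi> y)"
  have wpos: "wt A x > 0" if "x \<in> ?X" for x using wt_pos[OF finA that] .
  have xE: "fst x \<in> E" if "x \<in> ?X" for x using that U by (auto simp: pts_def)
  have row: "(\<Sum>y\<in>?X. nk U A x y * \<phi> y) = (\<Sum>v\<in>fst x. R v x)" if x: "x \<in> ?X" for x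
  proof -
    have "(\<Sum>y\<in>?X. nk U A x y * \<phi> y) = (\<Sum>v\<in>\<Union>E. R v x)"
      unfolding nk_def R_def sum_distrib_right by (rule sum.swap)
    also have "\<dots> = (\<Sum>v\<in>fst x. R v x)"
      using xE[OF x] finite_vertices
      by (intro sum.mono_neutral_right) (auto simp: R_def nkv_eq_0)
    finally show ?thesis .
  qed
  have "(\<Sum>x\<in>?X. (\<Sum>y\<in>?X. nk U A x y * \<phi> y)\<^sup>2 / wt A x) \<le>
      (\<Sum>x\<in>?X. 2 * (\<Sum>v\<in>\<Union>E. if v \<in> fst x then (R v x)\<^sup>2 / wt A x else 0))"
  proof (intro sum_mono)
    fix x assume x: "x \<in> ?X"
    have "(\<Sum>v\<in>fst x. R v x)\<^sup>2 \<le> (\<Sum>v\<in>fst x. (R v x)\<^sup>2) * real (card (fst x))"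
      using sum_squared_le_sum_of_squares by blast
    also have "\<dots> = 2 * (\<Sum>v\<in>fst x. (R v x)\<^sup>2)" using card_edge[OF xE[OF x]] by simp
    finally have "(\<Sum>y\<in>?X. nk U A x y * \<phi> y)\<^sup>2 / wt A x \<le> 2 * (\<Sum>v\<in>fst x. (R v x)\<^sup>2 / wt A x)"
      unfolding row[OF x] sum_divide_distrib[symmetric] using wpos[OF x] by (simp add: field_simps)
    moreover have "{v \<in> \<Union>E. v \<in> fst x} = fst x" using xE[OF x] by auto
    ultimately show "(\<Sum>y\<in>?X. nk U A x y * \<phi> y)\<^sup>2 / wt A x \<le>
        2 * (\<Sum>v\<in>\<Union>E. if v \<in> fst x then (R v x)\<^sup>2 / wt A x else 0)"
      using finite_vertices by (simp add: sum.inter_filter[symmetric])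
  qed
  also have "\<dots> = (\<Sum>v\<in>\<Union>E. 2 * (\<Sum>x\<in>?X. if v \<in> fst x then (R v x)\<^sup>2 / wt A x else 0))"
    unfolding sum_distrib_left by (rule sum.swap)
  also have "\<dots> \<le> (\<Sum>v\<in>\<Union>E. 2 * ((bnd U v)\<^sup>2 * sum (sqs (inc U v) \<phi>) A))"
  proof (intro sum_mono mult_left_mono)
    fix v
    let ?Y = "pts (inc U v) A"
    have Y: "{x \<in> ?X. v \<in> fst x} = ?Y" by (auto simp: pts_def inc_def)
    have YX: "?Y \<subseteq> ?X" using Y by blast
    have b0: "bnd U v \<ge> 0"
    proof (cases "degree_of U v \<ge> 1")
      case True then show ?thesis by (rule bnd_bounds(1)[OF U])
    qed (simp add: bnd_def)
    have "(\<Sum>x\<in>?X. if v \<in> fst x then (R v x)\<^sup>2 / wt A x else 0) = (\<Sum>x\<in>?Y. (R v x)\<^sup>2 / wt A x)"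
      using finX by (simp add: sum.inter_filter[symmetric] Y)
    also have "\<dots> = (\<Sum>x\<in>?Y. (\<Sum>y\<in>?Y. nkv U A v x y * \<phi> y)\<^sup>2 / wt A x)"
    proof -
      have "R v x = (\<Sum>y\<in>?Y. nkv U A v x y * \<phi> y)" for x
        unfolding R_def
      proof (rule sum.mono_neutral_right[OF finX YX], rule ballI)
        fix y assume "y \<in> ?X - ?Y"
        then have "v \<notin> fst y" using Y by blast
        then show "nkv U A v x y * \<phi> y = 0" by (simp add: nkv_eq_0)
      qed
      then show ?thesis by simp
    qed
    also have "\<dots> \<le> (bnd U v)\<^sup>2 * (\<Sum>x\<in>?Y. wt A x * (\<phi> x)\<^sup>2)"
    proof (rule operator_norm_le_of_form)
      fix \<psi>
      have "quad ?Y (nkv U A v) \<psi> = quad ?X (nkv U A v) \<psi>"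
        using Y by (intro quad_neutral[OF finX YX]) (auto intro!: nkv_eq_0)
      then show "\<bar>quad ?Y (nkv U A v) \<psi>\<bar> \<le> bnd U v * (\<Sum>x\<in>?Y. wt A x * (\<psi> x)\<^sup>2)"
        using vform_bound[OF U, of v \<psi> \<rho>] quad_nkv[OF U, of \<rho> v \<psi>]
          sum_sqs_eq[OF finA finite_inc[OF U], of v \<psi>] by (simp add: A_def)
    qed (use wpos YX nkv_sym b0 in auto)
    also have "(\<Sum>x\<in>?Y. wt A x * (\<phi> x)\<^sup>2) = sum (sqs (inc U v) \<phi>) A"
      using sum_sqs_eq[OF finA finite_inc[OF U]] by simp
    finally show "(\<Sum>x\<in>?X. if v \<in> fst x then (R v x)\<^sup>2 / wt A x else 0) \<le>
        (bnd U v)\<^sup>2 * sum (sqs (inc U v) \<phi>) A" .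
  qed simp
  also have "\<dots> = (\<Sum>v\<in>\<Union>E. \<Sum>s\<in>A. 2 * (bnd U v)\<^sup>2 * sqs (inc U v) \<phi> s)"
    by (simp add: sum_distrib_left mult.assoc)
  also have "\<dots> = (\<Sum>s\<in>A. \<Sum>v\<in>\<Union>E. 2 * (bnd U v)\<^sup>2 * sqs (inc U v) \<phi> s)"
    by (rule sum.swap)
  finally show ?thesis .
qed

lemma sum_nform_remove_le:
  assumes U: "U \<subseteq> E" and second: "\<And>v. degree_of U v = 2 \<Longrightarrow> second U v \<noteq> {}"
  shows "(\<Sum>g\<in>U. nform (U - {g}) \<phi> s) \<le>
    (real (card U) - 2) * nform U \<phi> s - (\<Sum>v\<in>\<Union>E. 2 * (bnd U v)\<^sup>2 * sqs (inc U v) \<phi> s)"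
proof -
  have finU: "finite U" using finite_sub[OF U] .
  have "(\<Sum>g\<in>U. nform (U - {g}) \<phi> s) = (\<Sum>v\<in>\<Union>E. \<Sum>g\<in>U. vform (U - {g}) v \<phi> s)"
    unfolding nform_def by (rule sum.swap)
  also have "\<dots> \<le> (\<Sum>v\<in>\<Union>E. (real (card U) - 2) * vform U v \<phi> s - 2 * (bnd U v)\<^sup>2 * sqs (inc U v) \<phi> s)"
  proof (intro sum_mono)
    fix v
    let ?I = "inc U v"
    have finI: "finite ?I" using finite_inc[OF U] .
    have "(\<Sum>g\<in>U. pairform (?I - {g}) \<phi> s) = (real (card U) - 2) * pairform ?I \<phi> s"
      unfolding pairform_def by (rule sum_remove_pairs[OF finU inc_subset])
    moreover have "(\<Sum>g\<in>U. G (U - {g}) v * sqs (?I - {g}) \<phi> s) \<le>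
        (real (card U) - 2) * (G U v * sqs ?I \<phi> s) - 2 * (bnd U v)\<^sup>2 * sqs ?I \<phi> s"
    proof -
      have "(\<Sum>g\<in>U. G (U - {g}) v * sqs (?I - {g}) \<phi> s) =
          (\<Sum>g\<in>U. \<Sum>e\<in>?I - {g}. G (U - {g}) v * (\<phi> (e, s e))\<^sup>2)"
        by (simp add: sqs_def sum_distrib_left)
      also have "\<dots> = (\<Sum>e\<in>?I. \<Sum>g\<in>U - {e}. G (U - {g}) v * (\<phi> (e, s e))\<^sup>2)"
        by (rule sum_swap_off_diagonal[OF finU finI])
      also have "\<dots> = (\<Sum>e\<in>?I. (\<Sum>g\<in>U - {e}. G (U - {g}) v) * (\<phi> (e, s e))\<^sup>2)"
        by (simp add: sum_distrib_right)
      also have "\<dots> \<le> (\<Sum>e\<in>?I. ((real (card U) - 2) * G U v - 2 * (bnd U v)\<^sup>2) * (\<phi> (e, s e))\<^sup>2)"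
        by (intro sum_mono mult_right_mono G_recursion[OF U] second) (auto simp: inc_def)
      also have "\<dots> = (real (card U) - 2) * (G U v * sqs ?I \<phi> s) - 2 * (bnd U v)\<^sup>2 * sqs ?I \<phi> s"
        by (simp add: sqs_def sum_subtractf sum_distrib_left left_diff_distrib mult.assoc)
      finally show ?thesis .
    qed
    ultimately show "(\<Sum>g\<in>U. vform (U - {g}) v \<phi> s) \<le>
        (real (card U) - 2) * vform U v \<phi> s - 2 * (bnd U v)\<^sup>2 * sqs ?I \<phi> s"
      by (simp add: vform_def inc_remove sum_subtractf right_diff_distrib)
  qed
  also have "\<dots> = (real (card U) - 2) * nform U \<phi> s - (\<Sum>v\<in>\<Union>E. 2 * (bnd U v)\<^sup>2 * sqs (inc U v) \<phi> s)"
    by (simp add: nform_def sum_subtractf sum_distrib_left)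
  finally show ?thesis .
qed

text \<open>The induction statement \<open>K \<le> 1 + T\<close>, for all boundary colorings at once
  because pinning changes the boundary.\<close>

definition good :: "'v set set \<Rightarrow> bool" where
  "good U \<longleftrightarrow> (\<forall>\<rho>\<in>colorings. \<forall>\<phi>. vsum (ext U \<rho>) (ssum U \<phi>) \<le>
     sum (sqs U \<phi>) (ext U \<rho>) + sum (nform U \<phi>) (ext U \<rho>))"

lemma good_step:
  assumes U: "U \<subseteq> E" and k3: "card U \<ge> 3"
    and second: "\<And>v. degree_of U v = 2 \<Longrightarrow> second U v \<noteq> {}"
    and IH: "\<And>g. g \<in> U \<Longrightarrow> good (U - {g})"
  shows "good U"
  unfolding good_def
proof (intro ballI allI)
  fix \<rho> \<phi> assume \<rho>: "\<rho> \<in> colorings"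
  let ?A = "ext U \<rho>"
  have finU: "finite U" using finite_sub[OF U] .
  have "\<rho> \<in> ?A" using \<rho> by (simp add: ext_def)
  then have Ane: "?A \<noteq> {}" by blast
  \<comment> \<open>The form of \<open>T\<close> for the instance pinned at \<open>x\<close>; its
    sum over all \<open>x\<close> is the form of \<open>T'\<close>.\<close>
  define q where "q = (\<lambda>x \<phi>. \<Sum>s\<in>fib ?A x. nform (U - {fst x}) \<phi> s)"
  have "vsum ?A (ssum U \<phi>) \<le> sum (sqs U \<phi>) ?A + quad (pts U ?A) (nk U ?A) \<phi>"
  proof (rule matrix_trickle_down[OF finite_ext Ane finU k3, where q = q])
    show "nk U ?A x y = nk U ?A y x" for x y
      unfolding nk_def by (intro sum.cong refl nkv_sym)
  next
    fix x \<phi> assume x: "x \<in> pts U ?A"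
    obtain s where s: "s \<in> colorings" "fib ?A x = ext (U - {fst x}) s"
      using fib_ext[OF x U] by blast
    have xU: "fst x \<in> U" using x by (auto simp: pts_def)
    show "vsum (fib ?A x) (ssum (U - {fst x}) \<phi>) \<le> sum (sqs (U - {fst x}) \<phi>) (fib ?A x) + q x \<phi>"
      using IH[OF xU] s unfolding good_def q_def by simp
    have U': "U - {fst x} \<subseteq> E" using U by auto
    have c: "real (card (U - {fst x})) - 1 = real (card U) - 2"
      using card_Suc_Diff1[OF finU xU] by linarith
    show "q x \<phi> \<le> (real (card U) - 2) / 100 * sum (sqs (U - {fst x}) \<phi>) (fib ?A x)"
      unfolding q_def s(2) c[symmetric] by (rule sum_nform_le[OF U' sum_bnd_le(1)[OF U']])
  next
    fix \<phi>
    have "(\<Sum>x\<in>pts U ?A. q x \<phi>) = (\<Sum>s\<in>?A. \<Sum>g\<in>U. nform (U - {g}) \<phi> s)"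
      using finU sum_pts[of ?A U ?A "\<lambda>s x. nform (U - {fst x}) \<phi> s"] by (simp add: q_def)
    also have "\<dots> \<le> (\<Sum>s\<in>?A. (real (card U) - 2) * nform U \<phi> s -
        (\<Sum>v\<in>\<Union>E. 2 * (bnd U v)\<^sup>2 * sqs (inc U v) \<phi> s))"
      by (intro sum_mono sum_nform_remove_le[OF U second])
    also have "\<dots> = (real (card U) - 2) * quad (pts U ?A) (nk U ?A) \<phi> -
        (\<Sum>s\<in>?A. \<Sum>v\<in>\<Union>E. 2 * (bnd U v)\<^sup>2 * sqs (inc U v) \<phi> s)"
      by (simp add: quad_nk[OF U] sum_subtractf sum_distrib_left)
    also have "\<dots> \<le> (real (card U) - 2) * quad (pts U ?A) (nk U ?A) \<phi> -
        (\<Sum>x\<in>pts U ?A. (\<Sum>y\<in>pts U ?A. nk U ?A x y * \<phi> y)\<^sup>2 / wt ?A x)"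
      using sum_nk_row_square_le[OF U \<rho>, of \<phi>] by simp
    finally show "(\<Sum>x\<in>pts U ?A. q x \<phi>) \<le> \<dots>" .
    show "quad (pts U ?A) (nk U ?A) \<phi> \<le> (real (card U) - 1) / 100 * sum (sqs U \<phi>) ?A"
      unfolding quad_nk[OF U] by (rule sum_nform_le[OF U sum_bnd_le(1)[OF U]])
  next
    fix \<psi> :: "'v set \<times> nat \<Rightarrow> real"
    assume eq: "\<forall>s\<in>?A. \<forall>e\<in>U. \<forall>f\<in>U. \<psi> (e, s e) = \<psi> (f, s f)"
    show "\<exists>b. \<forall>s\<in>?A. \<forall>e\<in>U. \<psi> (e, s e) = b"
      by (rule constant_of_single_site[OF U _ eq]) (use k3 in linarith)
  qed
  then show "vsum ?A (ssum U \<phi>) \<le> sum (sqs U \<phi>) ?A + sum (nform U \<phi>) ?A"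
    by (simp add: quad_nk[OF U])
qed

end

section \<open>Small components\<close>

lemma sum_neq_pairs:
  fixes F :: "'a \<Rightarrow> 'a \<Rightarrow> real"
  assumes "finite P" "finite R"
  shows "(\<Sum>(c, c')\<in>{(c, c') \<in> P \<times> R. c \<noteq> c'}. F c c') = (\<Sum>c\<in>P. \<Sum>c'\<in>R. F c c') - (\<Sum>c\<in>P \<inter> R. F c c)"
proof -
  let ?D = "{(c, c') \<in> P \<times> R. c \<noteq> c'}" and ?I = "(\<lambda>c. (c, c)) ` (P \<inter> R)"
  have fD: "finite ?D" using assms by (auto intro: finite_subset[of _ "P \<times> R"])
  have PR: "P \<times> R = ?D \<union> ?I" by auto
  have "(\<Sum>(c, c')\<in>P \<times> R. F c c') = (\<Sum>(c, c')\<in>?D. F c c') + (\<Sum>(c, c')\<in>?I. F c c')"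
    by (subst PR, rule sum.union_disjoint[OF fD]) (use assms in auto)
  also have "(\<Sum>(c, c')\<in>(\<lambda>c. (c, c)) ` (P \<inter> R). F c c') = (\<Sum>c\<in>P \<inter> R. F c c)"
    by (subst sum.reindex) (auto simp: inj_on_def)
  finally show ?thesis by (simp add: sum.cartesian_product)
qed

text \<open>\<open>D\<close> is the set of colorings of two adjacent edges and \<open>K\<close> the
  product of their update probabilities. Excluding equal colors contributes \<open>- 2 * W\<close>
  to the variance; this matches the \<open>K\<close> term, because each color has total
  \<open>K\<close> weight within \<open>3 * t\<close> of 1. The product of the sums and the squared
  mean cancel up to \<open>2 * t * (X2 + Y2)\<close>. The total error
  \<open>5 * t * (X2 + Y2)\<close> is at most \<open>(X2 + Y2) / 2\<close>, which
  \<open>t / 2 * Q\<close> absorbs because every color occurs in at least \<open>1 / t\<close>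
  colorings.\<close>

lemma pair_variance:
  fixes P R :: "'c set" and x y :: "'c \<Rightarrow> real"
  assumes fin: "finite P" "finite R" and t: "0 < t" "t \<le> 1 / 10"
    and P: "real (card P) \<ge> 1 / t + 1" and R: "real (card R) \<ge> 1 / t + 1"
  defines "D \<equiv> {(c, c') \<in> P \<times> R. c \<noteq> c'}"
  defines "K \<equiv> \<lambda>c (c1, c2). (if c \<noteq> c2 then 1 / real (card (P - {c2})) else 0) *
      (if c \<noteq> c1 then 1 / real (card (R - {c1})) else 0)"
  shows "vsum D (\<lambda>(c, c'). x c + y c') \<le> (\<Sum>(c, c')\<in>D. (1 + t / 2) * ((x c)\<^sup>2 + (y c')\<^sup>2)) -
    2 * (\<Sum>p\<in>D. \<Sum>c\<in>P \<inter> R. x c * y c * K c p)"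
proof -
  define a where "a = real (card P)"
  define b where "b = real (card R)"
  define r where "r = real (card (P \<inter> R))"
  have t10: "1 / t \<ge> 10" using t by (simp add: field_simps)
  have ab: "a \<ge> 11" "b \<ge> 11" "1 / t \<le> a - 1" "1 / t \<le> b - 1"
    using P R t10 unfolding a_def b_def by linarith+
  have finD: "finite D" unfolding D_def using fin by (auto intro: finite_subset[of _ "P \<times> R"])
  have ra: "r \<le> a" "r \<le> b"
    using fin by (auto simp: r_def a_def b_def intro!: card_mono)
  have sumD: "(\<Sum>(c, c')\<in>D. F c c') = (\<Sum>c\<in>P. \<Sum>c'\<in>R. F c c') - (\<Sum>c\<in>P \<inter> R. F c c)"
    for F :: "'c \<Rightarrow> 'c \<Rightarrow> real"
    unfolding D_def by (rule sum_neq_pairs[OF fin])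
  have Z: "real (card D) = a * b - r"
    using sumD[of "\<lambda>_ _. 1"] by (simp add: a_def b_def r_def)
  have "11 * b \<le> a * b" using ab by (intro mult_right_mono) auto
  then have Zpos: "real (card D) > 0" using Z ra ab by linarith
  then have Dne: "D \<noteq> {}" by auto
  define Sx where "Sx = sum x P"
  define Sy where "Sy = sum y R"
  define Ix where "Ix = sum x (P \<inter> R)"
  define Iy where "Iy = sum y (P \<inter> R)"
  define X2 where "X2 = (\<Sum>c\<in>P. (x c)\<^sup>2)"
  define Y2 where "Y2 = (\<Sum>c\<in>R. (y c)\<^sup>2)"
  define Q where "Q = (\<Sum>(c, c')\<in>D. (x c)\<^sup>2 + (y c')\<^sup>2)"
  define W where "W = (\<Sum>c\<in>P \<inter> R. x c * y c)"
  \<comment> \<open>\<open>p\<close> and \<open>q\<close> are the sums of \<open>x\<close> and of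
    \<open>y\<close> over \<open>D\<close>, so \<open>p + q\<close> is the total that enters the
    squared mean.\<close>
  define p where "p = b * Sx - Ix"
  define q where "q = a * Sy - Iy"
  define H where "H = (\<lambda>c. \<Sum>z\<in>D. K c z)"
  have I2: "(\<Sum>c\<in>P \<inter> R. (x c)\<^sup>2) \<le> X2" "(\<Sum>c\<in>P \<inter> R. (y c)\<^sup>2) \<le> Y2"
    using fin by (auto simp: X2_def Y2_def intro!: sum_mono2)
  have XY0: "X2 \<ge> 0" "Y2 \<ge> 0" by (auto simp: X2_def Y2_def intro: sum_nonneg)
  have s1: "(\<Sum>(c, c')\<in>D. x c + y c') = p + q"
    by (simp add: sumD sum.distrib p_def q_def Sx_def Sy_def Ix_def Iy_def a_def b_def sum_distrib_left)
  have s2: "(\<Sum>(c, c')\<in>D. x c * y c') = Sx * Sy - W"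
    by (simp add: sumD sum_product[symmetric] Sx_def Sy_def W_def)
  have s3: "Q = b * X2 + a * Y2 - ((\<Sum>c\<in>P \<inter> R. (x c)\<^sup>2) + (\<Sum>c\<in>P \<inter> R. (y c)\<^sup>2))"
    by (simp add: Q_def sumD sum.distrib X2_def Y2_def a_def b_def sum_distrib_left)
  have var: "vsum D (\<lambda>(c, c'). x c + y c') = Q + 2 * (Sx * Sy - W) - (p + q)\<^sup>2 / real (card D)"
  proof -
    have "(\<Sum>z\<in>D. ((\<lambda>(c, c'). x c + y c') z)\<^sup>2) = (\<Sum>(c, c')\<in>D. ((x c)\<^sup>2 + (y c')\<^sup>2) + 2 * (x c * y c'))"
      by (intro sum.cong refl) (auto simp: power2_sum)
    also have "\<dots> = Q + 2 * (\<Sum>(c, c')\<in>D. x c * y c')"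
      by (simp add: Q_def case_prod_unfold sum.distrib sum_distrib_left)
    finally show ?thesis
      unfolding vsum_eq[OF finD Dne] mean_def s1 s2 by (simp add: power2_eq_square)
  qed
  have i: "2 * (Sx * Sy) - (p + q)\<^sup>2 / real (card D) \<le> 2 * t * (X2 + Y2)"
  proof -
    have abpos: "a * b > 0" using ab by simp
    have "Sx * Sy * (a * b) = (p + Ix) * (q + Iy)" by (simp add: p_def q_def)
    then have SS: "Sx * Sy = (p + Ix) * (q + Iy) / (a * b)"
      by (subst eq_divide_eq) (use abpos in auto)
    have "(p + q)\<^sup>2 / (a * b) \<le> (p + q)\<^sup>2 / real (card D)"
      using Z Zpos abpos by (intro divide_left_mono) (auto simp: r_def)
    then have "2 * (Sx * Sy) - (p + q)\<^sup>2 / real (card D) \<le>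
        (2 * ((p + Ix) * (q + Iy)) - (p + q)\<^sup>2) / (a * b)"
      unfolding SS by (simp add: diff_divide_distrib)
    also have "\<dots> \<le> (Ix + Iy)\<^sup>2 / (a * b)"
    proof (intro divide_right_mono)
      have "(Ix + Iy)\<^sup>2 - (2 * ((p + Ix) * (q + Iy)) - (p + q)\<^sup>2) = (p - Iy)\<^sup>2 + (q - Ix)\<^sup>2"
        by (simp add: power2_eq_square algebra_simps)
      moreover have "(p - Iy)\<^sup>2 + (q - Ix)\<^sup>2 \<ge> 0" by simp
      ultimately show "2 * ((p + Ix) * (q + Iy)) - (p + q)\<^sup>2 \<le> (Ix + Iy)\<^sup>2" by linarith
    qed (use abpos in simp)
    also have "\<dots> \<le> 2 * r * (X2 + Y2) / (a * b)"
    proof (intro divide_right_mono)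
      have "Ix\<^sup>2 \<le> (\<Sum>c\<in>P \<inter> R. (x c)\<^sup>2) * r" "Iy\<^sup>2 \<le> (\<Sum>c\<in>P \<inter> R. (y c)\<^sup>2) * r"
        unfolding Ix_def Iy_def r_def using sum_squared_le_sum_of_squares by blast+
      moreover have "(\<Sum>c\<in>P \<inter> R. (x c)\<^sup>2) * r \<le> X2 * r" "(\<Sum>c\<in>P \<inter> R. (y c)\<^sup>2) * r \<le> Y2 * r"
        using I2 by (auto intro!: mult_right_mono simp: r_def)
      moreover have "(Ix + Iy)\<^sup>2 \<le> 2 * (Ix\<^sup>2 + Iy\<^sup>2)"
        using zero_le_power2[of "Ix - Iy"] by (simp add: power2_sum power2_diff)
      ultimately show "(Ix + Iy)\<^sup>2 \<le> 2 * r * (X2 + Y2)" by (simp add: algebra_simps)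
    qed (use abpos in simp)
    also have "\<dots> = r / (a * b) * (2 * (X2 + Y2))" by simp
    also have "\<dots> \<le> t * (2 * (X2 + Y2))"
    proof (intro mult_right_mono)
      have "r / (a * b) \<le> a / (a * b)" using ra abpos by (intro divide_right_mono) auto
      also have "\<dots> = 1 / b" using ab by simp
      also have "\<dots> \<le> 1 / (1 / t)" using ab t t10 by (intro divide_left_mono) auto
      finally show "r / (a * b) \<le> t" by simp
    qed (use XY0 in simp)
    finally show ?thesis by (simp add: algebra_simps)
  qed
  \<comment> \<open>Nearly all colorings leave \<open>c\<close> available to both edges, each
    contributing about \<open>1 / (a * b)\<close>. Their number lies between
    \<open>(a - 1) * (b - 2)\<close> and \<open>(a - 1) * (b - 1)\<close>.\<close>
  have Hb: "0 \<le> 1 - H c" "1 - H c \<le> 3 * t" if c: "c \<in> P \<inter> R" for c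
  proof -
    define C where "C = (SIGMA c1:P - {c}. R - {c, c1})"
    have finC: "finite C" using fin by (simp add: C_def)
    have CD: "C \<subseteq> D" by (auto simp: C_def D_def)
    have "H c = (\<Sum>z\<in>C. K c z)"
      unfolding H_def by (rule sum.mono_neutral_right[OF finD CD]) (auto simp: C_def D_def K_def)
    also have "\<dots> = (\<Sum>(c1, c2)\<in>C. 1 / (real (card (P - {c2})) * real (card (R - {c1}))))"
      by (intro sum.cong refl) (auto simp: C_def K_def)
    finally have HC: "H c = (\<Sum>(c1, c2)\<in>C. 1 / (real (card (P - {c2})) * real (card (R - {c1}))))" .
    have cP: "a - 1 \<le> real (card (P - {z}))" "real (card (P - {z})) \<le> a" for z
      using fin card_mono[of P "P - {z}"] diff_card_le_card_Diff[of "{z}" P] by (auto simp: a_def)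
    have cR: "b - 1 \<le> real (card (R - {z}))" "real (card (R - {z})) \<le> b" for z
      using fin card_mono[of R "R - {z}"] diff_card_le_card_Diff[of "{z}" R] by (auto simp: b_def)
    have cPc: "real (card (P - {c})) = a - 1"
      using card_Suc_Diff1[of P c] fin c by (simp add: a_def)
    have cRc: "real (card (R - {c})) = b - 1"
      using card_Suc_Diff1[of R c] fin c by (simp add: b_def)
    have "H c \<le> (\<Sum>z\<in>C. 1 / ((a - 1) * (b - 1)))"
      unfolding HC
    proof (intro sum_mono)
      fix z assume "z \<in> C"
      obtain c1 c2 where z: "z = (c1, c2)" by force
      have "1 / (real (card (P - {c2})) * real (card (R - {c1}))) \<le> 1 / ((a - 1) * (b - 1))"
        using cP cR ab by (intro frac_le mult_mono) auto
      then show "(case z of (c1, c2) \<Rightarrow> 1 / (real (card (P - {c2})) * real (card (R - {c1})))) \<le>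
          1 / ((a - 1) * (b - 1))" by (simp add: z)
    qed
    also have "\<dots> = real (card C) / ((a - 1) * (b - 1))" by simp
    also have "\<dots> \<le> ((a - 1) * (b - 1)) / ((a - 1) * (b - 1))"
    proof (intro divide_right_mono)
      have "card C \<le> card ((P - {c}) \<times> (R - {c}))"
        using fin by (intro card_mono) (auto simp: C_def)
      then have "real (card C) \<le> real (card ((P - {c}) \<times> (R - {c})))" by simp
      then show "real (card C) \<le> (a - 1) * (b - 1)" by (simp add: card_cartesian_product cPc cRc)
    qed (use ab in simp)
    finally show "0 \<le> 1 - H c" using ab by simp
    have "(a - 1) * (b - 2) \<le> real (card C)"
    proof -
      have "(a - 1) * (b - 2) = (\<Sum>c1\<in>P - {c}. b - 2)" by (simp only: sum_constant cPc)
      also have "\<dots> \<le> (\<Sum>c1\<in>P - {c}. real (card (R - {c, c1})))"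
      proof (intro sum_mono)
        fix c1
        have "card R - card {c, c1} \<le> card (R - {c, c1})" by (intro diff_card_le_card_Diff) auto
        moreover have "card {c, c1} \<le> 2" by (simp add: card_insert_if)
        ultimately show "b - 2 \<le> real (card (R - {c, c1}))" unfolding b_def by linarith
      qed
      also have "\<dots> = real (card C)" using fin by (simp add: C_def)
      finally show ?thesis .
    qed
    then have "(a - 1) * (b - 2) / (a * b) \<le> (\<Sum>z\<in>C. 1 / (a * b))"
      using ab by (simp add: divide_right_mono)
    also have "\<dots> \<le> H c"
      unfolding HC
    proof (intro sum_mono)
      fix z assume z: "z \<in> C"
      obtain c1 c2 where [simp]: "z = (c1, c2)" by force
      have "real (card (P - {c2})) * real (card (R - {c1})) \<le> a * b"
        using cP cR ab by (intro mult_mono) auto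
      moreover have "real (card (P - {c2})) * real (card (R - {c1})) > 0"
        using cP(1)[of c2] cR(1)[of c1] ab by (intro mult_pos_pos) linarith+
      ultimately show "1 / (a * b) \<le> (case z of (c1, c2) \<Rightarrow> 1 / (real (card (P - {c2})) * real (card (R - {c1}))))"
        by (simp add: divide_left_mono)
    qed
    finally have "1 - H c \<le> 1 - (a - 1) * (b - 2) / (a * b)" by simp
    also have "\<dots> \<le> 1 / b + 2 / b + (1 / a - 1 / b)"
      using ab by (simp add: field_simps)
    also have "\<dots> = 1 / a + 2 / b" by simp
    also have "\<dots> \<le> t + 2 * t"
    proof -
      have "1 / a \<le> 1 / (1 / t)" by (rule frac_le) (use ab t10 in linarith)+
      moreover have "1 / b \<le> 1 / (1 / t)" by (rule frac_le) (use ab t10 in linarith)+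
      ultimately show ?thesis by simp
    qed
    finally show "1 - H c \<le> 3 * t" by simp
  qed
  have ii: "2 * (\<Sum>c\<in>P \<inter> R. x c * y c * H c) - 2 * W \<le> 3 * t * (X2 + Y2)"
  proof -
    have "2 * (\<Sum>c\<in>P \<inter> R. x c * y c * H c) - 2 * W = (\<Sum>c\<in>P \<inter> R. - 2 * (x c * y c) * (1 - H c))"
      by (simp add: W_def sum_distrib_left sum_subtractf right_diff_distrib sum_negf mult.assoc)
    also have "\<dots> \<le> (\<Sum>c\<in>P \<inter> R. 3 * t * ((x c)\<^sup>2 + (y c)\<^sup>2))"
    proof (intro sum_mono)
      fix c assume c: "c \<in> P \<inter> R"
      have "- 2 * (x c * y c) \<le> (x c)\<^sup>2 + (y c)\<^sup>2"
        using zero_le_power2[of "x c + y c"] by (simp add: power2_sum)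
      then have "- 2 * (x c * y c) * (1 - H c) \<le> ((x c)\<^sup>2 + (y c)\<^sup>2) * (1 - H c)"
        using Hb(1)[OF c] by (rule mult_right_mono)
      also have "\<dots> \<le> ((x c)\<^sup>2 + (y c)\<^sup>2) * (3 * t)"
        using Hb(2)[OF c] by (intro mult_left_mono) auto
      finally show "- 2 * (x c * y c) * (1 - H c) \<le> 3 * t * ((x c)\<^sup>2 + (y c)\<^sup>2)"
        by (simp add: mult_ac)
    qed
    also have "\<dots> = 3 * t * ((\<Sum>c\<in>P \<inter> R. (x c)\<^sup>2) + (\<Sum>c\<in>P \<inter> R. (y c)\<^sup>2))"
      by (simp add: sum_distrib_left sum.distrib distrib_left)
    also have "\<dots> \<le> 3 * t * (X2 + Y2)" using I2 t by (intro mult_left_mono) auto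
    finally show ?thesis .
  qed
  have iii: "(X2 + Y2) / 2 \<le> t / 2 * Q"
  proof -
    have "1 / t * X2 \<le> (b - 1) * X2" by (rule mult_right_mono[OF ab(4) XY0(1)])
    moreover have "1 / t * Y2 \<le> (a - 1) * Y2" by (rule mult_right_mono[OF ab(3) XY0(2)])
    ultimately have "1 / t * (X2 + Y2) \<le> Q"
      using I2 unfolding s3 distrib_left left_diff_distrib mult_1 by linarith
    then have "t * (1 / t * (X2 + Y2)) \<le> t * Q" using t by (intro mult_left_mono) auto
    then show ?thesis using t by simp
  qed
  have "5 * t * (X2 + Y2) \<le> 1 / 2 * (X2 + Y2)" using t XY0 by (intro mult_right_mono) auto
  then have "vsum D (\<lambda>(c, c'). x c + y c') \<le> Q + t / 2 * Q - 2 * (\<Sum>c\<in>P \<inter> R. x c * y c * H c)"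
    using i ii iii unfolding var by (simp add: algebra_simps)
  also have "(\<Sum>c\<in>P \<inter> R. x c * y c * H c) = (\<Sum>z\<in>D. \<Sum>c\<in>P \<inter> R. x c * y c * K c z)"
    unfolding H_def sum_distrib_left by (rule sum.swap)
  also have "Q + t / 2 * Q = (\<Sum>(c, c')\<in>D. (1 + t / 2) * ((x c)\<^sup>2 + (y c')\<^sup>2))"
    unfolding Q_def case_prod_unfold sum_distrib_left[symmetric] by (simp add: algebra_simps)
  finally show ?thesis .
qed

lemma vsum_Times:
  assumes "finite A" "A \<noteq> {}" "finite B" "B \<noteq> {}"
  shows "vsum (A \<times> B) (\<lambda>z. f (fst z) + g (snd z)) = real (card B) * vsum A f + real (card A) * vsum B g"
proof -
  have s: "(\<Sum>z\<in>A \<times> B. F (fst z) (snd z)) = (\<Sum>a\<in>A. \<Sum>b\<in>B. F a b)" for F :: "_ \<Rightarrow> _ \<Rightarrow> real"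
    by (simp add: sum.cartesian_product case_prod_unfold)
  have pos: "real (card A) > 0" "real (card B) > 0" using assms by (auto simp: card_gt_0_iff)
  have m: "mean (A \<times> B) (\<lambda>z. f (fst z) + g (snd z)) = mean A f + mean B g"
  proof -
    have "(\<Sum>z\<in>A \<times> B. f (fst z) + g (snd z)) = (\<Sum>a\<in>A. \<Sum>b\<in>B. f a + g b)" by (rule s)
    also have "\<dots> = real (card B) * sum f A + real (card A) * sum g B"
      by (simp add: sum.distrib sum_distrib_left)
    finally show ?thesis using pos by (simp add: mean_def card_cartesian_product field_simps)
  qed
  have zero: "(\<Sum>a\<in>A. f a - mean A f) = 0"
    using pos by (simp add: sum_subtractf mean_def)
  have "vsum (A \<times> B) (\<lambda>z. f (fst z) + g (snd z)) =
     (\<Sum>a\<in>A. \<Sum>b\<in>B. (f a + g b - (mean A f + mean B g))\<^sup>2)"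
    unfolding vsum_def m by (rule s)
  also have "\<dots> = (\<Sum>a\<in>A. \<Sum>b\<in>B. (f a - mean A f)\<^sup>2 + (g b - mean B g)\<^sup>2 + 2 * (f a - mean A f) * (g b - mean B g))"
    by (intro sum.cong refl) (simp add: power2_eq_square algebra_simps)
  also have "\<dots> = real (card B) * vsum A f + real (card A) * vsum B g
      + (\<Sum>a\<in>A. \<Sum>b\<in>B. 2 * (f a - mean A f) * (g b - mean B g))"
    by (simp add: sum.distrib vsum_def sum_distrib_left)
  also have "(\<Sum>a\<in>A. \<Sum>b\<in>B. 2 * (f a - mean A f) * (g b - mean B g)) =
      (\<Sum>a\<in>A. 2 * (f a - mean A f)) * (\<Sum>b\<in>B. g b - mean B g)"
    by (rule sum_product[symmetric])
  also have "(\<Sum>a\<in>A. 2 * (f a - mean A f)) = 2 * (\<Sum>a\<in>A. f a - mean A f)"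
    by (rule sum_distrib_left[symmetric])
  finally show ?thesis unfolding zero by simp
qed

lemma vsum_reindex:
  assumes "bij_betw m B A"
  shows "vsum A f = vsum B (f \<circ> m)"
proof -
  have "mean A f = mean B (f \<circ> m)"
    using sum.reindex_bij_betw[OF assms, of f] bij_betw_same_card[OF assms] by (simp add: mean_def)
  then show ?thesis
    using sum.reindex_bij_betw[OF assms, of "\<lambda>s. (f s - mean A f)\<^sup>2"] by (simp add: vsum_def)
qed

section \<open>Splitting off components, the base case of two adjacent edges, and the full
  induction\<close>

context list_coloring_large
begin

lemma colorings_nb_iff:
  "s \<in> colorings \<longleftrightarrow> s \<in> extensional E \<and> (\<forall>e\<in>E. s e \<in> L e) \<and> (\<forall>e\<in>E. \<forall>f\<in>nb E e. s f \<noteq> s e)"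
  by (auto simp: colorings_iff avail_def)

lemma good_empty: "good {}"
  by (simp add: good_def ssum_def vsum_def mean_def sqs_def nform_def vform_degree_le_1 degree_of_def)

lemma good_singleton:
  assumes e: "e \<in> E"
  shows "good {e}"
  unfolding good_def
proof (intro ballI allI)
  fix \<rho> \<phi> assume "\<rho> \<in> colorings"
  then have ne: "ext {e} \<rho> \<noteq> {}" by (auto simp: ext_def)
  have "degree_of {e} v \<le> 1" for v
    unfolding degree_of_inc using card_mono[of "{e}" "inc {e} v"] inc_subset[of "{e}" v] by simp
  then have "nform {e} \<phi> s = 0" for s
    using e by (simp add: nform_def vform_degree_le_1)
  then show "vsum (ext {e} \<rho>) (ssum {e} \<phi>) \<le>
      sum (sqs {e} \<phi>) (ext {e} \<rho>) + sum (nform {e} \<phi>) (ext {e} \<rho>)"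
    using vsum_le_sum_square[OF finite_ext ne, of "ssum {e} \<phi>"] by (simp add: ssum_def sqs_def)
qed

definition merge :: "'v set set \<Rightarrow> ('v set \<Rightarrow> nat) \<times> ('v set \<Rightarrow> nat) \<Rightarrow> 'v set \<Rightarrow> nat" where
  "merge U2 p = (\<lambda>e. if e \<in> U2 then snd p e else fst p e)"

lemma merge_bij:
  assumes \<rho>: "\<rho> \<in> colorings" and U: "U1 \<subseteq> E" "U2 \<subseteq> E" and sep: "\<And>e f. e \<in> U1 \<Longrightarrow> f \<in> U2 \<Longrightarrow> e \<inter> f = {}"
  shows "bij_betw (merge U2) (ext U1 \<rho> \<times> ext U2 \<rho>) (ext (U1 \<union> U2) \<rho>)"
proof -
  have disj: "e \<notin> U2" if "e \<in> U1" for e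
    using sep[OF that] that U edge_nonempty by blast
  \<comment> \<open>Adjacent edges are never split between the two sets, so every constraint on a
    merged coloring already holds in one of its two parts.\<close>
  have cases: "(e \<notin> U2 \<and> f \<notin> U2) \<or> (e \<notin> U1 \<and> f \<notin> U1)" if "f \<in> nb E e" for e f
    using that sep[of e f] sep[of f e] disj by (auto simp: nb_def)
  define split where "split = (\<lambda>s. (\<lambda>e. if e \<in> U2 then \<rho> e else s e, \<lambda>e. if e \<in> U1 then \<rho> e else s e))"
  show ?thesis
  proof (rule bij_betw_byWitness[of _ split])
    show "\<forall>p\<in>ext U1 \<rho> \<times> ext U2 \<rho>. split (merge U2 p) = p"
    proof (clarify)
      fix s1 s2 assume s: "s1 \<in> ext U1 \<rho>" "s2 \<in> ext U2 \<rho>"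
      have "(if e \<in> U2 then \<rho> e else merge U2 (s1, s2) e) = s1 e" for e
      proof (cases "e \<in> U2")
        case True
        then have "e \<in> E - U1" using U disj by blast
        then show ?thesis using s True by (simp add: ext_def)
      qed (simp add: merge_def)
      moreover have "(if e \<in> U1 then \<rho> e else merge U2 (s1, s2) e) = s2 e" for e
      proof (cases "e \<in> E")
        case True
        then show ?thesis using s U disj by (auto simp: merge_def ext_def)
      next
        case False
        then have "s1 e = undefined" "s2 e = undefined" "e \<notin> U1"
          using s U by (auto simp: ext_def colorings_def extensional_def)
        then show ?thesis by (simp add: merge_def)
      qed
      ultimately show "split (merge U2 (s1, s2)) = (s1, s2)" by (simp add: split_def fun_eq_iff)
    qed
    show "\<forall>s\<in>ext (U1 \<union> U2) \<rho>. merge U2 (split s) = s"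
      using disj by (auto simp: merge_def split_def fun_eq_iff)
    show "merge U2 ` (ext U1 \<rho> \<times> ext U2 \<rho>) \<subseteq> ext (U1 \<union> U2) \<rho>"
    proof clarify
      fix s1 s2 assume s: "s1 \<in> ext U1 \<rho>" "s2 \<in> ext U2 \<rho>"
      let ?m = "merge U2 (s1, s2)"
      have m1: "?m e = s1 e" if "e \<notin> U2" for e using that by (simp add: merge_def)
      have m2: "?m e = s2 e" if "e \<in> E" "e \<notin> U1" for e using that s by (auto simp: merge_def ext_def)
      have c: "s1 \<in> colorings" "s2 \<in> colorings" using s by (auto simp: ext_def)
      have "?m f \<noteq> ?m e" if e: "e \<in> E" "f \<in> nb E e" for e f
      proof -
        have "f \<in> E" using e by (simp add: nb_def)
        then show ?thesis using cases[OF e(2)] c e m1 m2 by (auto simp: colorings_nb_iff)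
      qed
      moreover have "?m e \<in> L e" if "e \<in> E" for e
        using c that by (auto simp: merge_def colorings_nb_iff)
      moreover have "?m \<in> extensional E" using c U by (auto simp: merge_def colorings_nb_iff extensional_def)
      ultimately have "?m \<in> colorings" by (simp add: colorings_nb_iff)
      then show "?m \<in> ext (U1 \<union> U2) \<rho>" using s by (auto simp: ext_def merge_def)
    qed
    show "split ` ext (U1 \<union> U2) \<rho> \<subseteq> ext U1 \<rho> \<times> ext U2 \<rho>"
    proof (rule image_subsetI)
      fix s assume s: "s \<in> ext (U1 \<union> U2) \<rho>"
      then have c: "s \<in> colorings" by (simp add: ext_def)
      have part: "\<tau> \<in> colorings"
        if t: "\<And>e. \<tau> e = (if e \<in> W then \<rho> e else s e)" and W: "W \<subseteq> E"
          and WW: "\<And>e f. f \<in> nb E e \<Longrightarrow> (e \<notin> W \<and> f \<notin> W) \<or> (e \<notin> W' \<and> f \<notin> W')"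
          and WU: "U1 \<union> U2 = W \<union> W'" for \<tau> W W'
      proof -
        have t': "\<tau> e = \<rho> e" if "e \<in> E" "e \<notin> W'" for e
          using that s WU unfolding t by (auto simp: ext_def)
        have t'': "\<tau> e = s e" if "e \<notin> W" for e using that t by simp
        have "\<tau> f \<noteq> \<tau> e" if e: "e \<in> E" "f \<in> nb E e" for e f
        proof -
          have "f \<in> E" using e by (simp add: nb_def)
          then show ?thesis using WW[OF e(2)] c \<rho> e t' t'' by (auto simp: colorings_nb_iff)
        qed
        moreover have "\<tau> e \<in> L e" if "e \<in> E" for e
          using c \<rho> that by (auto simp: t colorings_nb_iff)
        moreover have "\<tau> \<in> extensional E" using c W by (auto simp: t colorings_nb_iff extensional_def)
        ultimately show ?thesis by (simp add: colorings_nb_iff)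
      qed
      have "fst (split s) \<in> colorings"
        using U cases by (intro part[of _ U2 U1]) (auto simp: split_def)
      moreover have "snd (split s) \<in> colorings"
        using U cases by (intro part[of _ U1 U2]) (auto simp: split_def)
      ultimately show "split s \<in> ext U1 \<rho> \<times> ext U2 \<rho>"
        using s by (auto simp: ext_def split_def)
    qed
  qed
qed

text \<open>Both ingredients only look into the component: \<open>second\<close> reaches no further
  than edges meeting an edge at \<open>v\<close>, and \<open>h\<close> reads neighbors, none of
  which lies in \<open>U2\<close>.\<close>

lemma vform_local:
  assumes U: "U1 \<subseteq> E" "U2 \<subseteq> E" and sep: "\<And>e f. e \<in> U1 \<Longrightarrow> f \<in> U2 \<Longrightarrow> e \<inter> f = {}"
    and I: "inc U2 v = {}" and agree: "\<And>e. e \<in> E \<Longrightarrow> e \<notin> U2 \<Longrightarrow> s e = s1 e"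
  shows "vform (U1 \<union> U2) v \<phi> s = vform U1 v \<phi> s1"
proof -
  have disj: "e \<notin> U2" if "e \<in> U1" for e
    using sep[OF that] that U edge_nonempty by blast
  have inc: "inc (U1 \<union> U2) v = inc U1 v" using I by (auto simp: inc_def)
  have sec: "second (U1 \<union> U2) v = second U1 v"
    unfolding second_def inc using sep by (auto simp: inc_def)
  have G: "G (U1 \<union> U2) v = G U1 v" by (simp add: G_def degree_of_inc inc sec)
  have E1: "e \<in> E" "e \<in> U1" if "e \<in> inc U1 v" for e using that U by (auto simp: inc_def)
  have "sqs (inc U1 v) \<phi> s = sqs (inc U1 v) \<phi> s1"
    unfolding sqs_def using E1 disj agree by (intro sum.cong refl) auto
  moreover have h: "h e c s = h e c s1" if "e \<in> inc U1 v" for e c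
  proof (rule h_cong)
    fix f assume f: "f \<in> nb E e"
    then have "f \<notin> U2" using sep[of e f] E1(2)[OF that] by (auto simp: nb_def)
    then show "s f = s1 f" using agree f by (simp add: nb_def)
  qed
  then have "pairform (inc U1 v) \<phi> s = pairform (inc U1 v) \<phi> s1"
    unfolding pairform_def by (intro sum.cong refl) auto
  ultimately show ?thesis by (simp add: vform_def inc G)
qed

text \<open>Given the boundary, the two parts are independent and variances add. The sizes of the
  other factor appear because \<open>vsum\<close> and the sums of squares are unnormalised.\<close>

lemma good_union:
  assumes U: "U1 \<subseteq> E" "U2 \<subseteq> E" and sep: "\<And>e f. e \<in> U1 \<Longrightarrow> f \<in> U2 \<Longrightarrow> e \<inter> f = {}"
    and good: "good U1" "good U2"
  shows "good (U1 \<union> U2)"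
  unfolding good_def
proof (intro ballI allI)
  fix \<rho> \<phi> assume \<rho>: "\<rho> \<in> colorings"
  let ?A1 = "ext U1 \<rho>" and ?A2 = "ext U2 \<rho>" and ?A = "ext (U1 \<union> U2) \<rho>"
  let ?n1 = "real (card ?A1)" and ?n2 = "real (card ?A2)"
  have bij: "bij_betw (merge U2) (?A1 \<times> ?A2) ?A" by (rule merge_bij[OF \<rho> U sep])
  have ne: "?A1 \<noteq> {}" "?A2 \<noteq> {}" using \<rho> by (auto simp: ext_def)
  have fin: "finite U1" "finite U2" using finite_sub U by auto
  have disj: "U1 \<inter> U2 = {}" using sep U edge_nonempty by fastforce
  have sum2: "(\<Sum>s\<in>?A. F s) = ?n2 * (\<Sum>s\<in>?A1. F1 s) + ?n1 * (\<Sum>s\<in>?A2. F2 s)"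
    if F: "\<And>p. p \<in> ?A1 \<times> ?A2 \<Longrightarrow> F (merge U2 p) = F1 (fst p) + F2 (snd p)" for F F1 F2 :: "_ \<Rightarrow> real"
  proof -
    have "(\<Sum>s\<in>?A. F s) = (\<Sum>p\<in>?A1 \<times> ?A2. F1 (fst p) + F2 (snd p))"
      using sum.reindex_bij_betw[OF bij, of F] F by simp
    also have "\<dots> = (\<Sum>s1\<in>?A1. \<Sum>s2\<in>?A2. F1 s1 + F2 s2)"
      by (simp only: sum.cartesian_product case_prod_unfold)
    finally show ?thesis by (simp add: sum.distrib sum_distrib_left)
  qed
  have m1: "merge U2 p e = fst p e" if "e \<notin> U2" for p e using that by (simp add: merge_def)
  have m2: "merge U2 p e = snd p e" if "p \<in> ?A1 \<times> ?A2" "e \<in> E" "e \<notin> U1" for p e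
    using that by (auto simp: merge_def ext_def)
  have split: "(\<Sum>e\<in>U1 \<union> U2. F (e, merge U2 p e)) = (\<Sum>e\<in>U1. F (e, fst p e)) + (\<Sum>e\<in>U2. F (e, snd p e))"
    for F :: "_ \<Rightarrow> real" and p
  proof -
    have "(\<Sum>e\<in>U1. F (e, merge U2 p e)) = (\<Sum>e\<in>U1. F (e, fst p e))"
      using disj by (intro sum.cong refl) (auto simp: merge_def)
    moreover have "(\<Sum>e\<in>U2. F (e, merge U2 p e)) = (\<Sum>e\<in>U2. F (e, snd p e))"
      by (simp add: merge_def)
    ultimately show ?thesis using fin disj by (simp add: sum.union_disjoint)
  qed
  have nf: "nform (U1 \<union> U2) \<phi> (merge U2 p) = nform U1 \<phi> (fst p) + nform U2 \<phi> (snd p)"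
    if p: "p \<in> ?A1 \<times> ?A2" for p
    unfolding nform_def sum.distrib[symmetric]
  proof (intro sum.cong refl)
    fix v
    have "inc U1 v = {} \<or> inc U2 v = {}" using sep by (fastforce simp: inc_def)
    then show "vform (U1 \<union> U2) v \<phi> (merge U2 p) = vform U1 v \<phi> (fst p) + vform U2 v \<phi> (snd p)"
    proof
      assume I: "inc U2 v = {}"
      have "vform (U1 \<union> U2) v \<phi> (merge U2 p) = vform U1 v \<phi> (fst p)"
        using m1 by (intro vform_local[OF U sep I]) auto
      moreover have "vform U2 v \<phi> (snd p) = 0"
        using vform_degree_le_1[OF U(2), of v] I by (simp add: degree_of_inc)
      ultimately show ?thesis by simp
    next
      assume I: "inc U1 v = {}"
      have "vform (U2 \<union> U1) v \<phi> (merge U2 p) = vform U2 v \<phi> (snd p)"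
        using m2[OF p] sep by (intro vform_local[OF U(2) U(1) _ I]) blast+
      moreover have "vform U1 v \<phi> (fst p) = 0"
        using vform_degree_le_1[OF U(1), of v] I by (simp add: degree_of_inc)
      ultimately show ?thesis by (simp add: Un_commute)
    qed
  qed
  have "vsum ?A (ssum (U1 \<union> U2) \<phi>) = vsum (?A1 \<times> ?A2) (\<lambda>p. ssum U1 \<phi> (fst p) + ssum U2 \<phi> (snd p))"
    unfolding vsum_reindex[OF bij] by (intro vsum_cong) (simp add: ssum_def split)
  also have "\<dots> = ?n2 * vsum ?A1 (ssum U1 \<phi>) + ?n1 * vsum ?A2 (ssum U2 \<phi>)"
    by (rule vsum_Times[OF finite_ext ne(1) finite_ext ne(2)])
  also have "\<dots> \<le> ?n2 * (sum (sqs U1 \<phi>) ?A1 + sum (nform U1 \<phi>) ?A1) +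
      ?n1 * (sum (sqs U2 \<phi>) ?A2 + sum (nform U2 \<phi>) ?A2)"
    using good \<rho> unfolding good_def by (intro add_mono mult_left_mono) auto
  also have "\<dots> = sum (sqs (U1 \<union> U2) \<phi>) ?A + sum (nform (U1 \<union> U2) \<phi>) ?A"
  proof -
    have "sum (sqs (U1 \<union> U2) \<phi>) ?A = ?n2 * sum (sqs U1 \<phi>) ?A1 + ?n1 * sum (sqs U2 \<phi>) ?A2"
      by (rule sum2) (simp add: sqs_def split[of "\<lambda>x. (\<phi> x)\<^sup>2"])
    moreover have "sum (nform (U1 \<union> U2) \<phi>) ?A = ?n2 * sum (nform U1 \<phi>) ?A1 + ?n1 * sum (nform U2 \<phi>) ?A2"
      by (rule sum2) (rule nf)
    ultimately show ?thesis by (simp add: distrib_left)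
  qed
  finally show "vsum ?A (ssum (U1 \<union> U2) \<phi>) \<le>
      sum (sqs (U1 \<union> U2) \<phi>) ?A + sum (nform (U1 \<union> U2) \<phi>) ?A" .
qed

text \<open>With all other edges fixed, \<open>e\<close> and \<open>f\<close> choose distinct colors
  from \<open>P\<close> and \<open>R\<close>. Two distinct edges share a single vertex, so only
  \<open>v\<close> contributes to \<open>nform\<close>; its weight is exactly \<open>t / 2\<close>,
  because \<open>second\<close> is empty there.\<close>

lemma good_pair:
  assumes ef: "e \<in> E" "f \<in> E" "e \<noteq> f" and v: "v \<in> e" "v \<in> f"
  shows "good {e, f}"
  unfolding good_def
proof (intro ballI allI)
  fix \<rho> and \<phi> :: "'v set \<times> nat \<Rightarrow> real"
  assume \<rho>: "\<rho> \<in> colorings"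
  let ?A = "ext {e, f} \<rho>"
  have U: "{e, f} \<subseteq> E" using ef by simp
  have fe: "f \<in> nb E e" "e \<in> nb E f" using ef v by (auto simp: nb_def)
  define P where "P = {c \<in> L e. \<forall>g\<in>nb E e - {f}. \<rho> g \<noteq> c}"
  define R where "R = {c \<in> L f. \<forall>g\<in>nb E f - {e}. \<rho> g \<noteq> c}"
  define D where "D = {(c, c') \<in> P \<times> R. c \<noteq> c'}"
  define m where "m = (\<lambda>p. \<rho>(e := fst p, f := snd p))"
  have me: "m p e = fst p" and mf: "m p f = snd p" and mo: "\<And>g. g \<noteq> e \<Longrightarrow> g \<noteq> f \<Longrightarrow> m p g = \<rho> g" for p
    using ef by (auto simp: m_def)
  have inc_v: "inc {e, f} v = {e, f}" using v by (auto simp: inc_def)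
  have deg_v: "degree_of {e, f} v = 2" using ef by (simp add: degree_of_inc inc_v)
  have D2: "2 \<le> \<Delta>" using degree_le_sub[OF U, of v] deg_v by simp
  have fin: "finite P" "finite R" using finite_L ef by (auto simp: P_def R_def)
  \<comment> \<open>The neighbor \<open>f\<close> is not fixed and blocks nothing in
    \<open>P\<close>, which gives the extra 1.\<close>
  have cP: "real (card P) \<ge> 1 / t + 1"
  proof -
    have "real (card (nb E e)) = real (card (nb E e - {f})) + 1"
      using card_Suc_Diff1[OF finite_nb fe(1)] by linarith
    then show ?thesis
      using card_avail_ge_gen[OF ef(1), of "nb E e - {f}" \<rho>] by (auto simp: P_def)
  qed
  have cR: "real (card R) \<ge> 1 / t + 1"
  proof -
    have "real (card (nb E f)) = real (card (nb E f - {e})) + 1"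
      using card_Suc_Diff1[OF finite_nb fe(2)] by linarith
    then show ?thesis
      using card_avail_ge_gen[OF ef(2), of "nb E f - {e}" \<rho>] by (auto simp: R_def)
  qed
  have av_e: "avail e (m p) = P - {snd p}" for p
  proof -
    have "(\<forall>g\<in>nb E e. m p g \<noteq> c) \<longleftrightarrow> (\<forall>g\<in>nb E e - {f}. \<rho> g \<noteq> c) \<and> c \<noteq> snd p" for c
    proof -
      have "m p g = \<rho> g" if "g \<in> nb E e - {f}" for g using that mo by (auto simp: nb_def)
      moreover have "(\<forall>g\<in>nb E e. m p g \<noteq> c) \<longleftrightarrow> (\<forall>g\<in>nb E e - {f}. m p g \<noteq> c) \<and> m p f \<noteq> c"
        using fe(1) by blast
      ultimately show ?thesis using mf[of p] by auto
    qed
    then show ?thesis by (auto simp: avail_def P_def)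
  qed
  have av_f: "avail f (m p) = R - {fst p}" for p
  proof -
    have "(\<forall>g\<in>nb E f. m p g \<noteq> c) \<longleftrightarrow> (\<forall>g\<in>nb E f - {e}. \<rho> g \<noteq> c) \<and> c \<noteq> fst p" for c
    proof -
      have "m p g = \<rho> g" if "g \<in> nb E f - {e}" for g using that mo by (auto simp: nb_def)
      moreover have "(\<forall>g\<in>nb E f. m p g \<noteq> c) \<longleftrightarrow> (\<forall>g\<in>nb E f - {e}. m p g \<noteq> c) \<and> m p e \<noteq> c"
        using fe(2) by blast
      ultimately show ?thesis using me[of p] by auto
    qed
    then show ?thesis by (auto simp: avail_def R_def)
  qed
  have bij: "bij_betw m D ?A"
  proof (rule bij_betw_byWitness[of _ "\<lambda>s. (s e, s f)"])
    show "\<forall>p\<in>D. (m p e, m p f) = p" using me mf by simp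
    show "\<forall>s\<in>?A. m (s e, s f) = s"
    proof
      fix s assume s: "s \<in> ?A"
      have "m (s e, s f) g = s g" for g
      proof (cases "g \<in> E")
        case True
        then show ?thesis using s by (auto simp: m_def ext_def)
      next
        case False
        then show ?thesis using s \<rho> by (auto simp: m_def ext_def colorings_iff extensional_def)
      qed
      then show "m (s e, s f) = s" by auto
    qed
    show "m ` D \<subseteq> ?A"
    proof (rule image_subsetI)
      fix p assume p: "p \<in> D"
      have "m p g \<in> avail g (m p)" if g: "g \<in> E" for g
      proof (cases "g = e \<or> g = f")
        case True
        have "fst p \<in> P - {snd p}" "snd p \<in> R - {fst p}" using p by (auto simp: D_def)
        then show ?thesis using True by (auto simp: av_e av_f me mf)
      next
        case False
        have "\<rho> g \<in> avail g \<rho>" using \<rho> g by (simp add: colorings_iff)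
        moreover have "\<rho> g \<noteq> fst p" if "e \<in> nb E g"
        proof -
          have "g \<in> nb E e - {f}" using that False g by (auto simp: nb_def)
          then show ?thesis using p by (auto simp: D_def P_def)
        qed
        moreover have "\<rho> g \<noteq> snd p" if "f \<in> nb E g"
        proof -
          have "g \<in> nb E f - {e}" using that False g by (auto simp: nb_def)
          then show ?thesis using p by (auto simp: D_def R_def)
        qed
        ultimately show ?thesis using False by (auto simp: avail_def m_def)
      qed
      moreover have "m p \<in> extensional E" using \<rho> ef by (auto simp: m_def colorings_iff extensional_def)
      ultimately have "m p \<in> colorings" by (simp add: colorings_iff)
      then show "m p \<in> ?A" by (simp add: ext_def m_def)
    qed
    show "(\<lambda>s. (s e, s f)) ` ?A \<subseteq> D"
    proof (rule image_subsetI)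
      fix s assume s: "s \<in> ?A"
      have "s e \<in> avail e s" "s f \<in> avail f s" using ext_in_avail[OF s] ef by auto
      moreover have "s g = \<rho> g" if "g \<in> nb E e - {f} \<or> g \<in> nb E f - {e}" for g
        using that s by (auto simp: ext_def nb_def)
      ultimately show "(s e, s f) \<in> D"
        using fe by (fastforce simp: D_def P_def R_def avail_def)
    qed
  qed
  define x where "x = (\<lambda>c. \<phi> (e, c))"
  define y where "y = (\<lambda>c. \<phi> (f, c))"
  define K where "K = (\<lambda>c (c1, c2). (if c \<noteq> c2 then 1 / real (card (P - {c2})) else 0) *
      (if c \<noteq> c1 then 1 / real (card (R - {c1})) else 0))"
  have "t \<le> 1 / 10" using t_small[OF D2] by simp
  then have main: "vsum D (\<lambda>(c, c'). x c + y c') \<le> (\<Sum>(c, c')\<in>D. (1 + t / 2) * ((x c)\<^sup>2 + (y c')\<^sup>2)) -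
      2 * (\<Sum>p\<in>D. \<Sum>c\<in>P \<inter> R. x c * y c * K c p)"
    unfolding D_def K_def using pair_variance[OF fin t_pos _ cP cR] by blast
  have nf: "nform {e, f} \<phi> (m p) = t / 2 * ((x (fst p))\<^sup>2 + (y (snd p))\<^sup>2) - 2 * (\<Sum>c\<in>P \<inter> R. x c * y c * K c p)"
    for p
  proof -
    have "nform {e, f} \<phi> (m p) = (\<Sum>u\<in>\<Union>E. if u = v then vform {e, f} v \<phi> (m p) else 0)"
      unfolding nform_def
    proof (intro sum.cong refl)
      fix u
      have "degree_of {e, f} u \<le> 1" if "u \<noteq> v"
      proof -
        have "\<not> (u \<in> e \<and> u \<in> f)" using edges_share_one[of e f v u] ef v that by auto
        then have "inc {e, f} u \<subseteq> {e} \<or> inc {e, f} u \<subseteq> {f}" by (auto simp: inc_def)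
        then show ?thesis unfolding degree_of_inc
          using card_mono[of "{e}" "inc {e, f} u"] card_mono[of "{f}" "inc {e, f} u"] by auto
      qed
      then show "vform {e, f} u \<phi> (m p) = (if u = v then vform {e, f} v \<phi> (m p) else 0)"
        using vform_degree_le_1[OF U] by auto
    qed
    also have "\<dots> = vform {e, f} v \<phi> (m p)"
      using finite_vertices ef v by auto
    also have "\<dots> = t / 2 * sqs {e, f} \<phi> (m p) - pairform {e, f} \<phi> (m p)"
    proof -
      have "second {e, f} v = {}" using v by (auto simp: second_def)
      then show ?thesis by (simp add: vform_def inc_v G_def deg_v)
    qed
    also have "sqs {e, f} \<phi> (m p) = (x (fst p))\<^sup>2 + (y (snd p))\<^sup>2"
      using ef by (simp add: sqs_def me mf x_def y_def)
    also have "pairform {e, f} \<phi> (m p) = 2 * (\<Sum>c\<in>palette. (x c * h e c (m p)) * (y c * h f c (m p)))"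
    proof -
      have "{e, f} - {e} = {f}" "{e, f} - {f} = {e}" using ef by auto
      then show ?thesis using ef by (simp add: pairform_def x_def y_def mult.commute)
    qed
    also have "(\<Sum>c\<in>palette. (x c * h e c (m p)) * (y c * h f c (m p))) = (\<Sum>c\<in>P \<inter> R. x c * y c * K c p)"
    proof (rule sum.mono_neutral_cong_right)
      show "P \<inter> R \<subseteq> palette" using ef by (auto simp: P_def palette_def)
      show "\<forall>c\<in>palette - P \<inter> R. x c * h e c (m p) * (y c * h f c (m p)) = 0"
        by (auto simp: h_def av_e av_f)
      fix c assume "c \<in> P \<inter> R"
      then show "x c * h e c (m p) * (y c * h f c (m p)) = x c * y c * K c p"
        by (auto simp: h_def av_e av_f K_def case_prod_unfold)
    qed simp
    finally show ?thesis .
  qed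
  have "vsum ?A (ssum {e, f} \<phi>) = vsum D (\<lambda>(c, c'). x c + y c')"
    unfolding vsum_reindex[OF bij] using ef
    by (intro vsum_cong) (auto simp: ssum_def me mf x_def y_def)
  moreover have "(\<Sum>(c, c')\<in>D. (1 + t / 2) * ((x c)\<^sup>2 + (y c')\<^sup>2)) - 2 * (\<Sum>p\<in>D. \<Sum>c\<in>P \<inter> R. x c * y c * K c p) =
      (\<Sum>p\<in>D. sqs {e, f} \<phi> (m p)) + (\<Sum>p\<in>D. nform {e, f} \<phi> (m p))"
    unfolding nf sum.distrib[symmetric] sum_distrib_left[of 2] sum_subtractf[symmetric] using ef
    by (intro sum.cong refl) (auto simp: sqs_def me mf x_def y_def algebra_simps)
  moreover have "(\<Sum>p\<in>D. sqs {e, f} \<phi> (m p)) + (\<Sum>p\<in>D. nform {e, f} \<phi> (m p)) = sum (sqs {e, f} \<phi>) ?A + sum (nform {e, f} \<phi>) ?A"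
    by (simp only: sum.reindex_bij_betw[OF bij])
  ultimately show "vsum ?A (ssum {e, f} \<phi>) \<le>
      sum (sqs {e, f} \<phi>) ?A + sum (nform {e, f} \<phi>) ?A"
    using main by (simp only:)
qed

text \<open>Isolated edges and isolated adjacent pairs are removed first. Otherwise every vertex of
  degree 2 has a nonempty \<open>second\<close>, as \<open>good_step\<close> requires, and this
  alone rules out \<open>card U = 2\<close>.\<close>

lemma good_all: "U \<subseteq> E \<Longrightarrow> good U"
proof (induction "card U" arbitrary: U rule: less_induct)
  case less
  have finU: "finite U" using finite_sub[OF less.prems] .
  have IH: "good W" if "W \<subset> U" for W
    using less.hyps[of W] psubset_card_mono[OF finU that] that less.prems by auto
  have UE: "e \<in> E" if "e \<in> U" for e using that less.prems by auto
  consider "U = {}" | e where "e \<in> U" "nb U e = {}"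
    | v where "degree_of U v = 2" "second U v = {}"
    | e f where "e \<in> U" "f \<in> nb U e" "\<And>v. degree_of U v = 2 \<Longrightarrow> second U v \<noteq> {}"
    by (metis equals0I)
  then show ?case
  proof cases
    case 1
    then show ?thesis using good_empty by simp
  next
    case (2 e)
    have "good ({e} \<union> (U - {e}))"
    proof (rule good_union)
      show "e' \<inter> f = {}" if "e' \<in> {e}" "f \<in> U - {e}" for e' f
        using 2(2) that by (auto simp: nb_def)
      show "good (U - {e})" using IH[of "U - {e}"] 2(1) by auto
    qed (use 2 UE less.prems good_singleton in auto)
    then show ?thesis using 2(1) by (simp add: insert_absorb)
  next
    case (3 v)
    then obtain e f where ef: "inc U v = {e, f}" "e \<noteq> f"
      by (auto simp: degree_of_inc card_2_iff)
    then have efU: "e \<in> U" "f \<in> U" "v \<in> e" "v \<in> f" by (auto simp: inc_def)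
    have "good ({e, f} \<union> (U - {e, f}))"
    proof (rule good_union)
      show "e' \<inter> g = {}" if e': "e' \<in> {e, f}" and g: "g \<in> U - {e, f}" for e' g
      proof -
        have "v \<notin> g" using g ef(1) by (auto simp: inc_def)
        then show ?thesis using 3(2) e' g ef(1) by (auto simp: second_def)
      qed
      show "good {e, f}" using good_pair[OF _ _ ef(2) efU(3,4)] efU UE by auto
      show "good (U - {e, f})" using IH[of "U - {e, f}"] efU by auto
    qed (use efU UE less.prems in auto)
    then show ?thesis using efU by (simp add: insert_absorb)
  next
    case (4 e f)
    obtain v where v: "v \<in> e" "v \<in> f" "f \<in> U" "f \<noteq> e" using 4(2) by (auto simp: nb_def)
    have "card U \<ge> 3"
    proof (rule ccontr)
      assume "\<not> card U \<ge> 3"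
      moreover have "card {e, f} = 2" using v by simp
      moreover have "{e, f} \<subseteq> U" using 4(1) v by simp
      ultimately have "U = {e, f}" using card_seteq[OF finU, of "{e, f}"] by simp
      moreover have "inc {e, f} v = {e, f}" "second {e, f} v = {}"
        using v by (auto simp: inc_def second_def)
      ultimately show False using 4(3)[of v] v by (simp add: degree_of_inc)
    qed
    then show ?thesis
    proof (rule good_step[OF less.prems _ 4(3)])
      show "good (U - {g})" if "g \<in> U" for g by (rule IH) (use that in auto)
    qed
  qed
qed

lemma variance_le:
  assumes "U \<subseteq> E" "\<rho> \<in> colorings"
  shows "vsum (ext U \<rho>) (ssum U \<phi>) \<le> 11 * sum (sqs U \<phi>) (ext U \<rho>)"
proof -
  have "sum (nform U \<phi>) (ext U \<rho>) \<le> 10 * sum (sqs U \<phi>) (ext U \<rho>)"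
    by (rule sum_nform_le[OF assms(1) sum_bnd_le(2)[OF assms(1)]])
  moreover have "vsum (ext U \<rho>) (ssum U \<phi>) \<le>
      sum (sqs U \<phi>) (ext U \<rho>) + sum (nform U \<phi>) (ext U \<rho>)"
    using good_all[OF assms(1)] assms(2) unfolding good_def by blast
  ultimately show ?thesis by linarith
qed

end

section \<open>The local walk\<close>

text \<open>The vertices of the link decompose into parts indexed by \<open>U\<close>; the difference of two part
  indicators is an eigenvector of the walk with eigenvalue \<open>- 1 / (k - 1)\<close>.\<close>

lemma lambda2_walk_le:
  fixes A :: "('e \<Rightarrow> 'c) set" and U :: "'e set"
  assumes A: "finite A" "A \<noteq> {}" and U: "finite U" "card U \<ge> 2"
    and P: "\<And>x y. x \<in> pts U A \<Longrightarrow> y \<in> pts U A \<Longrightarrow>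
      P x y = (if x = y then 0 else real (card (fib (fib A x) y)) / ((real (card U) - 1) * wt A x))"
    and var: "\<And>\<phi>. vsum A (ssum U \<phi>) \<le> (1 + C) * sum (sqs U \<phi>) A"
  shows "lambda2 (pts U A) P \<le> C / (real (card U) - 1)"
proof -
  let ?X = "pts U A"
  define k where "k = real (card U)"
  have k: "k - 1 > 0" using U(2) by (simp add: k_def)
  define N where "N = (\<lambda>x y. real (card (fib (fib A x) y)))"
  have w: "wt A x > 0" if "x \<in> ?X" for x using wt_pos[OF A(1) that] .
  have Nsym: "N x y = N y x" for x y
  proof -
    have "fib (fib A x) y = fib (fib A y) x" by (auto simp: fib_def)
    then show ?thesis by (simp add: N_def)
  qed
  have Nxx: "N x x = wt A x" for x
  proof -
    have "fib (fib A x) x = fib A x" by (auto simp: fib_def)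
    then show ?thesis by (simp add: N_def wt_def)
  qed
  have Nrow: "(\<Sum>y\<in>?X. N x y * \<psi> y) = (\<Sum>s\<in>fib A x. ssum U \<psi> s)" for x \<psi>
    using sum_pts[OF A(1) U(1), of "fib A x" "\<lambda>_. \<psi>"] by (simp add: N_def ssum_def fib_def)
  \<comment> \<open>Since \<open>N x x = wt A x\<close>, subtracting the diagonal covers both cases:
    relative to the weights, \<open>N\<close> is \<open>1 + (k - 1) P\<close>.\<close>
  have P': "P x y = (N x y - (if x = y then wt A x else 0)) / ((k - 1) * wt A x)"
    if "x \<in> ?X" "y \<in> ?X" for x y
    using P[OF that] Nxx[of x] by (auto simp: N_def k_def)
  have wP: "wt A x * P x y = (N x y - (if x = y then wt A x else 0)) / (k - 1)"
    if "x \<in> ?X" "y \<in> ?X" for x y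
    using P'[OF that] w[OF that(1)] by simp
  have Prow: "(\<Sum>y\<in>?X. P x y * \<psi> y) = ((\<Sum>s\<in>fib A x. ssum U \<psi> s) - wt A x * \<psi> x) / ((k - 1) * wt A x)"
    if x: "x \<in> ?X" for x \<psi>
  proof -
    have "(\<Sum>y\<in>?X. P x y * \<psi> y) =
        (\<Sum>y\<in>?X. (N x y * \<psi> y - (if x = y then wt A x * \<psi> x else 0)) / ((k - 1) * wt A x))"
      by (intro sum.cong refl) (auto simp: P'[OF x] algebra_simps)
    also have "\<dots> = ((\<Sum>y\<in>?X. N x y * \<psi> y) - wt A x * \<psi> x) / ((k - 1) * wt A x)"
      using x A U by (simp add: sum_divide_distrib[symmetric] sum_subtractf)
    finally show ?thesis by (simp add: Nrow)
  qed
  obtain e f where ef: "e \<in> U" "f \<in> U" "e \<noteq> f"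
    using U(2) by (metis One_nat_def card_le_Suc0_iff_eq U(1) Suc_1 not_less_eq_eq)
  define \<psi> :: "'e \<times> 'c \<Rightarrow> real" where "\<psi> = (\<lambda>x. if fst x = e then 1 else if fst x = f then - 1 else 0)"
  \<comment> \<open>Each coloring uses exactly one pair from every part, so \<open>N\<close>
    annihilates \<open>\<psi>\<close> and only the subtracted diagonal is left.\<close>
  have S\<psi>: "ssum U \<psi> s = 0" for s
  proof -
    have "ssum U \<psi> s = (\<Sum>g\<in>U. (if g = e then 1 else 0) - (if g = f then 1 else 0))"
      unfolding ssum_def \<psi>_def using ef by (intro sum.cong refl) auto
    then show ?thesis using U ef by (simp add: sum_subtractf)
  qed
  show ?thesis
    unfolding k_def[symmetric]
  proof (rule lambda2_le[where w = "wt A" and \<psi> = \<psi> and r = "- 1 / (k - 1)"])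
    show "finite ?X" using A U by simp
    show "(\<Sum>y\<in>?X. P x y) = 1" if x: "x \<in> ?X" for x
    proof -
      have "(\<Sum>s\<in>fib A x. ssum U (\<lambda>_. 1) s) = k * wt A x" by (simp add: ssum_def k_def wt_def)
      then have "(\<Sum>y\<in>?X. P x y) = (k * wt A x - wt A x) / ((k - 1) * wt A x)"
        using Prow[OF x, of "\<lambda>_. 1"] by simp
      then show ?thesis using k w[OF x] by (simp add: left_diff_distrib)
    qed
    show "wt A x > 0" if "x \<in> ?X" for x using w that .
    show "wt A x * P x y = wt A y * P y x" if "x \<in> ?X" "y \<in> ?X" for x y
      using wP[OF that] wP[OF that(2,1)] Nsym[of x y] by auto
    show "(\<Sum>y\<in>?X. P x y * \<psi> y) = - 1 / (k - 1) * \<psi> x" if x: "x \<in> ?X" for x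
      using w[OF x] k by (simp add: Prow[OF x] S\<psi>)
    show "(\<Sum>x\<in>?X. wt A x * \<psi> x) = 0"
      using S\<psi> by (simp add: sum_pts_wt[OF A(1) U(1)] ssum_def)
    obtain s where "s \<in> A" using A by auto
    then show "\<exists>x\<in>?X. \<psi> x \<noteq> 0"
      using ef by (intro bexI[of _ "(e, s e)"]) (auto simp: \<psi>_def pts_def)
    fix \<phi> :: "'e \<times> 'c \<Rightarrow> real" assume mean0: "(\<Sum>x\<in>?X. wt A x * \<phi> x) = 0"
    let ?n = "\<Sum>x\<in>?X. wt A x * (\<phi> x)\<^sup>2"
    have n: "sum (sqs U \<phi>) A = ?n" by (rule sum_sqs_eq[OF A(1) U(1)])
    have "(\<Sum>s\<in>A. ssum U \<phi> s) = 0"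
      using mean0 by (simp add: sum_pts_wt[OF A(1) U(1)] ssum_def)
    then have m0: "mean A (ssum U \<phi>) = 0" by (simp add: mean_def)
    have "(\<Sum>x\<in>?X. \<Sum>y\<in>?X. wt A x * P x y * \<phi> x * \<phi> y) =
        (\<Sum>x\<in>?X. \<phi> x * (wt A x * (\<Sum>y\<in>?X. P x y * \<phi> y)))"
      unfolding sum_distrib_left by (intro sum.cong refl) (simp add: mult_ac)
    also have "\<dots> = (\<Sum>x\<in>?X. (\<phi> x * (\<Sum>s\<in>fib A x. ssum U \<phi> s) - wt A x * (\<phi> x)\<^sup>2) / (k - 1))"
    proof (intro sum.cong refl)
      fix x assume x: "x \<in> ?X"
      have "wt A x * (\<Sum>y\<in>?X. P x y * \<phi> y) = ((\<Sum>s\<in>fib A x. ssum U \<phi> s) - wt A x * \<phi> x) / (k - 1)"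
        using w[OF x] by (simp add: Prow[OF x])
      then show "\<phi> x * (wt A x * (\<Sum>y\<in>?X. P x y * \<phi> y)) =
          (\<phi> x * (\<Sum>s\<in>fib A x. ssum U \<phi> s) - wt A x * (\<phi> x)\<^sup>2) / (k - 1)"
        by (simp add: power2_eq_square right_diff_distrib mult_ac)
    qed
    also have "\<dots> = ((\<Sum>x\<in>?X. \<phi> x * (\<Sum>s\<in>fib A x. ssum U \<phi> s)) - ?n) / (k - 1)"
      by (simp add: sum_divide_distrib[symmetric] sum_subtractf)
    also have "(\<Sum>x\<in>?X. \<phi> x * (\<Sum>s\<in>fib A x. ssum U \<phi> s)) = (\<Sum>s\<in>A. (ssum U \<phi> s)\<^sup>2)"
      unfolding sum_distrib_left
      using sum_pts[OF A(1) U(1), of A "\<lambda>s x. \<phi> x * ssum U \<phi> s"]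
      by (simp add: power2_eq_square ssum_def sum_distrib_right)
    also have "(\<Sum>s\<in>A. (ssum U \<phi> s)\<^sup>2) = vsum A (ssum U \<phi>)"
      by (simp add: vsum_eq[OF A] m0)
    also have "(vsum A (ssum U \<phi>) - ?n) / (k - 1) \<le> ((1 + C) * ?n - ?n) / (k - 1)"
      using var[of \<phi>] k n by (intro divide_right_mono) auto
    also have "\<dots> = C / (k - 1) * ?n" by (simp add: distrib_right)
    finally show "(\<Sum>x\<in>?X. \<Sum>y\<in>?X. wt A x * P x y * \<phi> x * \<phi> y) \<le> C / (k - 1) * ?n" .
  qed
qed

lemma cond_pmf_of_set:
  assumes fin: "finite S" and ne: "S \<inter> B \<noteq> {}"
  shows "cond_pmf (pmf_of_set S) B = pmf_of_set (S \<inter> B)"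
proof (rule pmf_eqI)
  fix i
  have S: "S \<noteq> {}" "card S > 0" using ne fin by (auto simp: card_gt_0_iff)
  have "set_pmf (pmf_of_set S) \<inter> B \<noteq> {}" using ne S fin by simp
  from pmf_cond[OF this] show "pmf (cond_pmf (pmf_of_set S) B) i = pmf (pmf_of_set (S \<inter> B)) i"
    using S fin ne by (simp add: measure_pmf_of_set indicator_def)
qed

section \<open>Faces as pinned colorings and their links\<close>

context list_coloring
begin

definition graph :: "('v set \<Rightarrow> nat) \<Rightarrow> ('v set \<times> nat) set" where
  "graph s = (\<lambda>e. (e, s e)) ` E"

lemma graph_inj: "inj_on graph colorings"
proof (rule inj_onI)
  fix s s' assume "s \<in> colorings" "s' \<in> colorings" "graph s = graph s'"
  then show "s = s'"
    by (intro extensionalityI[of _ E]) (auto simp: colorings_def graph_def)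
qed

lemma facets_eq: "facets E L = graph ` colorings"
proof
  show "facets E L \<subseteq> graph ` colorings"
  proof
    fix F assume "F \<in> facets E L"
    then obtain s where s: "F = graph s" "proper_coloring E L s"
      by (auto simp: facets_def graph_def)
    have "restrict s E \<in> colorings" using s(2) by (simp add: colorings_def proper_coloring_def)
    moreover have "graph (restrict s E) = F" using s(1) by (simp add: graph_def)
    ultimately show "F \<in> graph ` colorings" by blast
  qed
qed (auto simp: facets_def graph_def colorings_def)

lemma complex_face:
  assumes "\<tau> \<in> coloring_complex E L"
  obtains U \<rho> where "U \<subseteq> E" "\<rho> \<in> colorings" "\<tau> = (\<lambda>e. (e, \<rho> e)) ` (E - U)"
proof -
  obtain \<rho> where \<rho>: "\<rho> \<in> colorings" "\<tau> \<subseteq> graph \<rho>"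
    using assms by (auto simp: coloring_complex_def facets_eq)
  show ?thesis
    by (rule that[of "{e \<in> E. (e, \<rho> e) \<notin> \<tau>}" \<rho>]) (use \<rho> in \<open>auto simp: graph_def\<close>)
qed

lemma link_facts:
  assumes U: "U \<subseteq> E" and \<rho>: "\<rho> \<in> colorings"
  defines "\<tau> \<equiv> (\<lambda>e. (e, \<rho> e)) ` (E - U)"
  shows "codim E \<tau> = card U" "link_vertices E L \<tau> = pts U (ext U \<rho>)"
    "\<And>x y. x \<in> pts U (ext U \<rho>) \<Longrightarrow> y \<in> pts U (ext U \<rho>) \<Longrightarrow> local_walk E L \<tau> x y =
      (if x = y then 0 else real (card (fib (fib (ext U \<rho>) x) y)) / ((real (card U) - 1) * wt (ext U \<rho>) x))"
proof -
  let ?A = "ext U \<rho>"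
  have "card \<tau> = card (E - U)" unfolding \<tau>_def by (rule card_image) (auto simp: inj_on_def)
  also have "\<dots> = card E - card U" using U finite_sub[OF U] by (simp add: card_Diff_subset)
  finally show cod: "codim E \<tau> = card U"
    using card_mono[OF finite_E U] by (simp add: codim_def)
  have sub: "\<tau> \<subseteq> graph s \<longleftrightarrow> s \<in> ?A" if "s \<in> colorings" for s
    using that by (auto simp: \<tau>_def graph_def ext_def)
  show link: "link_vertices E L \<tau> = pts U ?A"
  proof (intro Set.set_eqI iffI)
    fix x assume "x \<in> link_vertices E L \<tau>"
    then obtain s where x: "x \<notin> \<tau>" and s: "s \<in> colorings" "insert x \<tau> \<subseteq> graph s"
      by (auto simp: link_vertices_def coloring_complex_def facets_eq)
    then have "s \<in> ?A" using sub by auto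
    moreover obtain e where e: "e \<in> E" "x = (e, s e)" using s by (auto simp: graph_def)
    moreover have "e \<in> U"
    proof (rule ccontr)
      assume "e \<notin> U"
      then have "x = (e, \<rho> e)" using e \<open>s \<in> ?A\<close> by (simp add: ext_def)
      then show False using x e \<open>e \<notin> U\<close> by (auto simp: \<tau>_def)
    qed
    ultimately show "x \<in> pts U ?A" by (auto simp: pts_def)
  next
    fix x assume "x \<in> pts U ?A"
    then obtain s e where x: "s \<in> ?A" "e \<in> U" "x = (e, s e)" by (auto simp: pts_def)
    then have "s \<in> colorings" by (simp add: ext_def)
    moreover have "insert x \<tau> \<subseteq> graph s"
      using sub[OF \<open>s \<in> colorings\<close>] x U by (auto simp: graph_def)
    moreover have "x \<notin> \<tau>" using x by (auto simp: \<tau>_def)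
    ultimately show "x \<in> link_vertices E L \<tau>"
      by (auto simp: link_vertices_def coloring_complex_def facets_eq)
  qed
  fix x y assume xy: "x \<in> pts U ?A" "y \<in> pts U ?A"
  have fibA: "fib ?A x \<subseteq> colorings" by (auto simp: fib_def ext_def)
  have in_graph: "z \<in> graph s \<longleftrightarrow> s (fst z) = snd z" if "z \<in> pts U ?A" for z s
    using that U by (force simp: graph_def pts_def)
  have cond: "facets E L \<inter> {F. insert x \<tau> \<subseteq> F} = graph ` fib ?A x"
  proof -
    have "insert x \<tau> \<subseteq> graph s \<longleftrightarrow> s \<in> fib ?A x" if "s \<in> colorings" for s
      using sub[OF that] in_graph[OF xy(1)] by (auto simp: fib_def)
    then show ?thesis unfolding facets_eq using fibA by auto
  qed
  have fac: "finite (facets E L)" by (simp add: facets_eq)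
  have ne: "graph ` fib ?A x \<noteq> {}" using fib_nonempty[OF xy(1)] by simp
  have fin: "finite (graph ` fib ?A x)" by simp
  have card: "card (graph ` B) = card B" if "B \<subseteq> fib ?A x" for B
    using that fibA graph_inj by (meson card_image inj_on_subset subset_trans)
  have y: "graph ` fib ?A x \<inter> {F. y \<in> F} = graph ` fib (fib ?A x) y"
    using in_graph[OF xy(2)] by (auto simp: fib_def)
  have "cond_pmf (facet_distribution E L) {F. insert x \<tau> \<subseteq> F} = pmf_of_set (graph ` fib ?A x)"
    unfolding facet_distribution_def cond[symmetric]
    by (rule cond_pmf_of_set[OF fac]) (unfold cond, rule ne)
  then have "measure_pmf.prob (cond_pmf (facet_distribution E L) {F. insert x \<tau> \<subseteq> F}) {F. y \<in> F} =
      real (card (graph ` fib (fib ?A x) y)) / real (card (graph ` fib ?A x))"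
    by (simp only: measure_pmf_of_set[OF ne fin] y)
  also have "\<dots> = real (card (fib (fib ?A x) y)) / wt ?A x"
  proof -
    have "fib (fib ?A x) y \<subseteq> fib ?A x" by (auto simp: fib_def)
    then show ?thesis by (simp only: card wt_def subset_refl)
  qed
  finally have eq: "measure_pmf.prob (cond_pmf (facet_distribution E L) {F. insert x \<tau> \<subseteq> F}) {F. y \<in> F} = \<dots>" .
  show "local_walk E L \<tau> x y =
      (if x = y then 0 else real (card (fib (fib ?A x) y)) / ((real (card U) - 1) * wt ?A x))"
    unfolding local_walk_def cod eq by simp
qed

end

text \<open>A bootstrap: \<open>d \<ge> 2\<close> gives \<open>ln d \<ge> 2 / 3\<close> and so
  \<open>d\<close> above 6000, hence above \<open>2 ^ 12\<close>; then \<open>ln d \<ge> 8\<close>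
  and \<open>d \<ge> 960000\<close>.\<close>

lemma max_degree_large:
  fixes d :: nat and \<epsilon> :: real
  assumes eps: "0 < \<epsilon>" "\<epsilon> \<le> 1 / 10" and le: "(ln (real d))\<^sup>2 / real d \<le> \<epsilon> ^ 3 / 15" and d: "d \<ge> 2"
  shows "d \<ge> 400000"
proof -
  have "\<epsilon> ^ 3 \<le> (1 / 10) ^ 3" using eps by (intro power_mono) auto
  also have "(1 / 10) ^ 3 = (1 / 1000 :: real)" by (simp add: power3_eq_cube)
  finally have "(ln (real d))\<^sup>2 / real d \<le> 1 / 15000" using le by linarith
  then have key: "15000 * (ln (real d))\<^sup>2 \<le> real d" using d by (simp add: field_simps)
  have grow: "15000 * (2 / 3 * real n)\<^sup>2 \<le> real d" if n: "2 ^ n \<le> real d" for n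
  proof -
    have "2 / 3 * real n \<le> real n * ln 2" using mult_left_mono[OF ln2_ge_two_thirds, of "real n"] by simp
    also have "\<dots> = ln (2 ^ n)" by (simp add: ln_realpow)
    also have "\<dots> \<le> ln (real d)" using n d by simp
    finally have "(2 / 3 * real n)\<^sup>2 \<le> (ln (real d))\<^sup>2" by (intro power_mono) auto
    then show ?thesis using key by linarith
  qed
  have "real d \<ge> 15000 * (2 / 3 * real 1)\<^sup>2" using grow[of 1] d by simp
  then have "2 ^ 12 \<le> real d" by (simp add: power2_eq_square)
  from grow[OF this] show ?thesis by (simp add: power2_eq_square)
qed

theorem theorem5p3:
  fixes V :: "'v set" and E :: "'v set set" and q :: nat
    and L :: "'v set \<Rightarrow> nat set" and \<epsilon> :: real
    and k :: nat and \<tau> :: "('v set \<times> nat) set"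
  assumes "0 < \<epsilon>" and "\<epsilon> \<le> 1 / 10"
    and "edge_list_instance V E q L"
    and "extra_color ((4 / 3 + 4 * \<epsilon>) * real (max_degree V E)) E L"
    and "(ln (real (max_degree V E)))\<^sup>2 / real (max_degree V E) \<le> \<epsilon> ^ 3 / 15"
    and "2 \<le> k" and "k \<le> card E"
    and "\<tau> \<in> coloring_complex E L" and "codim E \<tau> = k"
  shows "lambda2 (link_vertices E L \<tau>) (local_walk E L \<tau>) \<le> (\<epsilon> + 1 / \<epsilon>) / (real k - 1)"
proof -
  define \<Delta> where "\<Delta> = max_degree V E"
  have V: "finite V" and E: "\<And>e. e \<in> E \<Longrightarrow> e \<subseteq> V \<and> card e = 2" and L: "\<And>e. e \<in> E \<Longrightarrow> L e \<subseteq> {1..q}"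
    using assms(3) by (auto simp: edge_list_instance_def simple_graph_def)
  have finE: "finite E" using E V by (intro finite_subset[of E "Pow V"]) auto
  have deg: "degree_of E v \<le> \<Delta>" for v
  proof (cases "v \<in> V")
    case True
    then show ?thesis using V by (auto simp: \<Delta>_def max_degree_def intro: Max_ge)
  next
    case False
    then have "{e \<in> E. v \<in> e} = {}" using E by blast
    then show ?thesis by (simp only: degree_of_def card.empty)
  qed
  have "E \<noteq> {}" using assms(6,7) by auto
  then obtain e where e: "e \<in> E" by auto
  then obtain v where "v \<in> e" using E[OF e] by (metis card.empty equals0I zero_neq_numeral)
  then have "{e \<in> E. v \<in> e} \<noteq> {}" using e by auto
  then have "degree_of E v \<ge> 1" using finE by (simp add: degree_of_def Suc_le_eq card_gt_0_iff)
  then have D1: "\<Delta> \<ge> 1" using deg[of v] by simp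
  have large: "\<Delta> \<le> 1 \<or> \<Delta> \<ge> 400000"
    using max_degree_large[OF assms(1,2,5)] unfolding \<Delta>_def by linarith
  have extra: "real (card (L e)) \<ge> 4 / 3 * real \<Delta> + real (edge_degree E e)" if "e \<in> E" for e
  proof -
    have "4 / 3 * real \<Delta> \<le> (4 / 3 + 4 * \<epsilon>) * real \<Delta>" using assms(1) by (intro mult_right_mono) auto
    then show ?thesis using assms(4) that by (fastforce simp: extra_color_def \<Delta>_def)
  qed
  interpret list_coloring_large E L \<Delta>
  proof
    show "finite (L e)" if "e \<in> E" for e using L[OF that] finite_subset by blast
    show "card e = 2" if "e \<in> E" for e using E that by blast
  qed (fact finE deg D1 large extra)+
  obtain U \<rho> where U: "U \<subseteq> E" and \<rho>: "\<rho> \<in> colorings" and \<tau>: "\<tau> = (\<lambda>e. (e, \<rho> e)) ` (E - U)"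
    using complex_face[OF assms(8)] by blast
  note facts = link_facts[OF U \<rho>, folded \<tau>]
  have k: "card U = k" using facts(1) assms(9) by simp
  have "\<rho> \<in> ext U \<rho>" using \<rho> by (simp add: ext_def)
  then have "lambda2 (pts U (ext U \<rho>)) (local_walk E L \<tau>) \<le> 10 / (real (card U) - 1)"
    using assms(6) k variance_le[OF U \<rho>]
    by (intro lambda2_walk_le[OF finite_ext _ finite_sub[OF U] _ facts(3)]) auto
  also have "\<dots> \<le> (\<epsilon> + 1 / \<epsilon>) / (real (card U) - 1)"
  proof (intro divide_right_mono)
    have "10 \<le> 1 / \<epsilon>" using assms(1,2) by (simp add: field_simps)
    then show "10 \<le> \<epsilon> + 1 / \<epsilon>" using assms(1) by simp
  qed (use assms(6) k in simp)
  finally show ?thesis unfolding facts(2) k .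
qed

end
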